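(* The following three configurations are unsplittable: - the Fano plane $(7_3)$, whose Levi graph is the Heawood graph $H(7,\{0,1,3\})$; - the Möbius–Kantor configuration $(8_3)$, whose Levi graph is $H(8,\{0,1,3\})\cong GP(8,3)$; - the Desargues configuration $(10_3)$, whose Levi graph is $GP(10,3)$. Moreover, let $n\ge 9$ and let $\mathcal{C}$ be a flag-transitive $(n_3)$ configuration whose Levi graph is a connected bicirculant. If $\mathcal{C}$ is not the Desargues configuration, then $\mathcal{C}$ is splittable.
   Context: A combinatorial $(n_3)$ configuration consists of $n$ points and $n$ lines with an incidence relation such that: - each line has 3 points; - each point lies on 3 lines; - two distinct points lie on at most one common line. Its Levi graph is the bipartite point–line incidence graph, a cubic graph of girth at least 6. Following the paper, an $(n_3)$ configuration is called flag-transitive if its Levi graph is a cubic symmetric (arc-transitive) graph. A graph is a bicirculant if it has an automorphism with exactly two orbits on vertices, the two orbits having equal size, which acts cyclically on each orbit. For a positive integer $m$ and $S\subseteq\mathbb{Z}_m$, the cyclic Haar graph $H(m,S)$ has vertex set $\{i^+\}\cup\{i^-\}$ for $i\in\mathbb{Z}_m$. Its edges join $i^+$ to $(i+k)^-$ for $k\in S$. The generalized Petersen graph $GP(m,k)$ has vertices $0,\dots,m-1,0',\dots,(m-1)'$. Its edges are $\{i',((i+1)\bmod m)'\}$, $\{i,i'\}$ and $\{i,(i+k)\bmod m\}$ for $i=0,\dots,m-1$. The square $G^2$ of a graph $G$ joins two distinct vertices iff their distance in $G$ is at most 2. A configuration is splittable if its Levi graph $L$ contains a set $\Sigma$ of vertices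 independent in $L^2$ with $L-\Sigma$ disconnected, and unsplittable otherwise. *)

theory Defs
  imports "Graph_Theory.Graph_Theory" "HOL-Combinatorics.Orbits"
begin

section \<open>Graphs\<close>

text \<open>
  Undirected simple graphs are symmetric loop-free digraphs without parallel arcs, that is,
  instances of \<^locale>\<open>pair_graph\<close>. The library's \<^const>\<open>symmetric\<close> only says that the arc
  relation is symmetric; it is unrelated to arc-transitivity.
\<close>

definition undirected :: "'a set \<Rightarrow> 'a rel \<Rightarrow> 'a pair_pre_digraph" where
  "undirected V E = \<lparr> pverts = V, parcs = E \<union> E\<inverse> \<rparr>"

definition graph_iso :: "'a pair_pre_digraph \<Rightarrow> 'b pair_pre_digraph \<Rightarrow> bool" where
  "graph_iso G H \<longleftrightarrow> digraph_iso (with_proj G) (with_proj H)"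

text \<open>Automorphisms are permutations of the whole type that fix everything outside the graph.\<close>

definition automorphism :: "'a pair_pre_digraph \<Rightarrow> ('a \<Rightarrow> 'a) \<Rightarrow> bool" where
  "automorphism G f \<longleftrightarrow> f permutes pverts G \<and>
     (\<forall>u \<in> pverts G. \<forall>v \<in> pverts G. (f u, f v) \<in> parcs G \<longleftrightarrow> (u, v) \<in> parcs G)"

definition cubic :: "'a pair_pre_digraph \<Rightarrow> bool" where
  "cubic G \<longleftrightarrow> (\<forall>v \<in> pverts G. out_degree (with_proj G) v = 3)"

definition arc_transitive :: "'a pair_pre_digraph \<Rightarrow> bool" where
  "arc_transitive G \<longleftrightarrow> (\<forall>(u, v) \<in> parcs G. \<forall>(x, y) \<in> parcs G.
     \<exists>f. automorphism G f \<and> f u = x \<and> f v = y)"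

definition bicirculant :: "'a pair_pre_digraph \<Rightarrow> bool" where
  "bicirculant G \<longleftrightarrow> (\<exists>f A B. automorphism G f \<and>
     pverts G = A \<union> B \<and> A \<inter> B = {} \<and> card A = card B \<and> cyclic_on f A \<and> cyclic_on f B)"

definition graph_dist :: "'a pair_pre_digraph \<Rightarrow> 'a \<Rightarrow> 'a \<Rightarrow> ereal" where
  "graph_dist G = wf_digraph.\<mu> (with_proj G) (\<lambda>_. 1)"

definition graph_square :: "'a pair_pre_digraph \<Rightarrow> 'a pair_pre_digraph" where
  "graph_square G = \<lparr> pverts = pverts G,
     parcs = {(u, v). u \<in> pverts G \<and> v \<in> pverts G \<and> u \<noteq> v \<and> graph_dist G u v \<le> 2} \<rparr>"

definition independent_set :: "'a pair_pre_digraph \<Rightarrow> 'a set \<Rightarrow> bool" where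
  "independent_set G S \<longleftrightarrow> S \<subseteq> pverts G \<and> (\<forall>u \<in> S. \<forall>v \<in> S. (u, v) \<notin> parcs G)"

text \<open>The library's \<^const>\<open>connected\<close> is false for the null graph, which is not counted as
  disconnected here.\<close>

definition disconnected :: "('a, 'b) pre_digraph \<Rightarrow> bool" where
  "disconnected G \<longleftrightarrow> verts G \<noteq> {} \<and> \<not> connected G"

definition splittable_graph :: "'a pair_pre_digraph \<Rightarrow> bool" where
  "splittable_graph G \<longleftrightarrow> (\<exists>S. independent_set (graph_square G) S \<and>
     disconnected (with_proj G \<restriction> (pverts G - S)))"

text \<open>In \<open>haar_graph m S\<close> the vertices \<open>Inl i\<close> and \<open>Inr i\<close> stand for $i^+$ and $i^-$; in
  \<open>gen_petersen m k\<close> they stand for $i$ and $i'$. Residues modulo \<open>m\<close> are represented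
  by \<open>{..<m}\<close>.\<close>

definition haar_graph :: "nat \<Rightarrow> nat set \<Rightarrow> (nat + nat) pair_pre_digraph" where
  "haar_graph m S = undirected ({..<m} <+> {..<m})
     {(Inl i, Inr ((i + k) mod m)) | i k. i < m \<and> k \<in> S}"

definition gen_petersen :: "nat \<Rightarrow> nat \<Rightarrow> (nat + nat) pair_pre_digraph" where
  "gen_petersen m k = undirected ({..<m} <+> {..<m})
     ({(Inr i, Inr ((i + 1) mod m)) | i. i < m} \<union>
      {(Inl i, Inr i) | i. i < m} \<union>
      {(Inl i, Inl ((i + k) mod m)) | i. i < m})"


section \<open>Configurations\<close>

record ('p, 'l) incidence_structure =
  points :: "'p set"
  blocks :: "'l set"
  incidence :: "('p \<times> 'l) set"

definition configuration3 :: "nat \<Rightarrow> ('p, 'l) incidence_structure \<Rightarrow> bool" where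
  "configuration3 n C \<longleftrightarrow>
     finite (points C) \<and> card (points C) = n \<and>
     finite (blocks C) \<and> card (blocks C) = n \<and>
     incidence C \<subseteq> points C \<times> blocks C \<and>
     (\<forall>l \<in> blocks C. card {p \<in> points C. (p, l) \<in> incidence C} = 3) \<and>
     (\<forall>p \<in> points C. card {l \<in> blocks C. (p, l) \<in> incidence C} = 3) \<and>
     (\<forall>p \<in> points C. \<forall>q \<in> points C. p \<noteq> q \<longrightarrow>
        card {l \<in> blocks C. (p, l) \<in> incidence C \<and> (q, l) \<in> incidence C} \<le> 1)"

definition configuration_iso ::
    "('p, 'l) incidence_structure \<Rightarrow> ('q, 'm) incidence_structure \<Rightarrow> bool" where
  "configuration_iso C D \<longleftrightarrow> (\<exists>f g. bij_betw f (points C) (points D) \<and>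
     bij_betw g (blocks C) (blocks D) \<and>
     (\<forall>p \<in> points C. \<forall>l \<in> blocks C. (f p, g l) \<in> incidence D \<longleftrightarrow> (p, l) \<in> incidence C))"

definition levi_graph :: "('p, 'l) incidence_structure \<Rightarrow> ('p + 'l) pair_pre_digraph" where
  "levi_graph C = undirected (points C <+> blocks C)
     {(Inl p, Inr l) | p l. (p, l) \<in> incidence C}"

definition flag_transitive :: "('p, 'l) incidence_structure \<Rightarrow> bool" where
  "flag_transitive C \<longleftrightarrow> cubic (levi_graph C) \<and> arc_transitive (levi_graph C)"

definition splittable :: "('p, 'l) incidence_structure \<Rightarrow> bool" where
  "splittable C \<longleftrightarrow> splittable_graph (levi_graph C)"

abbreviation unsplittable :: "('p, 'l) incidence_structure \<Rightarrow> bool" where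
  "unsplittable C \<equiv> \<not> splittable C"

text \<open>The projective plane over the field with two elements, in homogeneous coordinates for
  points and lines.\<close>

definition fano :: "(nat \<times> nat \<times> nat, nat \<times> nat \<times> nat) incidence_structure" where
  "fano = (let V = {0, 1} \<times> {0, 1} \<times> {0, 1} - {(0, 0, 0)} in
     \<lparr> points = V, blocks = V,
       incidence = {((x, y, z), (a, b, c)) | x y z a b c.
         (x, y, z) \<in> V \<and> (a, b, c) \<in> V \<and> even (a * x + b * y + c * z)} \<rparr>)"

text \<open>The affine plane over the field with three elements with the origin and the four lines
  through it deleted; the pair \<open>(a, b)\<close> stands for the line $ax + by = 1$.\<close>

definition moebius_kantor :: "(nat \<times> nat, nat \<times> nat) incidence_structure" where
  "moebius_kantor = (let V = {0, 1, 2} \<times> {0, 1, 2} - {(0, 0)} in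
     \<lparr> points = V, blocks = V,
       incidence = {((x, y), (a, b)) | x y a b.
         (x, y) \<in> V \<and> (a, b) \<in> V \<and> (a * x + b * y) mod 3 = 1} \<rparr>)"

text \<open>The section of five points in general position in space by a generic plane: the points
  come from the ten lines and the lines from the ten planes spanned by the five points.\<close>

definition desargues :: "(nat set, nat set) incidence_structure" where
  "desargues = (let P = {p. p \<subseteq> {..<5} \<and> card p = 2}; L = {l. l \<subseteq> {..<5} \<and> card l = 3} in
     \<lparr> points = P, blocks = L, incidence = {(p, l). p \<in> P \<and> l \<in> L \<and> p \<subseteq> l} \<rparr>)"

end

theory Submission
  imports Defs
begin

text \<open>
  Deleting the neighbours of a cycle cuts the cycle off, and this is a splitting if these neighbours
  are pairwise at distance at least three. For a hexagon in a cubic bipartite graph without 4-cycles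
  this only fails if some path of length two on it lies on a second hexagon. In an arc-transitive
  cubic graph all paths of length two are equivalent, so the graph is splittable as soon as one of
  them lies on exactly one hexagon.

  An automorphism with two orbits of equal size, acting cyclically on each, makes the Levi graph
  a cyclic Haar graph or an I-graph, where further hexagons correspond to linear relations modulo \<open>n\<close>
  between two step lengths. Two independent relations bound \<open>n\<close> by their determinant. For Haar graphs
  with \<open>n \<ge> 9\<close> this leaves \<open>H(9, {0, 1, 3})\<close>, where the numbers of hexagons through paths of length two
  differ. For I-graphs with several kinds of hexagons it leaves the Desargues graph. In an I-graph
  without hexagons, the octagon \<open>u\<^sub>0 u\<^sub>x v\<^sub>x v\<^sub>x\<^sub>+\<^sub>y u\<^sub>x\<^sub>+\<^sub>y u\<^sub>y v\<^sub>y v\<^sub>0\<close> plays the role of the hexagon.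
  If it is not cut off by a splitting, arc-transitivity leads to one of five graphs \<open>GP(n, 5)\<close>.
  Of these, \<open>GP(24, 5)\<close> has an explicit splitting, and in the other four the numbers of vertices
  opposite to the middle of a path of length two differ.
\<close>

section \<open>Splittings, walks and automorphisms\<close>

text \<open>Neither step length need be a unit modulo \<open>n\<close>, so in general no step can be
  normalised to 1. What connectedness gives instead is that \<open>n\<close>, \<open>x\<close> and
  \<open>y\<close> have no common divisor, and this is just what the determinant bound needs. The
  hypothesis \<open>9 \<le> n\<close> enters there: apart from 9 and 10, the determinants of the
  pairs of hexagon relations to be compared are at most 8 in absolute value. It also guarantees 18
  vertices, more than the 12 or 16 in a hexagon or octagon together with its neighbours. Without
  hexagons, the octagon fails to split only if one step length is plus or minus five times the
  other. A second relation comes from transitivity: the octagon passes through a spoke, so some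
  octagon must also contain two consecutive steps inside one orbit. The determinants with these
  further relations leave finitely many \<open>n\<close>. Recognising the Desargues graph is not yet
  recognising the configuration, since an isomorphism of Levi graphs may exchange points and lines;
  a rotation that exchanges the two colours repairs this.\<close>

lemma (in pair_wf_digraph) awalk_unit_cost_le_2_iff:
  "(\<exists>p. awalk u p v \<and> awalk_cost (\<lambda>_. 1) p \<le> 2) \<longleftrightarrow>
    u \<in> pverts G \<and> (u = v \<or> (u, v) \<in> parcs G \<or> (\<exists>w. (u, w) \<in> parcs G \<and> (w, v) \<in> parcs G))"
    (is "?L \<longleftrightarrow> ?R")
proof
  assume ?L
  then obtain p where p: "awalk u p v" "awalk_cost (\<lambda>_. 1) p \<le> 2"
    by blast
  have "awalk_cost (\<lambda>_. 1) q = length q" for q :: "('a \<times> 'a) list"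
    by (induction q) auto
  then have "length p \<le> 2"
    using p(2) by simp
  then consider "p = []" | e where "p = [e]" | e f where "p = [e, f]"
    by (cases p; cases "tl p") (auto simp: Suc_le_eq)
  then show ?R
    using p(1) by cases (auto simp: awalk_def cas_simp)
next
  assume ?R
  then have "awalk u [] v \<or> awalk u [(u, v)] v \<or> (\<exists>w. awalk u [(u, w), (w, v)] v)"
    by (auto simp: awalk_def cas_simp)
  then show ?L
    by (elim disjE exE) (force intro: exI)+
qed

lemma (in pair_wf_digraph) graph_dist_le_2_iff:
  "graph_dist G u v \<le> 2 \<longleftrightarrow>
    u \<in> pverts G \<and> (u = v \<or> (u, v) \<in> parcs G \<or> (\<exists>w. (u, w) \<in> parcs G \<and> (w, v) \<in> parcs G))"
proof -
  have "awalk_cost (\<lambda>_. 1) q = real (length q)" for q :: "('a \<times> 'a) list"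
    by (induction q) auto
  \<comment> \<open>Costs are integers: if every walk cost more than 2, the infimum
    \<open>\<mu>\<close> would be at least 3.\<close>
  then have *: "(\<not> awalk_cost (\<lambda>_. 1) p \<le> 2) \<longleftrightarrow> 3 \<le> awalk_cost (\<lambda>_. 1) p" for p :: "('a \<times> 'a) list"
    by simp linarith
  have "graph_dist G u v \<le> 2 \<longleftrightarrow> (\<exists>p. awalk u p v \<and> awalk_cost (\<lambda>_. 1) p \<le> 2)"
  proof
    assume "graph_dist G u v \<le> 2"
    show "\<exists>p. awalk u p v \<and> awalk_cost (\<lambda>_. 1) p \<le> 2"
    proof (rule ccontr)
      assume "\<not> ?thesis"
      then have "3 \<le> graph_dist G u v"
        unfolding graph_dist_def \<mu>_def by (intro INF_greatest) (auto simp: *)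
      then show False
        using order_trans[OF _ \<open>graph_dist G u v \<le> 2\<close>] by fastforce
    qed
  next
    assume "\<exists>p. awalk u p v \<and> awalk_cost (\<lambda>_. 1) p \<le> 2"
    then obtain p where p: "awalk u p v" "ereal (awalk_cost (\<lambda>_. 1) p) \<le> 2"
      by auto
    show "graph_dist G u v \<le> 2"
      unfolding graph_dist_def by (rule order_trans[OF min_cost_le_walk_cost[OF p(1)] p(2)])
  qed
  then show ?thesis
    by (simp add: awalk_unit_cost_le_2_iff)
qed

lemma (in pair_sym_digraph) sym_parcs: "(x, y) \<in> parcs G \<Longrightarrow> (y, x) \<in> parcs G"
  using pair_sym_arcs by (auto simp: symmetric_def elim: symE)

lemma (in pair_sym_digraph) sym_parcs_disj: "(x, y) \<in> parcs G \<or> (y, x) \<in> parcs G \<longleftrightarrow> (x, y) \<in> parcs G"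
  using sym_parcs by blast

text \<open>A cut is easier to exhibit, and to refute, as a set closed under adjacency than as a
  pair of vertices without a walk. From such a pair, \<open>K\<close> is obtained as what is
  reachable from \<open>u\<close>.\<close>

lemma disconnected_restrict_iff:
  fixes G :: "'a pair_pre_digraph"
  shows "disconnected (with_proj G \<restriction> W) \<longleftrightarrow>
    (\<exists>K. K \<noteq> {} \<and> K \<subset> W \<and>
      (\<forall>x \<in> K. \<forall>y \<in> W. (x, y) \<in> parcs G \<or> (y, x) \<in> parcs G \<longrightarrow> y \<in> K))"
    (is "?L \<longleftrightarrow> ?R")
proof -
  define H where "H = mk_symmetric (with_proj G \<restriction> W)"
  have verts: "pverts H = W"
    by (simp add: H_def)
  have arcs: "(x, y) \<in> parcs H \<longleftrightarrow> x \<in> W \<and> y \<in> W \<and> ((x, y) \<in> parcs G \<or> (y, x) \<in> parcs G)" for x y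
    by (auto simp: H_def parcs_mk_symmetric)
  have conn: "connected (with_proj G \<restriction> W) \<longleftrightarrow>
      W \<noteq> {} \<and> (\<forall>u\<in>W. \<forall>v\<in>W. (u, v) \<in> rtrancl_on W (parcs H))"
    by (simp add: connected_def strongly_connected_def reachable_def verts flip: H_def)
  show ?thesis
  proof
    assume ?L
    then obtain u v where uv: "u \<in> W" "v \<in> W" "(u, v) \<notin> rtrancl_on W (parcs H)"
      by (auto simp: disconnected_def conn)
    let ?K = "{x \<in> W. (u, x) \<in> rtrancl_on W (parcs H)}"
    have "y \<in> ?K" if "x \<in> ?K" "y \<in> W" "(x, y) \<in> parcs G \<or> (y, x) \<in> parcs G" for x y
      using that rtrancl_on_into_rtrancl_on[of u x W "parcs H" y] by (auto simp: arcs)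
    then show ?R
      using uv by (intro exI[of _ ?K]) auto
  next
    assume ?R
    then obtain K where K: "K \<noteq> {}" "K \<subset> W"
      "\<forall>x \<in> K. \<forall>y \<in> W. (x, y) \<in> parcs G \<or> (y, x) \<in> parcs G \<longrightarrow> y \<in> K"
      by blast
    then obtain u v where uv: "u \<in> K" "v \<in> W - K"
      by blast
    have "y \<in> K" if "(x, y) \<in> rtrancl_on W (parcs H)" "x \<in> K" for x y
      using that
    proof (induction rule: rtrancl_on_induct)
      case (step y z)
      then show ?case
        using K(3) arcs[of y z] by blast
    qed
    then have "(u, v) \<notin> rtrancl_on W (parcs H)"
      using uv by blast
    then show ?L
      using uv K(2) unfolding disconnected_def conn by auto
  qed
qed

lemma (in pair_sym_digraph) splittable_graph_iff:
  "splittable_graph G \<longleftrightarrow> (\<exists>S K. S \<subseteq> pverts G \<and>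
     (\<forall>u \<in> S. \<forall>v \<in> S. u \<noteq> v \<longrightarrow> (u, v) \<notin> parcs G \<and> \<not> (\<exists>w. (u, w) \<in> parcs G \<and> (w, v) \<in> parcs G)) \<and>
     K \<noteq> {} \<and> K \<subset> pverts G - S \<and> (\<forall>x \<in> K. \<forall>y. (x, y) \<in> parcs G \<longrightarrow> y \<in> K \<union> S))"
proof -
  have "independent_set (graph_square G) S \<longleftrightarrow> S \<subseteq> pverts G \<and>
     (\<forall>u \<in> S. \<forall>v \<in> S. u \<noteq> v \<longrightarrow> (u, v) \<notin> parcs G \<and> \<not> (\<exists>w. (u, w) \<in> parcs G \<and> (w, v) \<in> parcs G))" for S
    unfolding independent_set_def graph_square_def graph_dist_le_2_iff by auto
  moreover have "disconnected (with_proj G \<restriction> (pverts G - S)) \<longleftrightarrow>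
     (\<exists>K. K \<noteq> {} \<and> K \<subset> pverts G - S \<and> (\<forall>x \<in> K. \<forall>y. (x, y) \<in> parcs G \<longrightarrow> y \<in> K \<union> S))" for S
    unfolding disconnected_restrict_iff sym_parcs_disj
    by (rule ex_cong) (auto dest: in_arcsD2)
  ultimately show ?thesis
    unfolding splittable_graph_def by simp
qed

lemma (in pair_wf_digraph) connected_closed_set:
  assumes "connected (with_proj G)" "K \<noteq> {}" "K \<subseteq> pverts G"
    "\<And>x y. x \<in> K \<Longrightarrow> (x, y) \<in> parcs G \<or> (y, x) \<in> parcs G \<Longrightarrow> y \<in> K"
  shows "K = pverts G"
proof (rule ccontr)
  assume "K \<noteq> pverts G"
  then have "disconnected (with_proj G \<restriction> pverts G)"
    unfolding disconnected_restrict_iff using assms by (intro exI[of _ K]) auto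
  moreover have "with_proj G \<restriction> pverts G = with_proj G"
    by (auto simp: induce_subgraph_def with_proj_def dest: in_arcsD1 in_arcsD2)
  ultimately show False
    using assms(1) by (simp add: disconnected_def)
qed

section \<open>Antipode counts as an invariant of paths of length two\<close>

primrec walks_to :: "'a pair_pre_digraph \<Rightarrow> nat \<Rightarrow> 'a \<Rightarrow> 'a set" where
  "walks_to G 0 x = {x}"
| "walks_to G (Suc k) x = (\<Union>y \<in> {y. (x, y) \<in> parcs G}. walks_to G k y)"

text \<open>In a cubic graph of girth at least \<open>2 * k\<close>, these are the vertices opposite to \<open>b\<close> on
  the cycles of length \<open>2 * k\<close> through the path \<open>a\<close>, \<open>b\<close>, \<open>c\<close>.\<close>

definition antipodes :: "'a pair_pre_digraph \<Rightarrow> nat \<Rightarrow> 'a \<Rightarrow> 'a \<Rightarrow> 'a \<Rightarrow> 'a set" where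
  "antipodes G k a b c = walks_to G k a \<inter> walks_to G k c - walks_to G (k - 1) b"

lemma antipodes_commute: "antipodes G k a b c = antipodes G k c b a"
  by (auto simp: antipodes_def)

lemma (in pair_wf_digraph) neighbours_automorphism:
  assumes "automorphism G f" "x \<in> pverts G"
  shows "{y. (f x, y) \<in> parcs G} = f ` {y. (x, y) \<in> parcs G}"
proof (intro equalityI subsetI)
  have f: "f permutes pverts G"
    "\<And>u v. u \<in> pverts G \<Longrightarrow> v \<in> pverts G \<Longrightarrow> (f u, f v) \<in> parcs G \<longleftrightarrow> (u, v) \<in> parcs G"
    using assms(1) by (auto simp: automorphism_def)
  {
    fix y assume "y \<in> {y. (f x, y) \<in> parcs G}"
    then have y: "y \<in> pverts G" "(f x, y) \<in> parcs G"
      by (auto dest: in_arcsD2)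
    then obtain z where "z \<in> pverts G" "y = f z"
      using permutes_image[OF f(1)] by blast
    then show "y \<in> f ` {y. (x, y) \<in> parcs G}"
      using f(2)[of x z] assms(2) y by auto
  next
    fix y assume "y \<in> f ` {y. (x, y) \<in> parcs G}"
    then show "y \<in> {y. (f x, y) \<in> parcs G}"
      using f(2)[of x] assms(2) by (auto dest: in_arcsD2)
  }
qed

lemma (in pair_wf_digraph) walks_to_automorphism:
  assumes "automorphism G f" "x \<in> pverts G"
  shows "walks_to G k (f x) = f ` walks_to G k x"
  using assms(2)
proof (induction k arbitrary: x)
  case (Suc k)
  have "walks_to G (Suc k) (f x) = (\<Union>y \<in> {y. (x, y) \<in> parcs G}. walks_to G k (f y))"
    by (simp add: neighbours_automorphism[OF assms(1) Suc.prems])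
  also have "\<dots> = (\<Union>y \<in> {y. (x, y) \<in> parcs G}. f ` walks_to G k y)"
    using Suc.IH by (intro SUP_cong) (auto dest: in_arcsD2)
  finally show ?case
    by (simp add: image_UN)
qed simp

lemma (in pair_wf_digraph) antipodes_automorphism:
  assumes "automorphism G f" "a \<in> pverts G" "b \<in> pverts G" "c \<in> pverts G"
  shows "antipodes G k (f a) (f b) (f c) = f ` antipodes G k a b c"
proof -
  have "inj f"
    using assms(1) by (auto simp: automorphism_def dest: permutes_inj)
  then show ?thesis
    by (simp add: antipodes_def walks_to_automorphism[OF assms(1)] assms image_Int image_set_diff)
qed

section \<open>Cubic arc-transitive bipartite graphs of girth at least six\<close>

locale symmetric_cubic = pair_pseudo_graph G for G :: "'a pair_pre_digraph" +
  fixes side :: "'a \<Rightarrow> bool"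
  assumes side: "(x, y) \<in> parcs G \<Longrightarrow> side y \<longleftrightarrow> \<not> side x"
    and degree: "x \<in> pverts G \<Longrightarrow> card {y. (x, y) \<in> parcs G} = 3"
    and no_square: "(x, y) \<in> parcs G \<Longrightarrow> (x, z) \<in> parcs G \<Longrightarrow> (w, y) \<in> parcs G \<Longrightarrow>
      (w, z) \<in> parcs G \<Longrightarrow> x = w \<or> y = z"
    and arc_trans: "arc_transitive G"
    and conn: "connected (with_proj G)"
begin

lemma third_neighbour:
  assumes "(x, y) \<in> parcs G" "(x, z) \<in> parcs G" "y \<noteq> z"
  obtains w where "{v. (x, v) \<in> parcs G} = {y, z, w}" "w \<noteq> y" "w \<noteq> z"
proof -
  have "card {v. (x, v) \<in> parcs G} = 3"
    using assms by (intro degree) (auto dest: in_arcsD1)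
  then obtain p q r where *: "{v. (x, v) \<in> parcs G} = {p, q, r}" "p \<noteq> q" "q \<noteq> r" "p \<noteq> r"
    unfolding card_3_iff by blast
  have "y \<in> {p, q, r}" "z \<in> {p, q, r}"
    using assms(1,2) by (auto simp flip: *(1))
  then have "\<exists>w. {p, q, r} = {y, z, w} \<and> w \<noteq> y \<and> w \<noteq> z"
    using *(2-4) assms(3) by (auto simp: insert_commute)
  then show ?thesis
    using that *(1) by metis
qed

text \<open>In a cubic graph a path of length two amounts to the arc from its middle vertex to the
  neighbour that it misses. Moving that arc moves the path, possibly reversing it, which is why only
  the set of ends is controlled.\<close>

lemma two_path_transitive:
  assumes "(b, a) \<in> parcs G" "(b, c) \<in> parcs G" "a \<noteq> c"
    and "(b', a') \<in> parcs G" "(b', c') \<in> parcs G" "a' \<noteq> c'"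
  obtains f where "automorphism G f" "f b = b'" "f ` {a, c} = {a', c'}"
proof -
  obtain d where d: "{v. (b, v) \<in> parcs G} = {a, c, d}" "d \<noteq> a" "d \<noteq> c"
    using assms(1-3) by (rule third_neighbour)
  obtain d' where d': "{v. (b', v) \<in> parcs G} = {a', c', d'}" "d' \<noteq> a'" "d' \<noteq> c'"
    using assms(4-6) by (rule third_neighbour)
  have bd: "(b, d) \<in> parcs G" and bd': "(b', d') \<in> parcs G"
    using d(1) d'(1) by blast+
  obtain f where f: "automorphism G f" "f b = b'" "f d = d'"
    using bspec[OF bspec[OF arc_trans[unfolded arc_transitive_def] bd, unfolded prod.case] bd',
        unfolded prod.case] by blast
  have "inj f"
    using f(1) by (auto simp: automorphism_def dest: permutes_inj)
  have "f ` {v. (b, v) \<in> parcs G} = {v. (b', v) \<in> parcs G}"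
    using neighbours_automorphism[OF f(1), of b] f(2) assms(1) by (auto dest: in_arcsD1)
  then have "f ` ({a, c, d} - {d}) = {a', c', d'} - {d'}"
    unfolding d(1) d'(1) image_set_diff[OF \<open>inj f\<close>] by (simp add: f(3))
  moreover have "{a, c, d} - {d} = {a, c}" "{a', c', d'} - {d'} = {a', c'}"
    using d(2,3) d'(2,3) by auto
  ultimately show ?thesis
    using that f by simp
qed

lemma card_antipodes_eq:
  assumes "(b, a) \<in> parcs G" "(b, c) \<in> parcs G" "a \<noteq> c"
    and "(b', a') \<in> parcs G" "(b', c') \<in> parcs G" "a' \<noteq> c'"
  shows "card (antipodes G k a b c) = card (antipodes G k a' b' c')"
proof -
  obtain f where f: "automorphism G f" "f b = b'" "f ` {a, c} = {a', c'}"
    using assms by (rule two_path_transitive)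
  have "f a = a' \<and> f c = c' \<or> f a = c' \<and> f c = a'"
    using f(3) by (auto simp: doubleton_eq_iff)
  then have "antipodes G k a' b' c' = antipodes G k (f a) (f b) (f c)"
    using f(2) antipodes_commute[of G] by metis
  moreover have "inj f"
    using f(1) by (auto simp: automorphism_def dest: permutes_inj)
  ultimately show ?thesis
    using antipodes_automorphism[OF f(1), of a b c k] assms(1,2)
    by (simp add: in_arcsD1[OF assms(1)] in_arcsD2[OF assms(1)] in_arcsD2[OF assms(2)]
        card_image inj_on_subset)
qed

section \<open>Splitting off a hexagon\<close>

definition hexagon :: "'a \<Rightarrow> 'a \<Rightarrow> 'a \<Rightarrow> 'a \<Rightarrow> 'a \<Rightarrow> 'a \<Rightarrow> bool" where
  "hexagon a b c d e f \<longleftrightarrow> {(a, b), (b, c), (c, d), (d, e), (e, f), (f, a)} \<subseteq> parcs G \<and>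
     a \<noteq> c \<and> c \<noteq> e \<and> e \<noteq> a \<and> b \<noteq> d \<and> d \<noteq> f \<and> f \<noteq> b"

lemma hexagon_rotate: "hexagon a b c d e f \<Longrightarrow> hexagon b c d e f a"
  by (auto simp: hexagon_def)

lemma antipodes_2_iff:
  "p \<in> antipodes G 2 a b c \<longleftrightarrow> (b, p) \<notin> parcs G \<and>
    (\<exists>s. (a, s) \<in> parcs G \<and> (s, p) \<in> parcs G) \<and> (\<exists>s. (c, s) \<in> parcs G \<and> (s, p) \<in> parcs G)"
  by (auto simp: antipodes_def numeral_2_eq_2)

context
  assumes unique: "\<And>a b c p q. (b, a) \<in> parcs G \<Longrightarrow> (b, c) \<in> parcs G \<Longrightarrow> a \<noteq> c \<Longrightarrow>
    p \<in> antipodes G 2 a b c \<Longrightarrow> q \<in> antipodes G 2 a b c \<Longrightarrow> p = q"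
begin

text \<open>Each coincidence closes a short cycle. A chord of the hexagon or an edge from
  \<open>y0\<close> to \<open>y1\<close> gives a 4-cycle; a path from \<open>y0\<close> to
  \<open>y2\<close> or an edge from \<open>y0\<close> to \<open>y3\<close> gives a second hexagon
  through \<open>x0\<close>, \<open>x1\<close>, \<open>x2\<close>, hence an antipode besides
  \<open>x4\<close>.\<close>

lemma hexagon_outer:
  assumes hex: "hexagon x0 x1 x2 x3 x4 x5"
    and y0: "(x0, y0) \<in> parcs G" "y0 \<noteq> x1" "y0 \<noteq> x5"
  shows "y0 \<noteq> x3"
    and "(x1, y1) \<in> parcs G \<Longrightarrow> y1 \<noteq> x0 \<Longrightarrow> (y0, y1) \<notin> parcs G"
    and "(x2, y2) \<in> parcs G \<Longrightarrow> y2 \<noteq> x1 \<Longrightarrow> y2 \<noteq> x3 \<Longrightarrow> (y0, z) \<in> parcs G \<Longrightarrow> (z, y2) \<notin> parcs G"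
    and "(x3, y3) \<in> parcs G \<Longrightarrow> y3 \<noteq> x2 \<Longrightarrow> y3 \<noteq> x4 \<Longrightarrow> (y0, y3) \<notin> parcs G"
proof -
  have e: "(x0, x1) \<in> parcs G" "(x1, x2) \<in> parcs G" "(x2, x3) \<in> parcs G" "(x3, x4) \<in> parcs G"
      "(x4, x5) \<in> parcs G" "(x5, x0) \<in> parcs G"
    and ne: "x0 \<noteq> x2" "x2 \<noteq> x4" "x4 \<noteq> x0" "x1 \<noteq> x3" "x3 \<noteq> x5" "x5 \<noteq> x1"
    using hex by (auto simp: hexagon_def)
  note e' = e[THEN sym_parcs]
  show "y0 \<noteq> x3"
    using no_square[of x0 x1 x3 x2] e e' ne y0 by blast
  show "(y0, y1) \<notin> parcs G" if "(x1, y1) \<in> parcs G" "y1 \<noteq> x0"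
    using no_square[of x0 y0 x1 y1] e e' y0 that sym_parcs by blast
  have x4: "x4 \<in> antipodes G 2 x0 x1 x2"
    unfolding antipodes_2_iff using no_square[of x1 x2 x4 x3] e e' ne by blast
  show "(z, y2) \<notin> parcs G" if y2: "(x2, y2) \<in> parcs G" "y2 \<noteq> x1" "y2 \<noteq> x3" "(y0, z) \<in> parcs G" for z
  proof
    assume z: "(z, y2) \<in> parcs G"
    show False
    proof (cases "(x1, z) \<in> parcs G")
      case True
      then have "z = x0"
        using no_square[of x1 x0 z y0] e e' y0 y2 sym_parcs by blast
      then show False
        using no_square[of x0 x1 y2 x2] z e e' y2 ne by blast
    next
      case False
      then have "z \<in> antipodes G 2 x0 x1 x2"
        unfolding antipodes_2_iff using y0 y2 z sym_parcs by blast
      then have "z = x4"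
        using unique[OF e'(1) e(2) ne(1)] x4 by blast
      then show False
        using no_square[of x0 x5 y0 x4] e e' ne y0 y2(4) sym_parcs by blast
    qed
  qed
  show "(y0, y3) \<notin> parcs G" if y3: "(x3, y3) \<in> parcs G" "y3 \<noteq> x2" "y3 \<noteq> x4"
  proof
    assume z: "(y0, y3) \<in> parcs G"
    have "(x1, y3) \<notin> parcs G"
      using no_square[of x1 x2 y3 x3] e e' ne y3 by blast
    then have "y3 \<in> antipodes G 2 x0 x1 x2"
      unfolding antipodes_2_iff using y0 y3 z e by blast
    then show False
      using unique[OF e'(1) e(2) ne(1)] x4 y3 by blast
  qed
qed

text \<open>Rotating the hexagon carries \<open>hexagon_outer\<close> to all six corners. The
  hexagon and its outer neighbours are at most 12 vertices, so the cardinality bound leaves a vertex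
  on the other side of the cut.\<close>

lemma hexagon_splits:
  assumes hex: "hexagon x0 x1 x2 x3 x4 x5" and card: "12 < card (pverts G)"
  shows "splittable_graph G"
proof -
  note h0 = hex
  note h1 = hexagon_rotate[OF h0]
  note h2 = hexagon_rotate[OF h1]
  note h3 = hexagon_rotate[OF h2]
  note h4 = hexagon_rotate[OF h3]
  note h5 = hexagon_rotate[OF h4]
  have e: "(x0, x1) \<in> parcs G" "(x1, x2) \<in> parcs G" "(x2, x3) \<in> parcs G" "(x3, x4) \<in> parcs G"
      "(x4, x5) \<in> parcs G" "(x5, x0) \<in> parcs G"
    and ne: "x0 \<noteq> x2" "x2 \<noteq> x4" "x4 \<noteq> x0" "x1 \<noteq> x3" "x3 \<noteq> x5" "x5 \<noteq> x1"
    using hex by (auto simp: hexagon_def)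
  note e' = e[THEN sym_parcs]
  obtain y0 where y0: "{v. (x0, v) \<in> parcs G} = {x1, x5, y0}" "y0 \<noteq> x1" "y0 \<noteq> x5"
    using e(1) e'(6) ne(6)[symmetric] by (rule third_neighbour)
  obtain y1 where y1: "{v. (x1, v) \<in> parcs G} = {x2, x0, y1}" "y1 \<noteq> x2" "y1 \<noteq> x0"
    using e(2) e'(1) ne(1)[symmetric] by (rule third_neighbour)
  obtain y2 where y2: "{v. (x2, v) \<in> parcs G} = {x3, x1, y2}" "y2 \<noteq> x3" "y2 \<noteq> x1"
    using e(3) e'(2) ne(4)[symmetric] by (rule third_neighbour)
  obtain y3 where y3: "{v. (x3, v) \<in> parcs G} = {x4, x2, y3}" "y3 \<noteq> x4" "y3 \<noteq> x2"
    using e(4) e'(3) ne(2)[symmetric] by (rule third_neighbour)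
  obtain y4 where y4: "{v. (x4, v) \<in> parcs G} = {x5, x3, y4}" "y4 \<noteq> x5" "y4 \<noteq> x3"
    using e(5) e'(4) ne(5)[symmetric] by (rule third_neighbour)
  obtain y5 where y5: "{v. (x5, v) \<in> parcs G} = {x0, x4, y5}" "y5 \<noteq> x0" "y5 \<noteq> x4"
    using e(6) e'(5) ne(3)[symmetric] by (rule third_neighbour)
  have a: "(x0, y0) \<in> parcs G" "(x1, y1) \<in> parcs G" "(x2, y2) \<in> parcs G" "(x3, y3) \<in> parcs G"
      "(x4, y4) \<in> parcs G" "(x5, y5) \<in> parcs G"
    using y0(1) y1(1) y2(1) y3(1) y4(1) y5(1) by blast+
  note o0 = hexagon_outer[OF h0 a(1) y0(2,3)]
    and o1 = hexagon_outer[OF h1 a(2) y1(2,3)]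
    and o2 = hexagon_outer[OF h2 a(3) y2(2,3)]
    and o3 = hexagon_outer[OF h3 a(4) y3(2,3)]
    and o4 = hexagon_outer[OF h4 a(5) y4(2,3)]
    and o5 = hexagon_outer[OF h5 a(6) y5(2,3)]
  define K where "K = {x0, x1, x2, x3, x4, x5}"
  define S where "S = {y0, y1, y2, y3, y4, y5}"
  have sx: "side x1 \<noteq> side x0" "side x2 = side x0" "side x3 \<noteq> side x0" "side x4 = side x0"
      "side x5 \<noteq> side x0"
    using e[THEN side] by auto
  have sy: "side y0 \<noteq> side x0" "side y1 = side x0" "side y2 \<noteq> side x0" "side y3 = side x0"
      "side y4 \<noteq> side x0" "side y5 = side x0"
    using a[THEN side] sx by auto
  \<comment> \<open>By the two-colouring, an edge can only join outer neighbours of corners one or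
    three apart, and a common neighbour can only occur for corners two apart. So these nine pairs
    and the six in \<open>common\<close> to \<open>common5\<close> are all that matter.\<close>
  have adj: "(y0, y1) \<notin> parcs G" "(y1, y2) \<notin> parcs G" "(y2, y3) \<notin> parcs G" "(y3, y4) \<notin> parcs G"
      "(y4, y5) \<notin> parcs G" "(y5, y0) \<notin> parcs G" "(y0, y3) \<notin> parcs G" "(y1, y4) \<notin> parcs G"
      "(y2, y5) \<notin> parcs G"
    using o0(2)[OF a(2) y1(3)] o1(2)[OF a(3) y2(3)] o2(2)[OF a(4) y3(3)] o3(2)[OF a(5) y4(3)]
      o4(2)[OF a(6) y5(3)] o5(2)[OF a(1) y0(3)] o0(4)[OF a(4) y3(3,2)] o1(4)[OF a(5) y4(3,2)]
      o2(4)[OF a(6) y5(3,2)] by blast+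
  have common: "(z, y2) \<notin> parcs G" if "(y0, z) \<in> parcs G" for z
    using o0(3)[OF a(3) y2(3,2) that] .
  have common': "(z, y3) \<notin> parcs G" if "(y1, z) \<in> parcs G" for z
    using o1(3)[OF a(4) y3(3,2) that] .
  have common'': "(z, y4) \<notin> parcs G" if "(y2, z) \<in> parcs G" for z
    using o2(3)[OF a(5) y4(3,2) that] .
  have common3: "(z, y5) \<notin> parcs G" if "(y3, z) \<in> parcs G" for z
    using o3(3)[OF a(6) y5(3,2) that] .
  have common4: "(z, y0) \<notin> parcs G" if "(y4, z) \<in> parcs G" for z
    using o4(3)[OF a(1) y0(3,2) that] .
  have common5: "(z, y1) \<notin> parcs G" if "(y5, z) \<in> parcs G" for z
    using o5(3)[OF a(2) y1(3,2) that] .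
  have 1: "(u, v) \<notin> parcs G" if "u \<in> S" "v \<in> S" for u v
  proof
    assume uv: "(u, v) \<in> parcs G"
    note side[OF uv] sym_parcs[OF uv] uv
    then show False
      using that sy adj unfolding S_def by (elim insertE emptyE) simp_all
  qed
  have 2: False if "u \<in> S" "v \<in> S" "u \<noteq> v" "(u, w) \<in> parcs G" "(w, v) \<in> parcs G" for u v w
  proof -
    have "side u = side v"
      using side[OF that(4)] side[OF that(5)] by blast
    moreover note sym_parcs[OF that(4)] sym_parcs[OF that(5)]
    ultimately show False
      using that sy common common' common'' common3 common4 common5
      unfolding S_def by (elim insertE emptyE) simp_all
  qed
  have 3: "K \<inter> S = {}"
    using o0(1) o1(1) o2(1) o3(1) o4(1) o5(1) y0(2,3) y1(2,3) y2(2,3) y3(2,3) y4(2,3) y5(2,3) sx sy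
    by (auto simp: K_def S_def)
  have 4: "y \<in> K \<union> S" if "x \<in> K" "(x, y) \<in> parcs G" for x y
  proof -
    have "y \<in> {v. (x, v) \<in> parcs G}"
      using that(2) by simp
    then show ?thesis
      using that(1) unfolding K_def S_def
      by (elim insertE emptyE) (simp_all add: y0(1) y1(1) y2(1) y3(1) y4(1) y5(1), blast+)
  qed
  have 5: "K \<subseteq> pverts G" "S \<subseteq> pverts G"
    using e a by (auto simp: K_def S_def dest: in_arcsD1 in_arcsD2)
  have "card (K \<union> S) \<le> 12"
    using card_Un_le[of K S] card_length[of "[x0, x1, x2, x3, x4, x5]"]
      card_length[of "[y0, y1, y2, y3, y4, y5]"] by (simp add: K_def S_def)
  then have "K \<union> S \<noteq> pverts G"
    using card by auto
  then have 6: "K \<subset> pverts G - S"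
    using 3 5 by blast
  show ?thesis
    unfolding splittable_graph_iff
  proof (rule exI[of _ S], rule exI[of _ K], intro conjI)
    show "\<forall>u\<in>S. \<forall>v\<in>S. u \<noteq> v \<longrightarrow>
        (u, v) \<notin> parcs G \<and> \<not> (\<exists>w. (u, w) \<in> parcs G \<and> (w, v) \<in> parcs G)"
      using 1 2 by blast
    show "K \<noteq> {}"
      by (simp add: K_def)
    show "\<forall>x\<in>K. \<forall>y. (x, y) \<in> parcs G \<longrightarrow> y \<in> K \<union> S"
      using 4 by blast
  qed (use 5 6 in blast)+
qed

end

text \<open>One count suffices: all paths of length two have equally many antipodes, so uniqueness
  for one of them is uniqueness everywhere.\<close>

theorem splittable_if_unique_antipode:
  assumes "(b, a) \<in> parcs G" "(b, c) \<in> parcs G" "a \<noteq> c" "card (antipodes G 2 a b c) = 1"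
    and card: "12 < card (pverts G)"
  shows "splittable_graph G"
proof -
  have unique: "p = q" if "(b', a') \<in> parcs G" "(b', c') \<in> parcs G" "a' \<noteq> c'"
    "p \<in> antipodes G 2 a' b' c'" "q \<in> antipodes G 2 a' b' c'" for a' b' c' p q
  proof -
    have "card (antipodes G 2 a' b' c') = 1"
      using card_antipodes_eq[OF assms(1-3) that(1-3), of 2] assms(4) by simp
    then show ?thesis
      using that(4,5) by (metis card_1_singletonE singletonD)
  qed
  obtain p where p: "p \<in> antipodes G 2 a b c"
    using assms(4) by (metis card_1_singletonE insertI1)
  then obtain s t where st: "(b, p) \<notin> parcs G" "(a, s) \<in> parcs G" "(s, p) \<in> parcs G"
      "(c, t) \<in> parcs G" "(t, p) \<in> parcs G"
    by (auto simp: antipodes_2_iff)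
  have "s \<noteq> t" "s \<noteq> b" "t \<noteq> b" "p \<noteq> a" "p \<noteq> c"
  proof -
    show "s \<noteq> t"
      using no_square[of s a c b] st assms(1-3) st(2)[THEN sym_parcs] st(4)[THEN sym_parcs] by metis
  qed (use st assms(1-3) in auto)
  then have hex: "hexagon a b c t p s"
    unfolding hexagon_def insert_subset
    using st assms(1-3) st(2-)[THEN sym_parcs] assms(1)[THEN sym_parcs] by simp
  show ?thesis
    by (rule hexagon_splits[OF unique hex card])
qed

end

section \<open>Graphs given by adjacency lists\<close>

definition presents :: "'a pair_pre_digraph \<Rightarrow> (nat \<Rightarrow> 'a) \<Rightarrow> nat list list \<Rightarrow> bool" where
  "presents G \<phi> al \<longleftrightarrow> bij_betw \<phi> {..<length al} (pverts G) \<and>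
     (\<forall>i < length al. set (al ! i) \<subseteq> {..<length al} \<and> {y. (\<phi> i, y) \<in> parcs G} = \<phi> ` set (al ! i))"

lemma presentsD:
  assumes "presents G \<phi> al" "i < length al"
  shows "\<phi> i \<in> pverts G" "{y. (\<phi> i, y) \<in> parcs G} = \<phi> ` set (al ! i)"
    "j \<in> set (al ! i) \<Longrightarrow> j < length al"
  using assms by (auto simp: presents_def bij_betw_def)

lemma presents_eq_iff:
  assumes "presents G \<phi> al" "i < length al" "j < length al"
  shows "\<phi> i = \<phi> j \<longleftrightarrow> i = j"
  using assms by (auto simp: presents_def bij_betw_def inj_on_def)

lemma presents_arc_iff:
  assumes "presents G \<phi> al" "i < length al" "j < length al"
  shows "(\<phi> i, \<phi> j) \<in> parcs G \<longleftrightarrow> j \<in> set (al ! i)"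
proof -
  have "(\<phi> i, \<phi> j) \<in> parcs G \<longleftrightarrow> \<phi> j \<in> \<phi> ` set (al ! i)"
    using presentsD(2)[OF assms(1,2)] by auto
  also have "\<dots> \<longleftrightarrow> j \<in> set (al ! i)"
    using presents_eq_iff[OF assms(1,3)] presentsD(3)[OF assms(1,2)] by auto
  finally show ?thesis .
qed

lemma presents_vertexE:
  assumes "presents G \<phi> al" "x \<in> pverts G"
  obtains i where "i < length al" "x = \<phi> i"
proof -
  have "x \<in> \<phi> ` {..<length al}"
    using assms by (simp add: presents_def bij_betw_def)
  then show ?thesis
    using that by blast
qed

text \<open>\<open>R\<close> is an executable form of adjacency, so that \<open>al\<close> can be
  obtained by evaluation even where \<open>E\<close> is a set comprehension.\<close>

lemma presents_undirected:
  assumes vs: "distinct vs" "set vs = V" and E: "E \<subseteq> V \<times> V"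
    and R: "\<And>x y. x \<in> V \<Longrightarrow> y \<in> V \<Longrightarrow> R x y \<longleftrightarrow> (x, y) \<in> E \<or> (y, x) \<in> E"
    and al: "map (\<lambda>x. filter (\<lambda>j. R x (vs ! j)) [0..<length vs]) vs = al"
  shows "presents (undirected V E) ((!) vs) al"
proof -
  have "bij_betw ((!) vs) {..<length vs} V"
    using bij_betw_nth[OF vs(1)] vs(2) by blast
  moreover have "{y. (vs ! i, y) \<in> E \<union> E\<inverse>} = (!) vs ` {j. j < length vs \<and> R (vs ! i) (vs ! j)}"
    if "i < length vs" for i
  proof -
    have "{y. (vs ! i, y) \<in> E \<union> E\<inverse>} = {y \<in> V. R (vs ! i) y}"
      using R[of "vs ! i"] E vs(2) nth_mem[OF that] by auto
    also have "\<dots> = (!) vs ` {j. j < length vs \<and> R (vs ! i) (vs ! j)}"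
      unfolding vs(2)[symmetric] by (auto simp: in_set_conv_nth)
    finally show ?thesis .
  qed
  ultimately show ?thesis
    unfolding al[symmetric] presents_def undirected_def by auto
qed

lemma presents_bijE:
  assumes G: "presents G \<phi> al" and H: "presents H \<psi> al"
  obtains h where "bij_betw h (pverts G) (pverts H)" "\<And>i. i < length al \<Longrightarrow> h (\<phi> i) = \<psi> i"
    "\<And>x y. x \<in> pverts G \<Longrightarrow> y \<in> pverts G \<Longrightarrow> (h x, h y) \<in> parcs H \<longleftrightarrow> (x, y) \<in> parcs G"
proof
  let ?N = "{..<length al}"
  define h where "h x = \<psi> (inv_into ?N \<phi> x)" for x
  show h: "h (\<phi> i) = \<psi> i" if "i < length al" for i
    using G that by (auto simp: h_def presents_def bij_betw_def)
  show "bij_betw h (pverts G) (pverts H)"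
    using bij_betw_trans[OF bij_betw_inv_into[of \<phi> ?N "pverts G"], of \<psi> "pverts H"] G H
    by (simp add: presents_def h_def[abs_def] comp_def)
  show "(h x, h y) \<in> parcs H \<longleftrightarrow> (x, y) \<in> parcs G" if "x \<in> pverts G" "y \<in> pverts G" for x y
    using that h presents_arc_iff[OF G] presents_arc_iff[OF H]
    by (auto elim!: presents_vertexE[OF G])
qed

lemma graph_iso_if_presents:
  assumes G: "presents G \<phi> al" "pair_wf_digraph G" and H: "presents H \<psi> al" "pair_wf_digraph H"
  shows "graph_iso G H"
proof -
  interpret G: pair_wf_digraph G by fact
  interpret H: pair_wf_digraph H by fact
  obtain f where bij: "bij_betw f (pverts G) (pverts H)"
    and arcs: "\<And>x y. x \<in> pverts G \<Longrightarrow> y \<in> pverts G \<Longrightarrow> (f x, f y) \<in> parcs H \<longleftrightarrow> (x, y) \<in> parcs G"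
    by (rule presents_bijE[OF G(1) H(1)]) (rule that)
  define h where "h = \<lparr>iso_verts = f, iso_arcs = map_prod f f, iso_head = snd, iso_tail = fst\<rparr>"
  have "pre_digraph.digraph_isomorphism (with_proj G) h"
    unfolding pre_digraph.digraph_isomorphism_def
  proof (intro conjI)
    have inj: "inj_on f (pverts G)"
      using bij by (simp add: bij_betw_def)
    then show "inj_on (iso_verts h) (verts (with_proj G))"
      by (simp add: h_def)
    have "parcs G \<subseteq> pverts G \<times> pverts G"
      using G.in_arcsD1 G.in_arcsD2 by auto
    then show "inj_on (iso_arcs h) (arcs (with_proj G))"
      using inj_on_subset[OF map_prod_inj_on[OF inj inj]] by (simp add: h_def)
  qed (auto simp: h_def G.wf_digraph_axioms)
  moreover have "map_prod f f ` parcs G = parcs H"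
  proof (intro equalityI subsetI)
    fix e assume "e \<in> parcs H"
    obtain a b where ab: "e = (a, b)"
      by (cases e)
    then have "a \<in> f ` pverts G" "b \<in> f ` pverts G"
      using bij \<open>e \<in> parcs H\<close> H.in_arcsD1 H.in_arcsD2 by (auto simp: bij_betw_def)
    then obtain x y where "e = (f x, f y)" "x \<in> pverts G" "y \<in> pverts G"
      using ab by blast
    then show "e \<in> map_prod f f ` parcs G"
      using arcs \<open>e \<in> parcs H\<close> by (auto intro!: image_eqI[of _ _ "(x, y)"])
  qed (use arcs G.in_arcsD1 G.in_arcsD2 in auto)
  then have "with_proj H = app_iso h (with_proj G)"
    using bij by (simp add: app_iso_def h_def with_proj_def bij_betw_def)
  ultimately show ?thesis
    unfolding graph_iso_def digraph_iso_def by blast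
qed

text \<open>Removing duplicates keeps evaluation short and makes the length of an
  \<open>antipode_list\<close> a cardinality.\<close>

primrec walk_list :: "nat list list \<Rightarrow> nat \<Rightarrow> nat \<Rightarrow> nat list" where
  "walk_list al 0 i = [i]"
| "walk_list al (Suc k) i = remdups (concat (map (walk_list al k) (al ! i)))"

definition antipode_list :: "nat list list \<Rightarrow> nat \<Rightarrow> nat \<Rightarrow> nat \<Rightarrow> nat \<Rightarrow> nat list" where
  "antipode_list al k a b c = (let A = walk_list al k a; B = walk_list al (k - 1) b;
     C = walk_list al k c in filter (\<lambda>x. x \<in> set C \<and> x \<notin> set B) A)"

lemma walk_list_less:
  assumes "presents G \<phi> al"
  shows "i < length al \<Longrightarrow> j \<in> set (walk_list al k i) \<Longrightarrow> j < length al"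
  by (induction k arbitrary: i) (auto dest: presentsD(3)[OF assms])

lemma walks_to_presents:
  assumes "presents G \<phi> al" "i < length al"
  shows "walks_to G k (\<phi> i) = \<phi> ` set (walk_list al k i)"
  using assms(2)
proof (induction k arbitrary: i)
  case (Suc k)
  have "walks_to G (Suc k) (\<phi> i) = (\<Union>j \<in> set (al ! i). walks_to G k (\<phi> j))"
    by (simp add: presentsD(2)[OF assms(1) Suc.prems])
  also have "\<dots> = (\<Union>j \<in> set (al ! i). \<phi> ` set (walk_list al k j))"
    using Suc.IH presentsD(3)[OF assms(1) Suc.prems] by (intro SUP_cong) auto
  finally show ?case
    by (simp add: image_UN)
qed simp

lemma card_antipodes_presents:
  assumes "presents G \<phi> al" "a < length al" "b < length al" "c < length al" "0 < k"
  shows "card (antipodes G k (\<phi> a) (\<phi> b) (\<phi> c)) = length (antipode_list al k a b c)"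
proof -
  note less = walk_list_less[OF assms(1)]
  have inj: "inj_on \<phi> {..<length al}"
    using assms(1) by (auto simp: presents_def bij_betw_def)
  have "antipodes G k (\<phi> a) (\<phi> b) (\<phi> c) = \<phi> ` set (antipode_list al k a b c)"
    unfolding antipodes_def walks_to_presents[OF assms(1,2)] walks_to_presents[OF assms(1,3)]
      walks_to_presents[OF assms(1,4)]
    using less[OF assms(2)] less[OF assms(3)] less[OF assms(4)] presents_eq_iff[OF assms(1)]
    by (auto simp: antipode_list_def Let_def)
  moreover have "inj_on \<phi> (set (antipode_list al k a b c))"
    using less[OF assms(2)] by (intro inj_on_subset[OF inj]) (auto simp: antipode_list_def Let_def)
  moreover have "distinct (antipode_list al k a b c)"
    using assms(5) by (cases k) (auto simp: antipode_list_def Let_def)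
  ultimately show ?thesis
    by (simp add: card_image distinct_card)
qed

definition near :: "nat list list \<Rightarrow> nat \<Rightarrow> nat \<Rightarrow> bool" where
  "near al x y \<longleftrightarrow> y \<in> set (al ! x) \<or> (\<exists>w \<in> set (al ! x). y \<in> set (al ! w))"

lemma near_presents:
  assumes "presents G \<phi> al" "i < length al" "j < length al"
  shows "near al i j \<longleftrightarrow>
    (\<phi> i, \<phi> j) \<in> parcs G \<or> (\<exists>w. (\<phi> i, w) \<in> parcs G \<and> (w, \<phi> j) \<in> parcs G)"
proof -
  have "(\<exists>w. (\<phi> i, w) \<in> parcs G \<and> (w, \<phi> j) \<in> parcs G) \<longleftrightarrow>
      (\<exists>w \<in> {w. (\<phi> i, w) \<in> parcs G}. (w, \<phi> j) \<in> parcs G)"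
    by blast
  also have "\<dots> \<longleftrightarrow> (\<exists>w \<in> set (al ! i). j \<in> set (al ! w))"
    unfolding presentsD(2)[OF assms(1,2)]
    using presents_arc_iff[OF assms(1) presentsD(3)[OF assms(1,2)] assms(3)] by auto
  finally show ?thesis
    by (simp add: near_def presents_arc_iff[OF assms])
qed

definition splits :: "nat list list \<Rightarrow> nat list \<Rightarrow> nat list \<Rightarrow> bool" where
  "splits al S K \<longleftrightarrow> (\<forall>x \<in> set S. x < length al) \<and> K \<noteq> [] \<and>
     (\<forall>x \<in> set S. \<forall>y \<in> set S. x \<noteq> y \<longrightarrow> \<not> near al x y) \<and>
     (\<forall>x \<in> set K. x < length al \<and> x \<notin> set S \<and> (\<forall>y \<in> set (al ! x). y \<in> set K \<or> y \<in> set S)) \<and>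
     length S + length K < length al"

lemma (in pair_sym_digraph) splittable_graph_if_splits:
  assumes al: "presents G \<phi> al" and "splits al S K"
  shows "splittable_graph G"
proof -
  have S: "\<And>x. x \<in> set S \<Longrightarrow> x < length al"
      "\<And>x y. x \<in> set S \<Longrightarrow> y \<in> set S \<Longrightarrow> x \<noteq> y \<Longrightarrow> \<not> near al x y"
    and K: "K \<noteq> []" "\<And>x. x \<in> set K \<Longrightarrow> x < length al" "\<And>x. x \<in> set K \<Longrightarrow> x \<notin> set S"
      "\<And>x y. x \<in> set K \<Longrightarrow> y \<in> set (al ! x) \<Longrightarrow> y \<in> set K \<union> set S"
    and len: "length S + length K < length al"
    using assms(2) unfolding splits_def by blast+
  have V: "pverts G = \<phi> ` {..<length al}" and inj: "inj_on \<phi> {..<length al}"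
    using al by (auto simp: presents_def bij_betw_def)
  \<comment> \<open>The length bound in \<open>splits\<close> leaves a vertex outside both lists, so
    \<open>K\<close> is only a proper part of what remains after the deletion.\<close>
  have "\<not> {..<length al} \<subseteq> set S \<union> set K"
  proof
    assume "{..<length al} \<subseteq> set S \<union> set K"
    then have "length al \<le> card (set S \<union> set K)"
      using card_mono[of "set S \<union> set K" "{..<length al}"] by simp
    then show False
      using card_Un_le[of "set S" "set K"] card_length[of S] card_length[of K] len by linarith
  qed
  then obtain i where i: "i < length al" "i \<notin> set S" "i \<notin> set K"
    by auto
  show ?thesis
    unfolding splittable_graph_iff
  proof (rule exI[of _ "\<phi> ` set S"], rule exI[of _ "\<phi> ` set K"], intro conjI)
    show "\<phi> ` set S \<subseteq> pverts G"
      using S(1) V by auto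
    show "\<forall>u\<in>\<phi> ` set S. \<forall>v\<in>\<phi> ` set S. u \<noteq> v \<longrightarrow>
        (u, v) \<notin> parcs G \<and> \<not> (\<exists>w. (u, w) \<in> parcs G \<and> (w, v) \<in> parcs G)"
    proof (intro ballI impI)
      fix u v assume "u \<in> \<phi> ` set S" "v \<in> \<phi> ` set S" "u \<noteq> v"
      then obtain i j where ij: "u = \<phi> i" "v = \<phi> j" "i \<in> set S" "j \<in> set S" "i \<noteq> j"
        by blast
      then show "(u, v) \<notin> parcs G \<and> \<not> (\<exists>w. (u, w) \<in> parcs G \<and> (w, v) \<in> parcs G)"
        using S(2)[of i j] near_presents[OF al S(1)[OF ij(3)] S(1)[OF ij(4)]] by blast
    qed
    show "\<phi> ` set K \<noteq> {}"
      using K(1) by simp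
    have "\<phi> ` set K \<subseteq> pverts G - \<phi> ` set S"
      using K(2,3) S(1) presents_eq_iff[OF al] V by (auto simp: image_iff)
    moreover have "\<phi> i \<in> pverts G - \<phi> ` set S - \<phi> ` set K"
      using i K(2) S(1) presents_eq_iff[OF al] V by (auto simp: image_iff)
    ultimately show "\<phi> ` set K \<subset> pverts G - \<phi> ` set S"
      by blast
    show "\<forall>x\<in>\<phi> ` set K. \<forall>y. (x, y) \<in> parcs G \<longrightarrow> y \<in> \<phi> ` set K \<union> \<phi> ` set S"
    proof (intro ballI allI impI)
      fix x y assume "x \<in> \<phi> ` set K" "(x, y) \<in> parcs G"
      then obtain i where "i \<in> set K" "y \<in> {y. (\<phi> i, y) \<in> parcs G}"
        by blast
      then show "y \<in> \<phi> ` set K \<union> \<phi> ` set S"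
        using presentsD(2)[OF al K(2)] K(4) by blast
    qed
  qed
qed

section \<open>Excluding splittings by exhaustive search\<close>

fun independent_lists :: "nat list list \<Rightarrow> nat list \<Rightarrow> nat list list" where
  "independent_lists al [] = [[]]"
| "independent_lists al (x # xs) = (let ts = independent_lists al xs in
     ts @ map ((#) x) (filter (\<lambda>t. \<forall>y \<in> set t. \<not> near al x y) ts))"

text \<open>This is the direction that unsplittability needs: whatever set a hypothetical splitting
  deletes, its list of indices has been examined. The predicate \<open>P\<close> stands for
  membership in that set.\<close>

lemma independent_lists_complete:
  "(\<And>x y. x \<in> set xs \<Longrightarrow> y \<in> set xs \<Longrightarrow> P x \<Longrightarrow> P y \<Longrightarrow> x \<noteq> y \<Longrightarrow> \<not> near al x y) \<Longrightarrow>
    distinct xs \<Longrightarrow> filter P xs \<in> set (independent_lists al xs)"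
proof (induction xs)
  case (Cons x xs)
  have "filter P xs \<in> set (independent_lists al xs)"
    using Cons.IH Cons.prems by simp
  moreover have "\<forall>y \<in> set (filter P xs). \<not> near al x y" if "P x"
    using Cons.prems that by auto
  ultimately show ?case
    by (simp add: Let_def)
qed simp

text \<open>Removes from \<open>R\<close> what a search through \<open>R\<close> reaches from the given stack; the first number
  bounds the number of steps.\<close>

fun unreached :: "nat list list \<Rightarrow> nat \<Rightarrow> nat list \<Rightarrow> nat list \<Rightarrow> nat list" where
  "unreached al (Suc k) (x # xs) R = (let ys = filter (\<lambda>y. y \<in> set R) (al ! x) in
     unreached al k (ys @ xs) (filter (\<lambda>y. y \<notin> set ys) R))"
| "unreached al _ _ R = R"

text \<open>Whatever the search removes is linked to the stack inside \<open>R\<close>, so a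
  property that spreads along such links holds for it. Running out of steps only leaves more behind,
  so the step bound does not affect soundness.\<close>

lemma unreached_closed:
  assumes "\<And>x. x \<in> set xs \<Longrightarrow> P x" "\<And>x y. P x \<Longrightarrow> y \<in> set (al ! x) \<Longrightarrow> y \<in> set R \<Longrightarrow> P y"
    and "z \<in> set R" "z \<notin> set (unreached al k xs R)"
  shows "P z"
  using assms
proof (induction al k xs R rule: unreached.induct)
  case (1 al k x xs R)
  define ys where "ys = filter (\<lambda>y. y \<in> set R) (al ! x)"
  have ys: "P y" if "y \<in> set ys" for y
    using that "1.prems"(1)[of x] "1.prems"(2)[of x y] by (auto simp: ys_def)
  show ?case
  proof (cases "z \<in> set ys")
    case False
    show ?thesis
    proof (rule "1.IH"[OF ys_def])
      show "P w" if "w \<in> set (ys @ xs)" for w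
        using that ys "1.prems"(1) by auto
      show "P w" if "P v" "w \<in> set (al ! v)" "w \<in> set (filter (\<lambda>y. y \<notin> set ys) R)" for v w
        using that "1.prems"(2)[of v w] by auto
      show "z \<in> set (filter (\<lambda>y. y \<notin> set ys) R)"
        using False "1.prems"(3) by auto
      show "z \<notin> set (unreached al k (ys @ xs) (filter (\<lambda>y. y \<notin> set ys) R))"
        using "1.prems"(4) by (simp add: ys_def Let_def)
    qed
  qed (rule ys)
qed auto

definition splitfree :: "nat list list \<Rightarrow> bool" where
  "splitfree al \<longleftrightarrow> (\<forall>T \<in> set (independent_lists al [0..<length al]).
     case filter (\<lambda>i. i \<notin> set T) [0..<length al] of [] \<Rightarrow> True
       | x # R \<Rightarrow> unreached al (length al) [x] R = [])"

text \<open>Membership in \<open>K\<close> is constant along edges avoiding \<open>S\<close>, and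
  the search links every remaining vertex to the first one by such edges. Hence \<open>K\<close>
  would be empty or all of the rest.\<close>

lemma (in pair_sym_digraph) unsplittable_graph_if_splitfree:
  assumes al: "presents G \<phi> al" and "splitfree al"
  shows "\<not> splittable_graph G"
proof
  assume "splittable_graph G"
  then obtain S K where SK: "S \<subseteq> pverts G \<and>
     (\<forall>u \<in> S. \<forall>v \<in> S. u \<noteq> v \<longrightarrow> (u, v) \<notin> parcs G \<and> \<not> (\<exists>w. (u, w) \<in> parcs G \<and> (w, v) \<in> parcs G)) \<and>
     K \<noteq> {} \<and> K \<subset> pverts G - S \<and> (\<forall>x \<in> K. \<forall>y. (x, y) \<in> parcs G \<longrightarrow> y \<in> K \<union> S)"
    unfolding splittable_graph_iff by (elim exE) (rule that)
  have S: "(\<phi> x, \<phi> y) \<notin> parcs G \<and> \<not> (\<exists>w. (\<phi> x, w) \<in> parcs G \<and> (w, \<phi> y) \<in> parcs G)"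
    if "\<phi> x \<in> S" "\<phi> y \<in> S" "\<phi> x \<noteq> \<phi> y" for x y
    using SK that by metis
  have K: "K \<noteq> {}" "K \<subset> pverts G - S" "\<And>x y. x \<in> K \<Longrightarrow> (x, y) \<in> parcs G \<Longrightarrow> y \<in> K \<union> S"
    using SK by metis+
  let ?N = "[0..<length al]"
  define T where "T = filter (\<lambda>i. \<phi> i \<in> S) ?N"
  have "T \<in> set (independent_lists al ?N)"
    unfolding T_def
  proof (rule independent_lists_complete)
    fix x y assume xy: "x \<in> set ?N" "y \<in> set ?N" "\<phi> x \<in> S" "\<phi> y \<in> S" "x \<noteq> y"
    then show "\<not> near al x y"
      using S[of x y] near_presents[OF al, of x y] presents_eq_iff[OF al, of x y] by auto
  qed simp
  then have T: "case filter (\<lambda>i. i \<notin> set T) ?N of [] \<Rightarrow> True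
      | x # R \<Rightarrow> unreached al (length al) [x] R = []"
    using assms(2) by (auto simp: splitfree_def)
  have notT: "filter (\<lambda>i. i \<notin> set T) ?N = filter (\<lambda>i. \<phi> i \<notin> S) ?N"
    by (rule filter_cong) (auto simp: T_def)
  obtain u v where uv: "u \<in> K" "v \<in> pverts G - S - K"
    using K by blast
  then obtain i j where i: "i < length al" "u = \<phi> i" and j: "j < length al" "v = \<phi> j"
    using K(2) by (metis Diff_iff psubsetD presents_vertexE[OF al])
  have ij: "i \<in> set (filter (\<lambda>i. \<phi> i \<notin> S) ?N)" "j \<in> set (filter (\<lambda>i. \<phi> i \<notin> S) ?N)"
    using i j uv K(2) by auto
  then obtain x R where xR: "filter (\<lambda>i. \<phi> i \<notin> S) ?N = x # R"
    by (cases "filter (\<lambda>i. \<phi> i \<notin> S) ?N") auto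
  have un: "unreached al (length al) [x] R = []"
    using T by (simp add: notT xR)
  have x: "x < length al"
    using xR by (metis (no_types, lifting) Cons_eq_filterD atLeastLessThan_iff in_set_conv_decomp set_upt)
  have R: "y < length al \<and> \<phi> y \<notin> S" if "y \<in> set (x # R)" for y
    using that unfolding xR[symmetric] by auto
  have step: "\<phi> y \<in> K \<longleftrightarrow> \<phi> z \<in> K" if "z \<in> set (al ! y)" "y < length al" "\<phi> y \<notin> S" "\<phi> z \<notin> S" for y z
  proof -
    have "(\<phi> y, \<phi> z) \<in> parcs G"
      using that presents_arc_iff[OF al that(2) presentsD(3)[OF al that(2,1)]] by simp
    then show ?thesis
      using K(3) sym_parcs that(3,4) by blast
  qed
  have const: "\<phi> z \<in> K \<longleftrightarrow> \<phi> x \<in> K" if "z \<in> set (x # R)" for z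
  proof (cases "z = x")
    case False
    let ?P = "\<lambda>z. z < length al \<and> \<phi> z \<notin> S \<and> (\<phi> z \<in> K \<longleftrightarrow> \<phi> x \<in> K)"
    have "?P z"
    proof (rule unreached_closed[of "[x]" ?P al R z "length al"])
      show "?P y" if "y \<in> set [x]" for y
        using that R by simp
      show "?P w" if "?P y" "w \<in> set (al ! y)" "w \<in> set R" for y w
        using that R[of w] step[of w y] by auto
    qed (use False that un in auto)
    then show ?thesis
      by blast
  qed simp
  show False
    using const[of i] const[of j] ij uv i j unfolding xR by auto
qed

section \<open>Cyclic Haar graphs\<close>

text \<open>The vertices \<open>u i\<close> and \<open>v i\<close> with \<open>i\<close> in the residue class of \<open>\<alpha> * x + \<beta> * y\<close> modulo \<open>n\<close>
  are written \<open>U \<alpha> \<beta>\<close> and \<open>W \<alpha> \<beta>\<close>. In these redundant coordinates adjacency has constant coefficients,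
  and coincidences of vertices are divisibilities \<open>Z \<alpha> \<beta>\<close>.\<close>

definition lin_dvd :: "int \<Rightarrow> int \<Rightarrow> int \<Rightarrow> int \<Rightarrow> int \<Rightarrow> bool" where
  "lin_dvd n x y \<alpha> \<beta> \<longleftrightarrow> n dvd \<alpha> * x + \<beta> * y"

text \<open>The assumption \<open>unit\<close> records connectedness: a common divisor of
  \<open>n\<close>, \<open>x\<close> and \<open>y\<close> other than a unit would confine the steps
  to a proper subgroup of the residues.\<close>

locale two_orbits = symmetric_cubic G side for G :: "'a pair_pre_digraph" and side +
  fixes n :: nat and x y :: int and U W :: "int \<Rightarrow> int \<Rightarrow> 'a"
  assumes unit: "\<And>d. d dvd int n \<Longrightarrow> d dvd x \<Longrightarrow> d dvd y \<Longrightarrow> d dvd 1"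
    and U_eq: "U \<alpha> \<beta> = U \<gamma> \<delta> \<longleftrightarrow> lin_dvd (int n) x y (\<alpha> - \<gamma>) (\<beta> - \<delta>)"
    and W_eq: "W \<alpha> \<beta> = W \<gamma> \<delta> \<longleftrightarrow> lin_dvd (int n) x y (\<alpha> - \<gamma>) (\<beta> - \<delta>)"
    and U_neq_W [simp]: "U \<alpha> \<beta> \<noteq> W \<gamma> \<delta>"
    and verts: "pverts G = {U \<alpha> \<beta> | \<alpha> \<beta>. True} \<union> {W \<alpha> \<beta> | \<alpha> \<beta>. True}"
    and card_verts: "card (pverts G) = 2 * n" and n_ge: "9 \<le> n"
begin

abbreviation Z :: "int \<Rightarrow> int \<Rightarrow> bool" where
  "Z \<equiv> lin_dvd (int n) x y"

lemma W_neq_U [simp]: "W \<gamma> \<delta> \<noteq> U \<alpha> \<beta>"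
  using U_neq_W by metis

lemma dvd_if_dvd_mult:
  assumes "int n dvd m * x" "int n dvd m * y"
  shows "int n dvd m"
proof -
  have "coprime (int n) (gcd x y)"
    using unit by (intro coprimeI) auto
  moreover have "int n dvd m * gcd x y"
    using gcd_greatest[OF assms] by (cases "m \<ge> 0") (simp_all add: gcd_mult_left)
  ultimately show ?thesis
    by (simp add: coprime_dvd_mult_left_iff)
qed

text \<open>As in Cramer's rule, eliminating one unknown at a time shows that \<open>n\<close>
  divides the determinant times \<open>x\<close> and times \<open>y\<close>. Since \<open>n\<close>,
  \<open>x\<close> and \<open>y\<close> have no common divisor, it divides the determinant
  itself.\<close>

lemma Z_det:
  assumes "Z \<alpha> \<beta>" "Z \<gamma> \<delta>"
  shows "int n dvd \<alpha> * \<delta> - \<beta> * \<gamma>"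
proof (rule dvd_if_dvd_mult)
  have "int n dvd \<delta> * (\<alpha> * x + \<beta> * y) - \<beta> * (\<gamma> * x + \<delta> * y)"
    "int n dvd \<alpha> * (\<gamma> * x + \<delta> * y) - \<gamma> * (\<alpha> * x + \<beta> * y)"
    using assms unfolding lin_dvd_def by (auto intro: dvd_diff dvd_mult)
  then show "int n dvd (\<alpha> * \<delta> - \<beta> * \<gamma>) * x" "int n dvd (\<alpha> * \<delta> - \<beta> * \<gamma>) * y"
    by (simp_all add: algebra_simps)
qed

lemma Z_add: "Z \<alpha> \<beta> \<Longrightarrow> Z \<gamma> \<delta> \<Longrightarrow> Z (\<alpha> + \<gamma>) (\<beta> + \<delta>)"
  using dvd_add[of "int n" "\<alpha> * x + \<beta> * y" "\<gamma> * x + \<delta> * y"] by (simp add: lin_dvd_def algebra_simps)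

lemma Z_uminus: "Z (- \<alpha>) (- \<beta>) \<longleftrightarrow> Z \<alpha> \<beta>"
  using dvd_minus_iff[of "int n" "\<alpha> * x + \<beta> * y"] by (simp add: lin_dvd_def algebra_simps)

lemma n_le_if_dvd: "int n dvd d \<Longrightarrow> d \<noteq> 0 \<Longrightarrow> int n \<le> \<bar>d\<bar>"
  using dvd_imp_le_int[of d "int n"] by simp

end

locale haar_like = two_orbits +
  assumes adj_U: "{z. (U \<alpha> \<beta>, z) \<in> parcs G} = {W \<alpha> \<beta>, W (\<alpha> + 1) \<beta>, W \<alpha> (\<beta> + 1)}"
    and adj_W: "{z. (W \<alpha> \<beta>, z) \<in> parcs G} = {U \<alpha> \<beta>, U (\<alpha> - 1) \<beta>, U \<alpha> (\<beta> - 1)}"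
begin

lemma adj_U_iff: "(U \<alpha> \<beta>, z) \<in> parcs G \<longleftrightarrow> z = W \<alpha> \<beta> \<or> z = W (\<alpha> + 1) \<beta> \<or> z = W \<alpha> (\<beta> + 1)"
  using adj_U[of \<alpha> \<beta>] by blast

lemma adj_W_iff: "(W \<alpha> \<beta>, z) \<in> parcs G \<longleftrightarrow> z = U \<alpha> \<beta> \<or> z = U (\<alpha> - 1) \<beta> \<or> z = U \<alpha> (\<beta> - 1)"
  using adj_W[of \<alpha> \<beta>] by blast

lemma swap: "haar_like G side n y x (\<lambda>\<alpha> \<beta>. U \<beta> \<alpha>) (\<lambda>\<alpha> \<beta>. W \<beta> \<alpha>)"
proof unfold_locales
  show "pverts G = {U \<beta> \<alpha> |\<alpha> \<beta>. True} \<union> {W \<beta> \<alpha> |\<alpha> \<beta>. True}"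
    unfolding verts by blast
  show "d dvd 1" if "d dvd int n" "d dvd y" "d dvd x" for d
    using unit that by blast
qed (auto simp: U_eq W_eq card_verts n_ge adj_U adj_W lin_dvd_def insert_commute add.commute)

text \<open>The steps of the graph are 0, \<open>x\<close> and \<open>y\<close>. Taking
  \<open>x\<close> as the new zero turns them into \<open>y - x\<close>, \<open>- x\<close> and 0;
  the shift by 1 in \<open>W\<close> moves the origin of the second orbit accordingly. With
  \<open>swap\<close> this yields all six orders of the three steps.\<close>

lemma rotate: "haar_like G side n (y - x) (- x) (\<lambda>\<alpha> \<beta>. U (- \<alpha> - \<beta>) \<alpha>) (\<lambda>\<alpha> \<beta>. W (1 - \<alpha> - \<beta>) \<alpha>)"
proof unfold_locales
  have "\<exists>\<gamma> \<delta>. U \<alpha> \<beta> = U (- \<gamma> - \<delta>) \<gamma>" for \<alpha> \<beta>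
    by (rule exI[of _ \<beta>], rule exI[of _ "- \<alpha> - \<beta>"]) simp
  moreover have "\<exists>\<gamma> \<delta>. W \<alpha> \<beta> = W (1 - \<gamma> - \<delta>) \<gamma>" for \<alpha> \<beta>
    by (rule exI[of _ \<beta>], rule exI[of _ "1 - \<alpha> - \<beta>"]) simp
  ultimately have "{U \<alpha> \<beta> | \<alpha> \<beta>. True} = {U (- \<alpha> - \<beta>) \<alpha> |\<alpha> \<beta>. True}"
    "{W \<alpha> \<beta> | \<alpha> \<beta>. True} = {W (1 - \<alpha> - \<beta>) \<alpha> |\<alpha> \<beta>. True}"
    by blast+
  then show "pverts G = {U (- \<alpha> - \<beta>) \<alpha> |\<alpha> \<beta>. True} \<union> {W (1 - \<alpha> - \<beta>) \<alpha> |\<alpha> \<beta>. True}"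
    by (simp add: verts)
  show "d dvd 1" if "d dvd int n" "d dvd y - x" "d dvd - x" for d
    using unit[of d] that dvd_add[of d "y - x" x] by simp
  show "(U (- \<alpha> - \<beta>) \<alpha> = U (- \<gamma> - \<delta>) \<gamma>) = lin_dvd (int n) (y - x) (- x) (\<alpha> - \<gamma>) (\<beta> - \<delta>)" for \<alpha> \<beta> \<gamma> \<delta>
    unfolding U_eq by (simp add: lin_dvd_def algebra_simps)
  show "(W (1 - \<alpha> - \<beta>) \<alpha> = W (1 - \<gamma> - \<delta>) \<gamma>) = lin_dvd (int n) (y - x) (- x) (\<alpha> - \<gamma>) (\<beta> - \<delta>)" for \<alpha> \<beta> \<gamma> \<delta>
    unfolding W_eq by (simp add: lin_dvd_def algebra_simps)
  show "{z. (U (- \<alpha> - \<beta>) \<alpha>, z) \<in> parcs G} =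
      {W (1 - \<alpha> - \<beta>) \<alpha>, W (1 - (\<alpha> + 1) - \<beta>) (\<alpha> + 1), W (1 - \<alpha> - (\<beta> + 1)) \<alpha>}" for \<alpha> \<beta>
    unfolding adj_U by (auto simp: algebra_simps)
  show "{z. (W (1 - \<alpha> - \<beta>) \<alpha>, z) \<in> parcs G} =
      {U (- \<alpha> - \<beta>) \<alpha>, U (- (\<alpha> - 1) - \<beta>) (\<alpha> - 1), U (- \<alpha> - (\<beta> - 1)) \<alpha>}" for \<alpha> \<beta>
    unfolding adj_W by (auto simp: algebra_simps)
qed (auto simp: card_verts n_ge)

lemma not_Z: "\<not> Z 1 0" "\<not> Z 0 1" "\<not> Z 1 (- 1)" "\<not> Z (- 1) 1" "\<not> Z 2 (- 2)" "\<not> Z (- 2) 2"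
proof -
  have "card {W 0 0, W 1 0, W 0 1} = 3"
    using degree[of "U 0 0"] adj_U[of 0 0] unfolding verts by simp blast
  then have "W 0 0 \<noteq> W 1 0" "W 0 0 \<noteq> W 0 1" "W 1 0 \<noteq> W 0 1"
    by (auto simp: card_insert_if split: if_splits)
  then show 1: "\<not> Z 1 0" "\<not> Z 0 1" "\<not> Z 1 (- 1)"
    unfolding W_eq using Z_uminus[of 1 0] Z_uminus[of 0 1] by simp_all
  then show "\<not> Z (- 1) 1"
    using Z_uminus[of 1 "- 1"] by simp
  show 2: "\<not> Z 2 (- 2)"
  proof
    assume "Z 2 (- 2)"
    then have eq: "U 1 (- 1) = U (- 1) 1"
      by (simp add: U_eq)
    have "(U 1 (- 1), W 0 1) \<in> parcs G"
      unfolding eq by (simp add: adj_U_iff)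
    then have "U 0 0 = U 1 (- 1) \<or> W 1 0 = W 0 1"
      by (intro no_square[of _ "W 1 0" "W 0 1"]) (simp_all add: adj_U_iff)
    then show False
      using 1 Z_uminus[of 1 "- 1"] by (auto simp: U_eq W_eq)
  qed
  then show "\<not> Z (- 2) 2"
    using Z_uminus[of 2 "- 2"] by simp
qed

lemma antipodes_subset:
  assumes p: "p \<in> antipodes G 2 (W 1 0) (U 0 0) (W 0 1)" and "p \<noteq> W 1 1"
  shows "p \<in> {W 2 (- 1), W 1 (- 1), W 2 0} \<and> p \<in> {W (- 1) 2, W (- 1) 1, W 0 2}"
proof -
  have "p \<in> {W 2 (- 1), W 1 1, W 1 (- 1), W 2 0}"
    using p by (auto simp: antipodes_2_iff adj_U_iff adj_W_iff)
  moreover have "p \<in> {W (- 1) 2, W 1 1, W (- 1) 1, W 0 2}"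
    using p by (auto simp: antipodes_2_iff adj_U_iff adj_W_iff)
  ultimately show ?thesis
    using assms(2) by blast
qed

lemma not_Z_1_1: "\<not> Z 1 1"
proof
  assume "Z 1 1"
  then have "W 1 1 = W 0 0"
    by (simp add: W_eq)
  then have "U 0 0 = U 1 0 \<or> W 1 0 = W 0 0"
    by (intro no_square) (auto simp: adj_U_iff)
  then show False
    using not_Z Z_uminus[of 1 0] by (auto simp: U_eq W_eq)
qed

text \<open>Since steps commute, every such graph contains the hexagon \<open>U 0 0\<close>,
  \<open>W 1 0\<close>, \<open>U 1 0\<close>, \<open>W 1 1\<close>, \<open>U 0 1\<close>,
  \<open>W 0 1\<close>.\<close>

lemma opposite_in_antipodes: "W 1 1 \<in> antipodes G 2 (W 1 0) (U 0 0) (W 0 1)"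
  unfolding antipodes_2_iff
proof (intro conjI)
  show "\<exists>s. (W 1 0, s) \<in> parcs G \<and> (s, W 1 1) \<in> parcs G"
    by (rule exI[of _ "U 1 0"]) (simp add: adj_U_iff adj_W_iff)
  show "\<exists>s. (W 0 1, s) \<in> parcs G \<and> (s, W 1 1) \<in> parcs G"
    by (rule exI[of _ "U 0 1"]) (simp add: adj_U_iff adj_W_iff)
qed (use not_Z not_Z_1_1 in \<open>simp add: adj_U_iff W_eq\<close>)

context
  assumes not_split: "\<not> splittable_graph G"
begin

text \<open>Without a splitting the path has an antipode besides \<open>W 1 1\<close>. The
  candidates as seen from its two ends must then coincide somewhere, and these are the coincidences
  that cubicity and the absence of 4-cycles do not exclude.\<close>

lemma extra_relation: "Z 3 (- 3) \<or> Z 3 (- 2) \<or> Z (- 2) 3 \<or> Z (- 1) 3 \<or> Z 3 (- 1)"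
proof (rule ccontr)
  assume "\<not> ?thesis"
  then have no: "\<not> Z 3 (- 3)" "\<not> Z 3 (- 2)" "\<not> Z (- 2) 3" "\<not> Z (- 1) 3" "\<not> Z 3 (- 1)"
      "\<not> Z 2 (- 3)" "\<not> Z 1 (- 3)" "\<not> Z (- 3) 2"
    using Z_uminus[of "- 2" 3] Z_uminus[of "- 1" 3] Z_uminus[of 3 "- 2"] by auto
  have "antipodes G 2 (W 1 0) (U 0 0) (W 0 1) = {W 1 1}"
  proof (intro equalityI subsetI)
    fix p assume p: "p \<in> antipodes G 2 (W 1 0) (U 0 0) (W 0 1)"
    show "p \<in> {W 1 1}"
    proof (rule ccontr)
      assume "p \<notin> {W 1 1}"
      then show False
        using antipodes_subset[OF p] no not_Z by (auto simp: W_eq)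
    qed
  qed (use opposite_in_antipodes in auto)
  then show False
    using splittable_if_unique_antipode[of "U 0 0" "W 1 0" "W 0 1"] not_split not_Z n_ge
    by (auto simp: adj_U_iff W_eq card_verts)
qed

end

end

text \<open>If \<open>3 x = y\<close>, then the path from \<open>W 1 0\<close> to \<open>W 0 0\<close> lies on three hexagons.\<close>

lemma (in haar_like) not_Z_3_m1:
  assumes "\<not> splittable_graph G"
  shows "\<not> Z 3 (- 1)"
proof
  assume Z: "Z 3 (- 1)"
  interpret R: haar_like G side n "y - x" "- x" "\<lambda>\<alpha> \<beta>. U (- \<alpha> - \<beta>) \<alpha>" "\<lambda>\<alpha> \<beta>. W (1 - \<alpha> - \<beta>) \<alpha>"
    by (rule rotate)
  have RZ: "R.Z \<alpha> \<beta> \<longleftrightarrow> Z (- \<alpha> - \<beta>) \<alpha>" for \<alpha> \<beta>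
    by (simp add: lin_dvd_def algebra_simps)
  note det = n_le_if_dvd[OF Z_det[OF Z]]
  \<comment> \<open>Against \<open>Z 3 (- 1)\<close> the five relations from the rotated graph have
    determinants 9, 8, 7, 5 and 7 up to sign. With at least nine residues only the first survives,
    and it forces \<open>n = 9\<close>.\<close>
  have "n = 9 \<and> Z 0 3"
    using R.extra_relation[OF assms] det[of 0 3] det[of "-1" 3] det[of "-1" "-2"] det[of "-2" "-1"] det[of "-2" 3]
      n_ge by (auto simp: RZ)
  then have n: "n = 9" and Z': "Z 0 3"
    by auto
  have notZ: "\<not> Z \<gamma> \<delta>" if "\<not> 9 dvd 3 * \<delta> + \<gamma>" for \<gamma> \<delta>
    using Z_det[OF Z, of \<gamma> \<delta>] that n by auto
  \<comment> \<open>In \<open>H(9, {0, 1, 3})\<close> this path has at most two antipodes, while the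
    path from \<open>W 1 0\<close> to \<open>W 0 0\<close> has at least three; transitivity forbids
    the difference.\<close>
  have "antipodes G 2 (W 0 1) (U 0 0) (W 0 0) \<subseteq> {W (- 1) 1, W 0 2}"
  proof
    fix p assume p: "p \<in> antipodes G 2 (W 0 1) (U 0 0) (W 0 0)"
    have "p \<in> {W (- 1) 2, W 1 1, W (- 1) 1, W 0 2}" "p \<in> {W 1 (- 1), W (- 1) 1, W (- 1) 0, W 0 (- 1)}"
      using p by (auto simp: antipodes_2_iff adj_U_iff adj_W_iff)
    then show "p \<in> {W (- 1) 1, W 0 2}"
      using notZ by (auto simp: W_eq)
  qed
  then have "card (antipodes G 2 (W 0 1) (U 0 0) (W 0 0)) \<le> card {W (- 1) 1, W 0 2}"
    by (intro card_mono) auto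
  also have "\<dots> \<le> 2"
    by (simp add: card_insert_if)
  also have "2 < card {W 2 (- 1), W 2 0, W 1 (- 1)}"
    using notZ by (simp add: W_eq card_insert_if)
  also have "\<dots> \<le> card (antipodes G 2 (W 1 0) (U 0 0) (W 0 0))"
  proof (rule card_mono)
    show "finite (antipodes G 2 (W 1 0) (U 0 0) (W 0 0))"
    proof (rule finite_subset[OF _ pair_finite_verts])
      show "antipodes G 2 (W 1 0) (U 0 0) (W 0 0) \<subseteq> pverts G"
        by (auto simp: antipodes_2_iff dest: in_arcsD2)
    qed
    \<comment> \<open>The relation gives two of the three vertices second coordinates, through which
      they are reached from \<open>W 0 0\<close>.\<close>
    have eq: "W 2 (- 1) = W (- 1) 0" "W 2 0 = W (- 1) 1"
      using Z Z_uminus[of 3 "- 1"] by (simp_all add: W_eq)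
    have "W 2 (- 1) \<in> antipodes G 2 (W 1 0) (U 0 0) (W 0 0)"
      unfolding antipodes_2_iff
    proof (intro conjI)
      show "\<exists>s. (W 1 0, s) \<in> parcs G \<and> (s, W 2 (- 1)) \<in> parcs G"
        by (rule exI[of _ "U 1 (- 1)"]) (simp add: adj_U_iff adj_W_iff)
      show "\<exists>s. (W 0 0, s) \<in> parcs G \<and> (s, W 2 (- 1)) \<in> parcs G"
        unfolding eq by (rule exI[of _ "U (- 1) 0"]) (simp add: adj_U_iff adj_W_iff)
    qed (use notZ in \<open>simp add: adj_U_iff W_eq\<close>)
    moreover have "W 2 0 \<in> antipodes G 2 (W 1 0) (U 0 0) (W 0 0)"
      unfolding antipodes_2_iff
    proof (intro conjI)
      show "\<exists>s. (W 1 0, s) \<in> parcs G \<and> (s, W 2 0) \<in> parcs G"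
        by (rule exI[of _ "U 1 0"]) (simp add: adj_U_iff adj_W_iff)
      show "\<exists>s. (W 0 0, s) \<in> parcs G \<and> (s, W 2 0) \<in> parcs G"
        unfolding eq by (rule exI[of _ "U (- 1) 0"]) (simp add: adj_U_iff adj_W_iff)
    qed (use notZ in \<open>simp add: adj_U_iff W_eq\<close>)
    moreover have "W 1 (- 1) \<in> antipodes G 2 (W 1 0) (U 0 0) (W 0 0)"
      unfolding antipodes_2_iff
    proof (intro conjI)
      show "\<exists>s. (W 1 0, s) \<in> parcs G \<and> (s, W 1 (- 1)) \<in> parcs G"
        by (rule exI[of _ "U 1 (- 1)"]) (simp add: adj_U_iff adj_W_iff)
      show "\<exists>s. (W 0 0, s) \<in> parcs G \<and> (s, W 1 (- 1)) \<in> parcs G"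
        by (rule exI[of _ "U 0 (- 1)"]) (simp add: adj_U_iff adj_W_iff)
    qed (use notZ in \<open>simp add: adj_U_iff W_eq\<close>)
    ultimately show "{W 2 (- 1), W 2 0, W 1 (- 1)} \<subseteq> antipodes G 2 (W 1 0) (U 0 0) (W 0 0)"
      by blast
  qed
  also have "\<dots> = card (antipodes G 2 (W 0 1) (U 0 0) (W 0 0))"
    using not_Z by (intro card_antipodes_eq) (auto simp: adj_U_iff W_eq)
  finally show False
    by simp
qed

text \<open>Excluding \<open>Z 3 (- 1)\<close> in all six orders of the steps removes every extra
  relation except \<open>Z 3 (- 3)\<close>, here and after rotation. The two survivors have a
  determinant of 9, but sharing the factor 3 they give more: \<open>n\<close> divides
  \<open>3 * x\<close> and \<open>3 * y\<close>, hence 3.\<close>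

theorem (in haar_like) splittable: "splittable_graph G"
proof (rule ccontr)
  assume not_split: "\<not> splittable_graph G"
  have rotated: "haar_like G side n (y - x) (- x) (\<lambda>\<alpha> \<beta>. U (- \<alpha> - \<beta>) \<alpha>) (\<lambda>\<alpha> \<beta>. W (1 - \<alpha> - \<beta>) \<alpha>)"
    by (rule rotate)
  have swapped: "haar_like G side n y x (\<lambda>\<alpha> \<beta>. U \<beta> \<alpha>) (\<lambda>\<alpha> \<beta>. W \<beta> \<alpha>)"
    by (rule swap)
  note 1 = haar_like.not_Z_3_m1[OF _ not_split]
  have "\<not> Z 3 (- 1)" "\<not> Z (- 1) 3" "\<not> Z (- 2) 3" "\<not> Z 3 (- 2)" "\<not> Z (- 1) (- 2)" "\<not> Z (- 2) (- 1)"
    using 1[OF haar_like_axioms] 1[OF swapped] 1[OF rotated] 1[OF haar_like.rotate[OF rotated]]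
      1[OF haar_like.rotate[OF swapped]] 1[OF haar_like.rotate[OF haar_like.rotate[OF swapped]]]
    by (simp_all add: lin_dvd_def algebra_simps)
  moreover have "Z 0 3 \<or> Z (- 1) 3 \<or> Z (- 1) (- 2) \<or> Z (- 2) (- 1) \<or> Z (- 2) 3"
    using haar_like.extra_relation[OF rotated not_split] by (simp add: lin_dvd_def algebra_simps)
  ultimately have Z: "Z 3 (- 3)" "Z 0 3"
    using extra_relation[OF not_split] by auto
  then have "Z 3 0"
    using Z_add[OF Z] by simp
  then have "int n dvd 3"
    using Z(2) dvd_if_dvd_mult[of 3] by (simp add: lin_dvd_def)
  then show False
    using n_ge n_le_if_dvd[of 3] by simp
qed

section \<open>I-graphs\<close>

lemma alternating_int:
  fixes P :: "int \<Rightarrow> bool"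
  assumes "\<And>i. P (i + 1) \<longleftrightarrow> \<not> P i"
  shows "P i \<longleftrightarrow> (P 0 \<longleftrightarrow> even i)"
proof (induction i rule: int_induct[of _ 0])
  case (step1 i)
  then show ?case
    using assms[of i] by auto
next
  case (step2 i)
  then show ?case
    using assms[of "i - 1"] by auto
qed simp

text \<open>This is \<open>gen_petersen n r\<close>, first the rim with step \<open>r\<close>, then
  the rim with step 1. Adding \<open>n - r\<close> or \<open>n - 1\<close> avoids truncated
  subtraction.\<close>

definition igraph_lists :: "nat \<Rightarrow> nat \<Rightarrow> nat list list" where
  "igraph_lists n r =
     map (\<lambda>i. [(i + r) mod n, (i + (n - r)) mod n, n + i]) [0..<n] @
     map (\<lambda>i. [n + (i + 1) mod n, n + (i + (n - 1)) mod n, i]) [0..<n]"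

locale igraph_like = two_orbits +
  assumes adj_U: "{z. (U \<alpha> \<beta>, z) \<in> parcs G} = {U (\<alpha> + 1) \<beta>, U (\<alpha> - 1) \<beta>, W \<alpha> \<beta>}"
    and adj_W: "{z. (W \<alpha> \<beta>, z) \<in> parcs G} = {W \<alpha> (\<beta> + 1), W \<alpha> (\<beta> - 1), U \<alpha> \<beta>}"
begin

lemma adj_U_iff: "(U \<alpha> \<beta>, z) \<in> parcs G \<longleftrightarrow> z = U (\<alpha> + 1) \<beta> \<or> z = U (\<alpha> - 1) \<beta> \<or> z = W \<alpha> \<beta>"
  using adj_U[of \<alpha> \<beta>] by blast

lemma adj_W_iff: "(W \<alpha> \<beta>, z) \<in> parcs G \<longleftrightarrow> z = W \<alpha> (\<beta> + 1) \<or> z = W \<alpha> (\<beta> - 1) \<or> z = U \<alpha> \<beta>"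
  using adj_W[of \<alpha> \<beta>] by blast

lemma swap: "igraph_like G side n y x (\<lambda>\<alpha> \<beta>. W \<beta> \<alpha>) (\<lambda>\<alpha> \<beta>. U \<beta> \<alpha>)"
proof unfold_locales
  show "pverts G = {W \<beta> \<alpha> |\<alpha> \<beta>. True} \<union> {U \<beta> \<alpha> |\<alpha> \<beta>. True}"
    unfolding verts by blast
  show "d dvd 1" if "d dvd int n" "d dvd y" "d dvd x" for d
    using unit that by blast
qed (auto simp: U_eq W_eq card_verts n_ge adj_U adj_W lin_dvd_def add.commute)

lemma Z_swap: "lin_dvd (int n) y x \<alpha> \<beta> \<longleftrightarrow> Z \<beta> \<alpha>"
  by (simp add: lin_dvd_def add.commute)

lemma two_steps_U: "(\<exists>s. (U \<alpha> \<beta>, s) \<in> parcs G \<and> (s, p) \<in> parcs G) \<longleftrightarrow>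
    p \<in> {U (\<alpha> + 2) \<beta>, U (\<alpha> - 2) \<beta>, U \<alpha> \<beta>, W (\<alpha> + 1) \<beta>, W (\<alpha> - 1) \<beta>, W \<alpha> (\<beta> + 1), W \<alpha> (\<beta> - 1)}"
  (is "?L \<longleftrightarrow> ?R")
proof -
  have "?L \<longleftrightarrow> (U (\<alpha> + 1) \<beta>, p) \<in> parcs G \<or> (U (\<alpha> - 1) \<beta>, p) \<in> parcs G \<or> (W \<alpha> \<beta>, p) \<in> parcs G"
    unfolding adj_U_iff[of \<alpha> \<beta>] by blast
  also have "\<dots> \<longleftrightarrow> ?R"
    unfolding adj_U_iff adj_W_iff by (auto simp: algebra_simps)
  finally show ?thesis .
qed

lemma two_steps_W: "(\<exists>s. (W \<alpha> \<beta>, s) \<in> parcs G \<and> (s, p) \<in> parcs G) \<longleftrightarrow>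
    p \<in> {W \<alpha> (\<beta> + 2), W \<alpha> (\<beta> - 2), W \<alpha> \<beta>, U \<alpha> (\<beta> + 1), U \<alpha> (\<beta> - 1), U (\<alpha> + 1) \<beta>, U (\<alpha> - 1) \<beta>}"
  (is "?L \<longleftrightarrow> ?R")
proof -
  have "?L \<longleftrightarrow> (W \<alpha> (\<beta> + 1), p) \<in> parcs G \<or> (W \<alpha> (\<beta> - 1), p) \<in> parcs G \<or> (U \<alpha> \<beta>, p) \<in> parcs G"
    unfolding adj_W_iff[of \<alpha> \<beta>] by blast
  also have "\<dots> \<longleftrightarrow> ?R"
    unfolding adj_U_iff adj_W_iff by (auto simp: algebra_simps)
  finally show ?thesis .
qed

text \<open>Every step, in either orbit, changes the colour, and a relation closes a walk of such
  steps. This halves the relations to be considered later.\<close>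

lemma Z_even:
  assumes "Z \<alpha> \<beta>"
  shows "even (\<alpha> + \<beta>)"
proof -
  have U: "side (U \<alpha> \<beta>) \<longleftrightarrow> (side (U 0 \<beta>) \<longleftrightarrow> even \<alpha>)" for \<alpha> \<beta>
    by (rule alternating_int, rule side) (simp add: adj_U_iff)
  have W: "side (W 0 \<beta>) \<longleftrightarrow> (side (W 0 0) \<longleftrightarrow> even \<beta>)" for \<beta>
    by (rule alternating_int, rule side) (simp add: adj_W_iff)
  have UW: "side (W 0 \<beta>) \<longleftrightarrow> \<not> side (U 0 \<beta>)" for \<beta>
    by (rule side) (simp add: adj_U_iff)
  have "U \<alpha> \<beta> = U 0 0"
    using assms by (simp add: U_eq)
  then show ?thesis
    using U[of \<alpha> \<beta>] W[of \<beta>] UW[of \<beta>] UW[of 0] by auto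
qed

lemma not_Z_odd: "odd (\<alpha> + \<beta>) \<Longrightarrow> \<not> Z \<alpha> \<beta>"
  using Z_even by blast

lemma even_n: "even n"
  using Z_even[of "int n" 0] by (simp add: lin_dvd_def)

section \<open>Short relations excluded by cubicity and girth\<close>

lemma not_Z_2_0: "\<not> Z 2 0"
proof -
  have "card {U 1 0, U (- 1) 0, W 0 0} = 3"
    using degree[of "U 0 0"] adj_U[of 0 0] unfolding verts by simp blast
  then show ?thesis
    by (auto simp: card_insert_if U_eq split: if_splits)
qed

lemma not_Z_4_0: "\<not> Z 4 0"
proof
  assume Z: "Z 4 0"
  then have eq: "U 3 0 = U (- 1) 0"
    by (simp add: U_eq)
  have "(U 2 0, U 3 0) \<in> parcs G"
    by (simp add: adj_U_iff)
  then have "U 0 0 = U 2 0 \<or> U 1 0 = U (- 1) 0"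
    unfolding eq by (intro no_square[of _ "U 1 0" "U (- 1) 0"]) (simp_all add: adj_U_iff)
  then show False
    using not_Z_2_0 Z_uminus[of 2 0] by (auto simp: U_eq)
qed

lemma not_Z_1_1: "\<not> Z 1 1" "\<not> Z 1 (- 1)"
proof -
  have "\<not> Z 1 r" if "r = 1 \<or> r = - 1" for r
  proof
    assume Z: "Z 1 r"
    then have eq: "W 1 r = W 0 0"
      by (simp add: W_eq)
    have "(W 1 0, W 1 r) \<in> parcs G"
      using that by (auto simp: adj_W_iff)
    then have "U 0 0 = W 1 0 \<or> U 1 0 = W 0 0"
      unfolding eq by (intro no_square[of _ "U 1 0" "W 0 0"]) (simp_all add: adj_U_iff adj_W_iff)
    then show False
      by simp
  qed
  then show "\<not> Z 1 1" "\<not> Z 1 (- 1)"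
    by auto
qed

lemma not_Z_small: "\<not> Z 2 0" "\<not> Z 4 0" "\<not> Z 0 2" "\<not> Z 0 4" "\<not> Z 1 1" "\<not> Z 1 (- 1)"
  using not_Z_2_0 not_Z_4_0 not_Z_1_1 igraph_like.not_Z_2_0[OF swap] igraph_like.not_Z_4_0[OF swap]
  by (simp_all add: Z_swap)

lemma Z_neg: "Z (- \<alpha>) \<beta> \<longleftrightarrow> Z \<alpha> (- \<beta>)" "Z 0 (- \<beta>) \<longleftrightarrow> Z 0 \<beta>"
  using Z_uminus[of \<alpha> "- \<beta>"] Z_uminus[of 0 \<beta>] by simp_all

lemma Z_0_0: "Z 0 0"
  by (simp add: lin_dvd_def)

text \<open>The two lists are what remains of the walks from either end. Their possible coincidences
  are the three kinds of hexagons through a spoke: \<open>x\<close> is three times \<open>y\<close>,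
  \<open>y\<close> is three times \<open>x\<close>, or their doubles agree, each up to sign.\<close>

lemma antipodes_spoke:
  "antipodes G 2 (U 1 0) (U 0 0) (W 0 0) =
    {U 3 0, W 2 0, W 1 1, W 1 (- 1)} \<inter> {W 0 2, W 0 (- 2), U 0 1, U 0 (- 1)}"
  (is "?L = ?R")
proof (rule Set.set_eqI)
  fix p
  have "p \<in> ?L \<longleftrightarrow> p \<notin> {U 1 0, U (- 1) 0, W 0 0} \<and>
      p \<in> {U 3 0, U (- 1) 0, U 1 0, W 2 0, W 0 0, W 1 1, W 1 (- 1)} \<and>
      p \<in> {W 0 2, W 0 (- 2), W 0 0, U 0 1, U 0 (- 1), U 1 0, U (- 1) 0}"
    unfolding antipodes_2_iff two_steps_U two_steps_W by (auto simp: adj_U_iff)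
  also have "\<dots> \<longleftrightarrow> p \<in> ?R"
    using not_Z_small by (auto simp: U_eq W_eq Z_neg)
  finally show "p \<in> ?L \<longleftrightarrow> p \<in> ?R" .
qed

text \<open>A single kind of hexagon produces exactly one antipode and thus a splitting. So either
  no kind occurs or at least two do, and two kinds bound \<open>n\<close>.\<close>

lemma hexagon_relations:
  assumes not_split: "\<not> splittable_graph G"
  shows "n = 10 \<and> (Z 1 3 \<or> Z 1 (- 3)) \<or>
    \<not> Z 3 1 \<and> \<not> Z 3 (- 1) \<and> \<not> Z 1 3 \<and> \<not> Z 1 (- 3) \<and> \<not> Z 2 2 \<and> \<not> Z 2 (- 2)"
proof -
  let ?P = "{U 3 0, W 2 0, W 1 1, W 1 (- 1)} \<inter> {W 0 2, W 0 (- 2), U 0 1, U 0 (- 1)}"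
  have "card ?P \<noteq> 1"
    using splittable_if_unique_antipode[of "U 0 0" "U 1 0" "W 0 0"] not_split n_ge card_verts
    by (auto simp: antipodes_spoke adj_U_iff)
  then have single: "?P \<noteq> {p}" for p
    by auto
  have A: "(Z 1 3 \<or> Z 1 (- 3)) \<or> (Z 2 2 \<or> Z 2 (- 2))" if "Z 3 1 \<or> Z 3 (- 1)"
  proof (rule ccontr)
    assume no: "\<not> ?thesis"
    have "?P = {U 3 0}"
      using that no not_Z_small by (auto simp: U_eq W_eq Z_neg)
    then show False
      using single by blast
  qed
  have B: "(Z 3 1 \<or> Z 3 (- 1)) \<or> (Z 2 2 \<or> Z 2 (- 2))" if "Z 1 3 \<or> Z 1 (- 3)"
  proof (rule ccontr)
    assume no: "\<not> ?thesis"
    have "\<not> (Z 1 3 \<and> Z 1 (- 3))"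
      using Z_add[of 1 3 1 "- 3"] not_Z_2_0 by auto
    then have "?P = {W 1 1} \<or> ?P = {W 1 (- 1)}"
      using that no not_Z_small by (auto simp: U_eq W_eq Z_neg)
    then show False
      using single by blast
  qed
  have C: "(Z 3 1 \<or> Z 3 (- 1)) \<or> (Z 1 3 \<or> Z 1 (- 3))" if "Z 2 2 \<or> Z 2 (- 2)"
  proof (rule ccontr)
    assume no: "\<not> ?thesis"
    have "?P = {W 2 0}"
      using that no not_Z_small by (auto simp: U_eq W_eq Z_neg)
    then show False
      using single by blast
  qed
  have small: False if "Z \<alpha> \<beta>" "Z \<gamma> \<delta>" "\<alpha> * \<delta> - \<beta> * \<gamma> \<noteq> 0" "\<bar>\<alpha> * \<delta> - \<beta> * \<gamma>\<bar> \<le> 8" for \<alpha> \<beta> \<gamma> \<delta>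
    using n_le_if_dvd[OF Z_det[OF that(1,2)] that(3)] that(4) n_ge by linarith
  \<comment> \<open>Together with \<open>Z 2 2\<close> or \<open>Z 2 (- 2)\<close> all determinants
    are 4 or 8 up to sign, below the smallest admissible \<open>n\<close>.\<close>
  have "\<not> ((Z 3 1 \<or> Z 3 (- 1)) \<and> (Z 2 2 \<or> Z 2 (- 2)))"
    using small[of 3 1 2 2] small[of 3 1 2 "- 2"] small[of 3 "- 1" 2 2] small[of 3 "- 1" 2 "- 2"] by auto
  moreover have "\<not> ((Z 1 3 \<or> Z 1 (- 3)) \<and> (Z 2 2 \<or> Z 2 (- 2)))"
    using small[of 1 3 2 2] small[of 1 3 2 "- 2"] small[of 1 "- 3" 2 2] small[of 1 "- 3" 2 "- 2"] by auto
  moreover have "n = 10" if "Z 3 1 \<or> Z 3 (- 1)" "Z 1 3 \<or> Z 1 (- 3)"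
  proof -
    \<comment> \<open>Equal signs give the determinant 8, which is too small; opposite signs give
      10.\<close>
    have "int n dvd 10"
      using that small[of 3 1 1 3] small[of 3 "- 1" 1 "- 3"]
        Z_det[of 3 1 1 "- 3"] Z_det[of 3 "- 1" 1 3] by auto
    then have "n dvd 10"
      by presburger
    then have "n \<le> 10"
      by (auto dest: dvd_imp_le)
    then have "n = 9 \<or> n = 10"
      using n_ge by linarith
    then show ?thesis
      using \<open>n dvd 10\<close> by auto
  qed
  ultimately show ?thesis
    using A B C by blast
qed

section \<open>I-graphs without hexagons\<close>

context
  assumes no_hexagon: "\<not> Z 3 1" "\<not> Z 3 (- 1)" "\<not> Z 1 3" "\<not> Z 1 (- 3)" "\<not> Z 2 2" "\<not> Z 2 (- 2)"
begin

text \<open>Two neighbours of the octagon at distance at most two satisfy a relation. Parity, girth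
  and the absence of hexagons exclude all of these except the ones assumed away: for instance
  \<open>U (- 1) 0\<close> and \<open>U 2 1\<close> are two steps apart if
  \<open>Z 5 1\<close>.\<close>

lemma octagon_splits:
  assumes "\<not> Z 1 5" "\<not> Z 1 (- 5)" "\<not> Z 5 1" "\<not> Z 5 (- 1)"
  shows "splittable_graph G"
proof -
  \<comment> \<open>\<open>K\<close> is an octagon that occurs in every I-graph, and \<open>S\<close> consists of its neighbours.\<close>
  define K where "K = {U 0 0, U 1 0, W 1 0, W 1 1, U 1 1, U 0 1, W 0 1, W 0 0}"
  define S where "S = {U (- 1) 0, U 2 0, U 2 1, U (- 1) 1, W 0 (- 1), W 0 2, W 1 (- 1), W 1 2}"
  note facts = not_Z_odd not_Z_small no_hexagon assms Z_neg Z_0_0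
  \<comment> \<open>\<open>NU\<close> and \<open>NW\<close> list the vertices at distance at most
    two by coordinates, the centre included, so that each separation below becomes a finite list of
    relations to refute.\<close>
  define NU where "NU \<alpha> \<beta> = {U (\<alpha> + 1) \<beta>, U (\<alpha> - 1) \<beta>, W \<alpha> \<beta>, U (\<alpha> + 2) \<beta>, U (\<alpha> - 2) \<beta>, U \<alpha> \<beta>,
    W (\<alpha> + 1) \<beta>, W (\<alpha> - 1) \<beta>, W \<alpha> (\<beta> + 1), W \<alpha> (\<beta> - 1)}" for \<alpha> \<beta>
  define NW where "NW \<alpha> \<beta> = {W \<alpha> (\<beta> + 1), W \<alpha> (\<beta> - 1), U \<alpha> \<beta>, W \<alpha> (\<beta> + 2), W \<alpha> (\<beta> - 2), W \<alpha> \<beta>,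
    U \<alpha> (\<beta> + 1), U \<alpha> (\<beta> - 1), U (\<alpha> + 1) \<beta>, U (\<alpha> - 1) \<beta>}" for \<alpha> \<beta>
  define N where "N p = {q. (p, q) \<in> parcs G \<or> (\<exists>w. (p, w) \<in> parcs G \<and> (w, q) \<in> parcs G)}" for p
  have NU: "N (U \<alpha> \<beta>) = NU \<alpha> \<beta>" for \<alpha> \<beta>
    unfolding N_def two_steps_U NU_def by (auto simp: adj_U_iff)
  have NW: "N (W \<alpha> \<beta>) = NW \<alpha> \<beta>" for \<alpha> \<beta>
    unfolding N_def two_steps_W NW_def by (auto simp: adj_W_iff)
  have sep: "S \<inter> NU (- 1) 0 \<subseteq> {U (- 1) 0}" "S \<inter> NU 2 0 \<subseteq> {U 2 0}"
    "S \<inter> NU 2 1 \<subseteq> {U 2 1}" "S \<inter> NU (- 1) 1 \<subseteq> {U (- 1) 1}"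
    "S \<inter> NW 0 (- 1) \<subseteq> {W 0 (- 1)}" "S \<inter> NW 0 2 \<subseteq> {W 0 2}"
    "S \<inter> NW 1 (- 1) \<subseteq> {W 1 (- 1)}" "S \<inter> NW 1 2 \<subseteq> {W 1 2}"
    unfolding S_def NU_def NW_def by (simp_all add: Int_insert_left U_eq W_eq facts)
  have "\<forall>p\<in>{U (- 1) 0, U 2 0, U 2 1, U (- 1) 1, W 0 (- 1), W 0 2, W 1 (- 1), W 1 2}. S \<inter> N p \<subseteq> {p}"
    by (simp only: ball_simps NU NW sep simp_thms)
  then have 1: "\<forall>p\<in>S. \<forall>q\<in>S. p \<noteq> q \<longrightarrow>
      (p, q) \<notin> parcs G \<and> \<not> (\<exists>w. (p, w) \<in> parcs G \<and> (w, q) \<in> parcs G)"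
    unfolding S_def[symmetric] N_def by blast
  have 2: "K \<inter> S = {}"
    by (auto simp: K_def S_def U_eq W_eq facts)
  have 3: "\<forall>p\<in>K. \<forall>q. (p, q) \<in> parcs G \<longrightarrow> q \<in> K \<union> S"
    by (simp add: K_def S_def adj_U_iff adj_W_iff)
  have 4: "K \<subseteq> pverts G" "S \<subseteq> pverts G"
    unfolding K_def S_def verts by blast+
  \<comment> \<open>Since \<open>n\<close> is at least 9, there are at least 18 vertices, so
    something remains beyond the octagon and its neighbours.\<close>
  have "card (K \<union> S) \<le> 16"
    using card_Un_le[of K S] card_length[of "[U 0 0, U 1 0, W 1 0, W 1 1, U 1 1, U 0 1, W 0 1, W 0 0]"]
      card_length[of "[U (- 1) 0, U 2 0, U 2 1, U (- 1) 1, W 0 (- 1), W 0 2, W 1 (- 1), W 1 2]"]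
    by (simp add: K_def S_def)
  then have "K \<union> S \<noteq> pverts G"
    using card_verts n_ge by auto
  then have 5: "K \<subset> pverts G - S"
    using 2 4 by blast
  show ?thesis
    unfolding splittable_graph_iff
  proof (rule exI[of _ S], rule exI[of _ K], intro conjI)
    show "K \<noteq> {}"
      by (simp add: K_def)
  qed (fact 4(2) 1 5 3)+
qed

text \<open>The relation would make six consecutive \<open>U\<close>-steps a hexagon. No hexagon
  passes through a spoke, so by transitivity none contains two consecutive
  \<open>U\<close>-steps.\<close>

lemma not_Z_6_0: "\<not> Z 6 0"
proof
  assume Z: "Z 6 0"
  have "antipodes G 2 (U 1 0) (U 0 0) (W 0 0) = {}"
    unfolding antipodes_spoke using no_hexagon not_Z_small by (auto simp: U_eq W_eq Z_neg)
  then have "card (antipodes G 2 (U 1 0) (U 0 0) (U (- 1) 0)) = 0"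
    using card_antipodes_eq[of "U 0 0" "U 1 0" "U (- 1) 0" "U 0 0" "U 1 0" "W 0 0" 2] not_Z_2_0
    by (simp add: adj_U_iff U_eq Z_neg)
  moreover have "finite (antipodes G 2 (U 1 0) (U 0 0) (U (- 1) 0))"
    by (rule finite_subset[OF _ pair_finite_verts]) (auto simp: antipodes_2_iff dest: in_arcsD2)
  moreover have "U 3 0 \<in> antipodes G 2 (U 1 0) (U 0 0) (U (- 1) 0)"
    unfolding antipodes_2_iff two_steps_U using Z not_Z_small by (simp add: adj_U_iff U_eq Z_neg)
  ultimately show False
    by auto
qed

text \<open>The common octagon gives the path \<open>U 1 0\<close>, \<open>U 0 0\<close>,
  \<open>W 0 0\<close> the antipode \<open>U 1 1\<close>. By transitivity the path
  \<open>U 1 0\<close>, \<open>U 0 0\<close>, \<open>U (- 1) 0\<close> has an antipode too; it gets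
  coordinates from either end, and their equality is one of these relations.\<close>

lemma octagon_relations:
  "Z 8 0 \<or> Z 5 1 \<or> Z 5 (- 1) \<or> Z 4 2 \<or> Z 4 (- 2) \<or> Z 3 3 \<or> Z 3 (- 3) \<or> Z 2 4 \<or> Z 2 (- 4)"
proof -
  have a3: "p \<in> antipodes G 3 a b c \<longleftrightarrow> \<not> (\<exists>s. (b, s) \<in> parcs G \<and> (s, p) \<in> parcs G) \<and>
      (\<exists>s. (a, s) \<in> parcs G \<and> (\<exists>t. (s, t) \<in> parcs G \<and> (t, p) \<in> parcs G)) \<and>
      (\<exists>s. (c, s) \<in> parcs G \<and> (\<exists>t. (s, t) \<in> parcs G \<and> (t, p) \<in> parcs G))" for p a b c
    by (auto simp: antipodes_def numeral_2_eq_2 numeral_3_eq_3)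
  have fin: "finite (antipodes G 3 a b c)" for a b c
    by (rule finite_subset[OF _ pair_finite_verts]) (auto simp: a3 dest: in_arcsD2)
  have "U 1 1 \<in> antipodes G 3 (U 1 0) (U 0 0) (W 0 0)"
    unfolding a3
  proof (intro conjI)
    show "\<not> (\<exists>s. (U 0 0, s) \<in> parcs G \<and> (s, U 1 1) \<in> parcs G)"
      unfolding two_steps_U by (simp add: U_eq Z_neg not_Z_small not_Z_odd no_hexagon)
    show "\<exists>s. (U 1 0, s) \<in> parcs G \<and> (\<exists>t. (s, t) \<in> parcs G \<and> (t, U 1 1) \<in> parcs G)"
      by (rule exI[of _ "W 1 0"]) (simp only: two_steps_W adj_U_iff, simp)
    show "\<exists>s. (W 0 0, s) \<in> parcs G \<and> (\<exists>t. (s, t) \<in> parcs G \<and> (t, U 1 1) \<in> parcs G)"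
      by (rule exI[of _ "W 0 1"]) (simp only: two_steps_W adj_W_iff[of 0 0 "W 0 1"], simp)
  qed
  then have "card (antipodes G 3 (U 1 0) (U 0 0) (W 0 0)) \<noteq> 0"
    using fin by auto
  then have "card (antipodes G 3 (U 1 0) (U 0 0) (U (- 1) 0)) \<noteq> 0"
    using card_antipodes_eq[of "U 0 0" "U 1 0" "U (- 1) 0" "U 0 0" "U 1 0" "W 0 0" 3] not_Z_2_0
    by (simp add: adj_U_iff U_eq Z_neg)
  then obtain p where p: "p \<in> antipodes G 3 (U 1 0) (U 0 0) (U (- 1) 0)"
    by fastforce
  have three_steps: "(\<exists>s. (U \<alpha> \<beta>, s) \<in> parcs G \<and> (\<exists>t. (s, t) \<in> parcs G \<and> (t, p) \<in> parcs G)) \<longleftrightarrow>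
    (\<exists>t. (U (\<alpha> + 1) \<beta>, t) \<in> parcs G \<and> (t, p) \<in> parcs G) \<or>
    (\<exists>t. (U (\<alpha> - 1) \<beta>, t) \<in> parcs G \<and> (t, p) \<in> parcs G) \<or>
    (\<exists>t. (W \<alpha> \<beta>, t) \<in> parcs G \<and> (t, p) \<in> parcs G)" for \<alpha> \<beta>
    unfolding adj_U_iff[of \<alpha> \<beta>] by blast
  have p0: "p \<notin> {U 2 0, U (- 2) 0, U 0 0, W 1 0, W (- 1) 0, W 0 1, W 0 (- 1)}"
    and p1: "p \<in> {U 4 0, W 3 0, W 2 1, W 2 (- 1), W 1 2, W 1 (- 2), U 1 1, U 1 (- 1)} \<union>
      {U 2 0, U (- 2) 0, U 0 0, W 1 0, W (- 1) 0, W 0 1, W 0 (- 1)}"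
    and p2: "p \<in> {U (- 4) 0, W (- 3) 0, W (- 2) 1, W (- 2) (- 1), W (- 1) 2, W (- 1) (- 2),
        U (- 1) 1, U (- 1) (- 1)} \<union>
      {U 2 0, U (- 2) 0, U 0 0, W 1 0, W (- 1) 0, W 0 1, W 0 (- 1)}"
    using p unfolding a3 three_steps two_steps_U two_steps_W by simp_all blast+
  then have "p \<in> {U 4 0, W 3 0, W 2 1, W 2 (- 1), W 1 2, W 1 (- 2), U 1 1, U 1 (- 1)}"
    "p \<in> {U (- 4) 0, W (- 3) 0, W (- 2) 1, W (- 2) (- 1), W (- 1) 2, W (- 1) (- 2),
        U (- 1) 1, U (- 1) (- 1)}"
    by blast+
  then show ?thesis
    by (elim insertE emptyE; clarsimp simp: U_eq W_eq Z_neg not_Z_odd not_Z_small no_hexagon not_Z_6_0)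
qed

text \<open>The determinants of the given relation with the octagon relations are, up to sign, 40,
  24, 26, 18, 22, 12, 14 and 6, so \<open>n\<close> is an even divisor of one of them.\<close>

lemma order_cases:
  assumes "Z 1 5 \<or> Z 1 (- 5)"
  shows "n \<in> {18, 22, 24, 26, 40}"
proof -
  obtain e where e: "Z 1 (5 * e)" "e = 1 \<or> e = - 1"
    using assms by force
  have mult: "Z m (m * (5 * e) + int n * l)" for m l
  proof -
    have "int n dvd m * (1 * x + 5 * e * y) + int n * (l * y)"
      by (rule dvd_add[OF dvd_mult[OF e(1)[unfolded lin_dvd_def]] dvd_triv_left])
    then show ?thesis
      by (simp add: lin_dvd_def algebra_simps)
  qed
  \<comment> \<open>For 10, 20, 12 and 14, a multiple of the given relation reduces modulo
    \<open>n\<close> to one already excluded: \<open>2 * 5 = 10\<close>, \<open>4 * 5 = 20\<close>,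
    \<open>2 * 5 = 12 - 2\<close> and \<open>3 * 5 = 14 + 1\<close>.\<close>
  have 10: "n \<noteq> 10"
    using mult[of 2 "- e"] not_Z_2_0 by auto
  have 20: "n \<noteq> 20"
    using mult[of 4 "- e"] not_Z_4_0 by auto
  have 12: "n \<noteq> 12"
    using mult[of 2 "- e"] no_hexagon e(2) by auto
  have 14: "n \<noteq> 14"
    using mult[of 3 "- e"] no_hexagon e(2) by auto
  have dvd: "n dvd 40 \<or> n dvd 24 \<or> n dvd 26 \<or> n dvd 18 \<or> n dvd 22 \<or> n dvd 12 \<or> n dvd 14 \<or> n dvd 6"
  proof -
    have det: "int n dvd \<bar>\<delta> - 5 * e * \<gamma>\<bar>" if "Z \<gamma> \<delta>" for \<gamma> \<delta>
      using Z_det[OF e(1) that] by simp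
    have conv: "int n dvd numeral w \<longleftrightarrow> n dvd numeral w" for w
      by (metis int_dvd_int_iff of_nat_numeral)
    show ?thesis
      using octagon_relations e(2) det[of 8 0] det[of 5 1] det[of 5 "- 1"] det[of 4 2] det[of 4 "- 2"]
        det[of 3 3] det[of 3 "- 3"] det[of 2 4] det[of 2 "- 4"]
      by (auto simp: conv)
  qed
  have range: "n \<in> set [9..<41]"
  proof -
    have "n \<le> 40"
      using dvd by (auto dest: dvd_imp_le)
    then show ?thesis
      unfolding set_upt atLeastLessThan_iff using n_ge by linarith
  qed
  have check: "\<forall>m \<in> set [9..<41]. even m \<longrightarrow> (m dvd 40 \<or> m dvd 24 \<or> m dvd 26 \<or> m dvd 18 \<or> m dvd 22 \<or>
      m dvd 12 \<or> m dvd 14 \<or> m dvd (6 :: nat)) \<longrightarrow> m \<in> {10, 12, 14, 18, 20, 22, 24, 26, 40}"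
    by code_simp
  have "n \<in> {10, 12, 14, 18, 20, 22, 24, 26, 40}"
    by (rule check[rule_format, OF range even_n dvd])
  then show ?thesis
    using 10 12 14 20 by simp
qed

end

end

section \<open>Reduction to explicit generalized Petersen graphs\<close>

definition (in two_orbits) std_vertex :: "nat \<Rightarrow> 'a" where
  "std_vertex i = (if i < n then U 0 (int i) else W 0 (int i - int n))"

text \<open>The relation expresses \<open>x\<close> as a multiple of \<open>y\<close>, so
  \<open>Z 0 m\<close> holds only for multiples of \<open>n\<close>. Hence the vertices
  \<open>U 0 i\<close> and \<open>W 0 i\<close> with \<open>i\<close> below \<open>n\<close> are
  distinct, and by counting they are all vertices.\<close>

lemma (in igraph_like) presents_igraph_lists:
  assumes Z: "Z 1 (int r) \<or> Z 1 (- int r)" and r: "0 < r" "r < n"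
  shows "presents G std_vertex (igraph_lists n r)"
proof -
  obtain s where s: "Z 1 s" "s = int r \<or> s = - int r"
    using Z by blast
  have Z0: "Z 0 m \<longleftrightarrow> int n dvd m" for m
    using Z_det[OF s(1), of 0 m] by (auto simp: lin_dvd_def)
  have len: "length (igraph_lists n r) = 2 * n"
    by (simp add: igraph_lists_def)
  have low: "igraph_lists n r ! i = [(i + r) mod n, (i + (n - r)) mod n, n + i]" if "i < n" for i
    using that by (simp add: igraph_lists_def nth_append)
  have high: "igraph_lists n r ! (n + i) = [n + (i + 1) mod n, n + (i + (n - 1)) mod n, i]" if "i < n" for i
    using that by (simp add: igraph_lists_def nth_append)
  have UW_mod: "std_vertex (m mod n) = U 0 (int m)" "std_vertex (n + m mod n) = W 0 (int m)" for m
    using n_ge by (simp_all add: std_vertex_def U_eq W_eq Z0 zmod_int mod_eq_dvd_iff[symmetric])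
  have lt: "m mod n < 2 * n" for m
    using mod_less_divisor[of n m] n_ge by linarith
  have V: "pverts G = std_vertex ` {..<2 * n}"
  proof (rule sym, rule card_subset_eq[OF pair_finite_verts])
    show "std_vertex ` {..<2 * n} \<subseteq> pverts G"
      by (auto simp: std_vertex_def verts)
    have "inj_on std_vertex {..<2 * n}"
    proof (rule inj_onI)
      fix i j assume "i \<in> {..<2 * n}" "j \<in> {..<2 * n}" "std_vertex i = std_vertex j"
      then have "i < n \<longleftrightarrow> j < n" "int n dvd int i - int j" "\<bar>int i - int j\<bar> < int n"
        by (auto simp: std_vertex_def U_eq W_eq Z0 split: if_splits)
      then show "i = j"
        using n_le_if_dvd[of "int i - int j"] by auto
    qed
    then show "card (std_vertex ` {..<2 * n}) = card (pverts G)"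
      by (simp add: card_image card_verts)
  qed
  have inj: "inj_on std_vertex {..<2 * n}"
    using V card_verts by (intro eq_card_imp_inj_on) auto
  have "set (igraph_lists n r ! i) \<subseteq> {..<2 * n} \<and>
      {z. (std_vertex i, z) \<in> parcs G} = std_vertex ` set (igraph_lists n r ! i)" if i: "i < 2 * n" for i
  proof (cases "i < n")
    case True
    have "U 1 (int i) = U 0 (int i - s)" "U (- 1) (int i) = U 0 (int i + s)"
      using s(1) Z_uminus[of 1 s] by (simp_all add: U_eq)
    moreover have "U 0 (int (i + (n - r))) = U 0 (int i - int r)" "U 0 (int (i + r)) = U 0 (int i + int r)"
      "std_vertex (n + i) = W 0 (int i)" "std_vertex i = U 0 (int i)"
      using r True by (simp_all add: U_eq Z0 std_vertex_def)
    ultimately show ?thesis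
      using s(2) True n_ge unfolding low[OF True] by (auto simp: adj_U_iff UW_mod lt)
  next
    case False
    define j where "j = i - n"
    then have j: "i = n + j" "j < n"
      using False i by auto
    have "W 0 (int (j + (n - 1))) = W 0 (int j - 1)" "W 0 (int (j + 1)) = W 0 (int j + 1)"
      "std_vertex (n + j) = W 0 (int j)" "std_vertex j = U 0 (int j)"
      using j n_ge by (simp_all add: W_eq Z0 std_vertex_def)
    then show ?thesis
      using j(2) n_ge unfolding j(1) high[OF j(2)] by (auto simp: adj_W_iff UW_mod)
  qed
  then show ?thesis
    unfolding presents_def len using V inj by (simp add: bij_betw_def)
qed

definition uneven :: "nat list list \<Rightarrow> nat \<Rightarrow> nat \<times> nat \<times> nat \<Rightarrow> nat \<times> nat \<times> nat \<Rightarrow> bool" where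
  "uneven al k P Q \<longleftrightarrow> (\<forall>(a, b, c) \<in> {P, Q}. a < length al \<and> b < length al \<and> c < length al \<and>
     a \<in> set (al ! b) \<and> c \<in> set (al ! b) \<and> a \<noteq> c) \<and> 0 < k \<and>
     (case P of (a, b, c) \<Rightarrow> case Q of (a', b', c') \<Rightarrow>
       length (antipode_list al k a b c) \<noteq> length (antipode_list al k a' b' c'))"

lemma (in symmetric_cubic) not_uneven:
  assumes "presents G \<phi> al"
  shows "\<not> uneven al k P Q"
proof
  assume un: "uneven al k P Q"
  obtain a b c a' b' c' where PQ: "P = (a, b, c)" "Q = (a', b', c')"
    by (metis surj_pair)
  have 1: "a < length al" "b < length al" "c < length al" "a \<in> set (al ! b)" "c \<in> set (al ! b)" "a \<noteq> c"
    "a' < length al" "b' < length al" "c' < length al" "a' \<in> set (al ! b')" "c' \<in> set (al ! b')" "a' \<noteq> c'"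
    "0 < k" "length (antipode_list al k a b c) \<noteq> length (antipode_list al k a' b' c')"
    using un unfolding uneven_def PQ by auto
  have "card (antipodes G k (\<phi> a) (\<phi> b) (\<phi> c)) = card (antipodes G k (\<phi> a') (\<phi> b') (\<phi> c'))"
    by (rule card_antipodes_eq) (use 1 presents_arc_iff[OF assms] presents_eq_iff[OF assms] in auto)
  then show False
    using card_antipodes_presents[OF assms] 1 by simp
qed

text \<open>Except for 26, a path on the rim with step 5 is compared with one on the rim with step
  1. Modulo 26 the square of 5 is -1, so multiplication by 5 exchanges the rims; a path ending in a
  spoke takes the place of the second one. For \<open>k = 3\<close> both paths then have four
  antipodes, hence \<open>k = 4\<close>.\<close>

lemma uneven_igraph_lists:
  "uneven (igraph_lists 18 5) 3 (5, 0, 13) (19, 18, 35)"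
  "uneven (igraph_lists 22 5) 3 (5, 0, 17) (23, 22, 43)"
  "uneven (igraph_lists 26 5) 4 (5, 0, 21) (5, 0, 26)"
  "uneven (igraph_lists 40 5) 3 (5, 0, 35) (41, 40, 79)"
  by code_simp+

text \<open>The deleted vertices are those with index 1 modulo 4 on the first rim and 3 modulo 4 on
  the second. Three cycles of length 12 remain, namely \<open>K\<close> and its rotations by 4 and
  8.\<close>

lemma splits_igraph_lists:
  "splits (igraph_lists 24 5) [1, 5, 9, 13, 17, 21, 27, 31, 35, 39, 43, 47]
     [0, 2, 7, 12, 14, 19, 24, 25, 26, 36, 37, 38]"
  by code_simp

lemma (in igraph_like) splittable_if_no_hexagon:
  assumes "\<not> Z 3 1" "\<not> Z 3 (- 1)" "\<not> Z 1 3" "\<not> Z 1 (- 3)" "\<not> Z 2 2" "\<not> Z 2 (- 2)"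
    and Z: "Z 1 5 \<or> Z 1 (- 5)"
  shows "splittable_graph G"
proof -
  have n: "n \<in> {18, 22, 24, 26, 40}"
    by (rule order_cases) (fact assms)+
  have p: "presents G std_vertex (igraph_lists n 5)"
    using Z n by (intro presents_igraph_lists) auto
  have "n = 24"
    using n not_uneven[OF p] uneven_igraph_lists by auto
  then show ?thesis
    using splittable_graph_if_splits[OF p] splits_igraph_lists by simp
qed

theorem (in igraph_like) splittable_or_presents_igraph_lists:
  "splittable_graph G \<or> n = 10 \<and> presents G std_vertex (igraph_lists 10 3)"
proof (rule ccontr)
  assume no: "\<not> ?thesis"
  have "\<not> (n = 10 \<and> (Z 1 3 \<or> Z 1 (- 3)))"
    using no presents_igraph_lists[of 3] by auto
  then have hex: "\<not> Z 3 1" "\<not> Z 3 (- 1)" "\<not> Z 1 3" "\<not> Z 1 (- 3)" "\<not> Z 2 2" "\<not> Z 2 (- 2)"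
    using hexagon_relations no by blast+
  have "\<not> Z 1 5 \<and> \<not> Z 1 (- 5)"
    using splittable_if_no_hexagon[OF hex] no by blast
  \<comment> \<open>Exchanging the two orbits turns these relations into the ones just
    excluded.\<close>
  moreover have "\<not> Z 5 1 \<and> \<not> Z (- 5) 1"
  proof -
    have "\<not> Z (- 3) 1" "\<not> Z (- 1) 3" "\<not> Z (- 2) 2"
      using hex by (simp_all add: Z_neg)
    then show ?thesis
      using igraph_like.splittable_if_no_hexagon[OF swap] hex no by (auto simp: Z_swap)
  qed
  ultimately show False
    using octagon_splits[OF hex] no by (auto simp: Z_neg)
qed

section \<open>Bicirculants\<close>

locale rotary = symmetric_cubic G side for G :: "'a pair_pre_digraph" and side +
  fixes n :: nat and u v :: "int \<Rightarrow> 'a"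
  assumes u_eq: "u i = u j \<longleftrightarrow> int n dvd i - j"
    and v_eq: "v i = v j \<longleftrightarrow> int n dvd i - j"
    and u_neq_v [simp]: "u i \<noteq> v j"
    and verts: "pverts G = range u \<union> range v"
    and card_verts: "card (pverts G) = 2 * n" and n_ge: "9 \<le> n"
    and shift_uu: "(u i, u j) \<in> parcs G \<longleftrightarrow> (u 0, u (j - i)) \<in> parcs G"
    and shift_uv: "(u i, v j) \<in> parcs G \<longleftrightarrow> (u 0, v (j - i)) \<in> parcs G"
    and shift_vv: "(v i, v j) \<in> parcs G \<longleftrightarrow> (v 0, v (j - i)) \<in> parcs G"
begin

lemma v_neq_u [simp]: "v i \<noteq> u j"
  using u_neq_v by metis

definition "Du = {d \<in> {0..<int n}. (u 0, u d) \<in> parcs G}"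
definition "Dv = {d \<in> {0..<int n}. (v 0, v d) \<in> parcs G}"
definition "X = {d \<in> {0..<int n}. (u 0, v d) \<in> parcs G}"

lemma finite_D [simp]: "finite Du" "finite Dv" "finite X"
  unfolding Du_def Dv_def X_def by (rule finite_subset[OF _ finite_atLeastLessThan_int], blast)+

lemma mod_eq: "u (i mod int n) = u i" "v (i mod int n) = v i"
  by (simp_all add: u_eq v_eq mod_eq_dvd_iff[symmetric])

lemma vertexE:
  assumes "z \<in> pverts G"
  obtains d where "d \<in> {0..<int n}" "z = u (i + d)" | d where "d \<in> {0..<int n}" "z = v (i + d)"
proof -
  obtain t where "z = u t \<or> z = v t"
    using assms unfolding verts by blast
  moreover have "(t - i) mod int n \<in> {0..<int n}"
    using n_ge by simp
  moreover have "u t = u (i + (t - i) mod int n)" "v t = v (i + (t - i) mod int n)"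
    unfolding u_eq v_eq by (simp_all add: mod_eq_dvd_iff[symmetric] mod_simps)
  ultimately show ?thesis
    using that by metis
qed

lemma neighbours_u: "{z. (u i, z) \<in> parcs G} = (\<lambda>d. u (i + d)) ` Du \<union> (\<lambda>d. v (i + d)) ` X"
proof (intro equalityI subsetI)
  fix z assume "z \<in> {z. (u i, z) \<in> parcs G}"
  then have z: "(u i, z) \<in> parcs G" "z \<in> pverts G"
    by (auto dest: in_arcsD2)
  show "z \<in> (\<lambda>d. u (i + d)) ` Du \<union> (\<lambda>d. v (i + d)) ` X"
    using z(2)
  proof (rule vertexE[of z i])
    fix d assume d: "d \<in> {0..<int n}" "z = u (i + d)"
    then have "d \<in> Du"
      using z(1) shift_uu[of i "i + d"] by (simp add: Du_def)
    then show ?thesis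
      using d by blast
  next
    fix d assume d: "d \<in> {0..<int n}" "z = v (i + d)"
    then have "d \<in> X"
      using z(1) shift_uv[of i "i + d"] by (simp add: X_def)
    then show ?thesis
      using d by blast
  qed
next
  fix z assume "z \<in> (\<lambda>d. u (i + d)) ` Du \<union> (\<lambda>d. v (i + d)) ` X"
  then show "z \<in> {z. (u i, z) \<in> parcs G}"
    using shift_uu[of i] shift_uv[of i] by (auto simp: Du_def X_def)
qed

lemma neighbours_v: "{z. (v i, z) \<in> parcs G} = (\<lambda>d. v (i + d)) ` Dv \<union> (\<lambda>d. u (i - d)) ` X"
proof (intro equalityI subsetI)
  fix z assume "z \<in> {z. (v i, z) \<in> parcs G}"
  then have z: "(v i, z) \<in> parcs G" "z \<in> pverts G"
    by (auto dest: in_arcsD2)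
  show "z \<in> (\<lambda>d. v (i + d)) ` Dv \<union> (\<lambda>d. u (i - d)) ` X"
    using z(2)
  proof (rule vertexE[of z i])
    fix d assume d: "d \<in> {0..<int n}" "z = v (i + d)"
    then have "d \<in> Dv"
      using z(1) shift_vv[of i "i + d"] by (simp add: Dv_def)
    then show ?thesis
      using d by blast
  next
    fix d assume d: "d \<in> {0..<int n}" "z = u (i + d)"
    define e where "e = (- d) mod int n"
    have "(u 0, v (- d)) \<in> parcs G"
      using sym_parcs[OF z(1)] d(2) shift_uv[of "i + d" i] by simp
    then have "e \<in> X"
      using n_ge by (simp add: X_def e_def mod_eq)
    moreover have "int n dvd d + e"
      unfolding e_def by (simp add: dvd_eq_mod_eq_0 mod_simps)
    then have "z = u (i - e)"
      unfolding d(2) u_eq by simp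
    ultimately show ?thesis
      by blast
  qed
next
  fix z assume "z \<in> (\<lambda>d. v (i + d)) ` Dv \<union> (\<lambda>d. u (i - d)) ` X"
  then consider d where "d \<in> Dv" "z = v (i + d)" | d where "d \<in> X" "z = u (i - d)"
    by blast
  then show "z \<in> {z. (v i, z) \<in> parcs G}"
  proof cases
    case (2 d)
    then have "(u (i - d), v i) \<in> parcs G"
      using shift_uv[of "i - d" i] by (simp add: X_def)
    then show ?thesis
      using 2 sym_parcs by blast
  qed (use shift_vv[of i] in \<open>auto simp: Dv_def\<close>)
qed

lemma inj_range: "inj_on (\<lambda>d. u (i + d)) {0..<int n}" "inj_on (\<lambda>d. v (i + d)) {0..<int n}"
  "inj_on (\<lambda>d. u (i - d)) {0..<int n}"
  using zdvd_not_zless n_ge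
  by (auto simp: inj_on_def u_eq v_eq mod_eq_dvd_iff[symmetric] dvd_diff_commute)

lemma card_X: "card Du + card X = 3" "card Dv + card X = 3"
proof -
  have sub: "Du \<subseteq> {0..<int n}" "Dv \<subseteq> {0..<int n}" "X \<subseteq> {0..<int n}"
    by (auto simp: Du_def Dv_def X_def)
  note inj = inj_range[THEN inj_on_subset]
  have "card {z. (u 0, z) \<in> parcs G} = card ((\<lambda>d. u (0 + d)) ` Du) + card ((\<lambda>d. v (0 + d)) ` X)"
    unfolding neighbours_u by (rule card_Un_disjoint) auto
  then show "card Du + card X = 3"
    using degree[of "u 0"] card_image[OF inj(1)[OF sub(1)], of 0] card_image[OF inj(2)[OF sub(3)], of 0]
    by (simp add: verts)
  have "card {z. (v 0, z) \<in> parcs G} = card ((\<lambda>d. v (0 + d)) ` Dv) + card ((\<lambda>d. u (0 - d)) ` X)"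
    unfolding neighbours_v by (rule card_Un_disjoint) auto
  then show "card Dv + card X = 3"
    using degree[of "v 0"] card_image[OF inj(2)[OF sub(2)], of 0] card_image[OF inj(3)[OF sub(3)], of 0]
    by (simp add: verts)
qed

text \<open>Indices in the subgroup generated by \<open>x\<close> and \<open>y\<close>, shifted by
  \<open>p\<close> on the second orbit, form a closed set of vertices; by connectedness it is
  everything. The shift is there to let \<open>W 0 0\<close> be a neighbour of
  \<open>U 0 0\<close>.\<close>

lemma two_orbitsI:
  assumes closed: "\<And>\<alpha> \<beta> z. (u (\<alpha> * x + \<beta> * y), z) \<in> parcs G \<or> (v (p + (\<alpha> * x + \<beta> * y)), z) \<in> parcs G \<Longrightarrow>
    \<exists>\<gamma> \<delta>. z = u (\<gamma> * x + \<delta> * y) \<or> z = v (p + (\<gamma> * x + \<delta> * y))"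
  shows "two_orbits G side n x y (\<lambda>\<alpha> \<beta>. u (\<alpha> * x + \<beta> * y)) (\<lambda>\<alpha> \<beta>. v (p + (\<alpha> * x + \<beta> * y)))"
proof unfold_locales
  let ?K = "{u (\<alpha> * x + \<beta> * y) |\<alpha> \<beta>. True} \<union> {v (p + (\<alpha> * x + \<beta> * y)) |\<alpha> \<beta>. True}"
  have K: "?K = pverts G"
  proof (rule connected_closed_set[OF conn])
    show "?K \<noteq> {}" "?K \<subseteq> pverts G"
      unfolding verts by blast+
    show "z \<in> ?K" if "w \<in> ?K" "(w, z) \<in> parcs G \<or> (z, w) \<in> parcs G" for w z
    proof -
      have "(w, z) \<in> parcs G"
        using that(2) sym_parcs by blast
      then show ?thesis
        using that(1) closed[of _ _ z] by blast
    qed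
  qed
  then show "pverts G = ?K"
    by simp
  show "d dvd 1" if d: "d dvd int n" "d dvd x" "d dvd y" for d
  proof -
    \<comment> \<open>Reaching the index 1 shows that no common divisor other than a unit
      exists.\<close>
    have "u 1 \<in> ?K"
      unfolding K verts by blast
    then obtain \<alpha> \<beta> where "u 1 = u (\<alpha> * x + \<beta> * y)"
      using u_neq_v by blast
    then have "d dvd 1 - (\<alpha> * x + \<beta> * y)"
      using d(1) dvd_trans unfolding u_eq by blast
    then show ?thesis
      using dvd_diff_right_iff[of d 1 "\<alpha> * x + \<beta> * y"] d(2,3) dvd_add[of d "1 - (\<alpha> * x + \<beta> * y)" "\<alpha> * x + \<beta> * y"] by simp
  qed
qed (auto simp: u_eq v_eq lin_dvd_def algebra_simps card_verts n_ge)

lemma haar_if_card_3: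
  assumes "card X = 3"
  shows "\<exists>x y U W. haar_like G side n x y U W"
proof -
  have D: "Du = {}" "Dv = {}"
    using card_X assms by auto
  obtain p q r where X: "X = {p, q, r}"
    using assms unfolding card_3_iff by blast
  \<comment> \<open>Measured from \<open>p\<close>, the connection set consists of 0,
    \<open>x\<close> and \<open>y\<close>.\<close>
  let ?x = "q - p" and ?y = "r - p"
  let ?U = "\<lambda>\<alpha> \<beta>. u (\<alpha> * ?x + \<beta> * ?y)" and ?W = "\<lambda>\<alpha> \<beta>. v (p + (\<alpha> * ?x + \<beta> * ?y))"
  have U: "{z. (?U \<alpha> \<beta>, z) \<in> parcs G} = {?W \<alpha> \<beta>, ?W (\<alpha> + 1) \<beta>, ?W \<alpha> (\<beta> + 1)}" for \<alpha> \<beta>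
    unfolding neighbours_u D X by (simp add: algebra_simps)
  have W: "{z. (?W \<alpha> \<beta>, z) \<in> parcs G} = {?U \<alpha> \<beta>, ?U (\<alpha> - 1) \<beta>, ?U \<alpha> (\<beta> - 1)}" for \<alpha> \<beta>
    unfolding neighbours_v D X by (simp add: algebra_simps)
  have "two_orbits G side n ?x ?y ?U ?W"
  proof (rule two_orbitsI)
    fix \<alpha> \<beta> z assume "(?U \<alpha> \<beta>, z) \<in> parcs G \<or> (?W \<alpha> \<beta>, z) \<in> parcs G"
    then have "z \<in> {z. (?U \<alpha> \<beta>, z) \<in> parcs G} \<union> {z. (?W \<alpha> \<beta>, z) \<in> parcs G}"
      by blast
    then show "\<exists>\<gamma> \<delta>. z = ?U \<gamma> \<delta> \<or> z = ?W \<gamma> \<delta>"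
      unfolding U W by blast
  qed
  then have "haar_like G side n ?x ?y ?U ?W"
    by (intro haar_like.intro haar_like_axioms.intro U W)
  then show ?thesis
    by blast
qed

lemma Du_uminus: "d \<in> Du \<Longrightarrow> (- d) mod int n \<in> Du"
  using sym_parcs[of "u 0" "u d"] shift_uu[of d 0] n_ge by (simp add: Du_def mod_eq)

lemma Dv_uminus: "d \<in> Dv \<Longrightarrow> (- d) mod int n \<in> Dv"
  using sym_parcs[of "v 0" "v d"] shift_vv[of d 0] n_ge by (simp add: Dv_def mod_eq)

lemma D_bounds: "d \<in> Du \<union> Dv \<Longrightarrow> 0 < d \<and> d < int n"
proof -
  have "(u 0, u 0) \<notin> parcs G" "(v 0, v 0) \<notin> parcs G"
    using side by blast+
  then show "d \<in> Du \<union> Dv \<Longrightarrow> 0 < d \<and> d < int n"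
    by (cases "d = 0") (auto simp: Du_def Dv_def)
qed

lemma uminus_mod: "0 < d \<Longrightarrow> d < int n \<Longrightarrow> (- d) mod int n = int n - d"
  by (simp add: zmod_zminus1_eq_if)

text \<open>A single difference inside an orbit is its own negative, so both orbits have the
  difference \<open>n / 2\<close>. Together with a cross edge and its translate by
  \<open>n / 2\<close> this makes a 4-cycle.\<close>

lemma card_X_neq_2: "card X \<noteq> 2"
proof
  assume "card X = 2"
  then have "card Du = 1" "card Dv = 1"
    using card_X by auto
  then obtain h k where h: "Du = {h}" and k: "Dv = {k}"
    by (metis card_1_singletonE)
  have "2 * h = int n" "2 * k = int n"
    using Du_uminus[of h] D_bounds[of h] uminus_mod[of h]
      Dv_uminus[of k] D_bounds[of k] uminus_mod[of k] h k by auto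
  then have "k = h"
    by simp
  obtain p where p: "p \<in> X"
    using \<open>card X = 2\<close> by (metis card.empty ex_in_conv zero_neq_numeral)
  have "(u 0, u h) \<in> parcs G" "(v 0, v h) \<in> parcs G" "(u 0, v p) \<in> parcs G"
    using h k p \<open>k = h\<close> by (auto simp: Du_def Dv_def X_def)
  moreover from this have "(v p, v (p + h)) \<in> parcs G" "(u h, v (p + h)) \<in> parcs G"
    using shift_vv[of p "p + h"] shift_uv[of h "p + h"] by simp_all
  ultimately have "u 0 = v (p + h) \<or> u h = v p"
    using no_square[of "u 0" "u h" "v p" "v (p + h)"] sym_parcs by blast
  then show False
    by simp
qed

lemma igraph_if_card_1:
  assumes "card X = 1"
  shows "\<exists>x y U W. igraph_like G side n x y U W"
proof -
  obtain p where X: "X = {p}"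
    using assms by (rule card_1_singletonE)
  have pair: "\<exists>j. D = {j, int n - j}"
    if "card D = 2" "\<And>d. d \<in> D \<Longrightarrow> (- d) mod int n \<in> D" "\<And>d. d \<in> D \<Longrightarrow> 0 < d \<and> d < int n" for D
  proof -
    obtain j l where jl: "D = {j, l}" "j \<noteq> l"
      using \<open>card D = 2\<close> unfolding card_2_iff by blast
    then have "int n - j \<in> D" "int n - l \<in> D"
      using that(2,3) uminus_mod by (metis insertCI)+
    \<comment> \<open>Only one nonzero residue can be its own negative, so negation exchanges the
      two elements.\<close>
    then have "l = int n - j"
      using jl by auto
    then show ?thesis
      using jl by blast
  qed
  obtain j where j: "Du = {j, int n - j}"
    using pair[of Du] Du_uminus D_bounds card_X(1) assms by auto
  obtain k where k: "Dv = {k, int n - k}"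
    using pair[of Dv] Dv_uminus D_bounds card_X(2) assms by auto
  have n0: "u (int n + i) = u i" "v (int n + i) = v i" "u (i + int n) = u i" "v (i + int n) = v i" for i
    by (simp_all add: u_eq v_eq)
  let ?U = "\<lambda>\<alpha> \<beta>. u (\<alpha> * j + \<beta> * k)" and ?W = "\<lambda>\<alpha> \<beta>. v (p + (\<alpha> * j + \<beta> * k))"
  have U: "{z. (?U \<alpha> \<beta>, z) \<in> parcs G} = {?U (\<alpha> + 1) \<beta>, ?U (\<alpha> - 1) \<beta>, ?W \<alpha> \<beta>}" for \<alpha> \<beta>
  proof -
    have "u (\<alpha> * j + \<beta> * k + (int n - j)) = ?U (\<alpha> - 1) \<beta>"
      unfolding u_eq by (simp add: algebra_simps)
    then show ?thesis
      unfolding neighbours_u j X by (auto simp: algebra_simps)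
  qed
  have W: "{z. (?W \<alpha> \<beta>, z) \<in> parcs G} = {?W \<alpha> (\<beta> + 1), ?W \<alpha> (\<beta> - 1), ?U \<alpha> \<beta>}" for \<alpha> \<beta>
  proof -
    have "v (p + (\<alpha> * j + \<beta> * k) + (int n - k)) = ?W \<alpha> (\<beta> - 1)"
      unfolding v_eq by (simp add: algebra_simps)
    then show ?thesis
      unfolding neighbours_v k X by (auto simp: algebra_simps)
  qed
  have "two_orbits G side n j k ?U ?W"
  proof (rule two_orbitsI)
    fix \<alpha> \<beta> z assume "(?U \<alpha> \<beta>, z) \<in> parcs G \<or> (?W \<alpha> \<beta>, z) \<in> parcs G"
    then have "z \<in> {z. (?U \<alpha> \<beta>, z) \<in> parcs G} \<union> {z. (?W \<alpha> \<beta>, z) \<in> parcs G}"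
      by blast
    then show "\<exists>\<gamma> \<delta>. z = ?U \<gamma> \<delta> \<or> z = ?W \<gamma> \<delta>"
      unfolding U W by blast
  qed
  then have "igraph_like G side n j k ?U ?W"
    by (intro igraph_like.intro igraph_like_axioms.intro U W)
  then show ?thesis
    by blast
qed

lemma card_X_neq_0: "card X \<noteq> 0"
proof
  assume "card X = 0"
  then have X: "X = {}"
    by simp
  have "range u = pverts G"
  proof (rule connected_closed_set[OF conn])
    show "z \<in> range u" if w: "w \<in> range u" and z: "(w, z) \<in> parcs G \<or> (z, w) \<in> parcs G" for w z
    proof -
      obtain i where "w = u i"
        using w by blast
      then have "z \<in> {z. (u i, z) \<in> parcs G}"
        using z sym_parcs by blast
      then show ?thesis
        unfolding neighbours_u X by blast
    qed
  qed (auto simp: verts)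
  moreover have "v 0 \<in> pverts G"
    by (simp add: verts)
  ultimately have "v 0 \<in> range u"
    by simp
  then show False
    by auto
qed

theorem haar_or_igraph:
  "(\<exists>x y U W. haar_like G side n x y U W) \<or> (\<exists>x y U W. igraph_like G side n x y U W)"
proof -
  have "card X = 1 \<or> card X = 3"
    using card_X(1) card_X_neq_0 card_X_neq_2 by arith
  then show ?thesis
    using haar_if_card_3 igraph_if_card_1 by blast
qed

end

section \<open>Parametrising the two cyclic orbits\<close>

definition rotation :: "nat \<Rightarrow> ('a \<Rightarrow> 'a) \<Rightarrow> 'a \<Rightarrow> int \<Rightarrow> 'a" where
  "rotation n f a i = (f ^^ nat (i mod int n)) a"

lemma cyclic_on_rotation:
  assumes "cyclic_on f A" "card A = n"
  obtains a where "range (rotation n f a) = A"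
    "\<And>i j. rotation n f a i = rotation n f a j \<longleftrightarrow> int n dvd i - j"
    "\<And>i. f (rotation n f a i) = rotation n f a (i + 1)"
proof -
  obtain a where a: "a \<in> A" "A = orbit f a"
    using assms(1) by (auto simp: cyclic_on_def)
  then have self: "a \<in> orbit f a"
    by simp
  define N where "N = funpow_dist1 f a a"
  have N: "A = (\<lambda>m. (f ^^ m) a) ` {0..<N}" "inj_on (\<lambda>m. (f ^^ m) a) {0..<N}" "(f ^^ N) a = a" "0 < N"
    using orbit_conv_funpow_dist1[OF self] inj_on_funpow_dist1[OF self] funpow_dist1_prop[OF self] a(2)
    by (auto simp: N_def)
  have "N = n"
    using card_image[OF N(2)] N(1) assms(2) by simp
  have nat_mod: "(f ^^ nat (int m mod int n)) a = (f ^^ m) a" for m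
    using funpow_mod_eq[OF N(3)] \<open>N = n\<close> by (simp add: zmod_int[symmetric])
  have nn: "nat (i mod int n) \<in> {0..<N}" for i
    using N(4) \<open>N = n\<close> by (simp add: nat_less_iff)
  show ?thesis
  proof (rule that)
    show eq: "rotation n f a i = rotation n f a j \<longleftrightarrow> int n dvd i - j" for i j
    proof -
      have "rotation n f a i = rotation n f a j \<longleftrightarrow> nat (i mod int n) = nat (j mod int n)"
        unfolding rotation_def using inj_on_eq_iff[OF N(2) nn nn] by blast
      also have "\<dots> \<longleftrightarrow> i mod int n = j mod int n"
        using N(4) \<open>N = n\<close> by (simp add: nat_eq_iff)
      finally show ?thesis
        by (simp add: mod_eq_dvd_iff)
    qed
    show "f (rotation n f a i) = rotation n f a (i + 1)" for i
    proof -
      have "f (rotation n f a i) = (f ^^ Suc (nat (i mod int n))) a"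
        by (simp add: rotation_def)
      also have "\<dots> = rotation n f a (int (Suc (nat (i mod int n))))"
        unfolding rotation_def nat_mod ..
      also have "\<dots> = rotation n f a (i + 1)"
        unfolding eq using N(4) \<open>N = n\<close> by (simp add: mod_eq_dvd_iff[symmetric] mod_simps)
      finally show ?thesis .
    qed
    have "(f ^^ m) a = rotation n f a (int m)" for m
      unfolding rotation_def nat_mod ..
    then show "range (rotation n f a) = A"
      unfolding N(1) using nn by (auto simp: rotation_def)
  qed
qed

lemma shift_invariant:
  fixes P :: "int \<Rightarrow> int \<Rightarrow> bool"
  assumes "\<And>i j. P (i + 1) (j + 1) \<longleftrightarrow> P i j"
  shows "P i j \<longleftrightarrow> P 0 (j - i)"
proof -
  have "P i (d + i) \<longleftrightarrow> P 0 d" for d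
  proof (induction i rule: int_induct[of _ 0])
    case (step1 i)
    then show ?case
      using assms[of i "d + i"] by (simp add: add.assoc)
  next
    case (step2 i)
    then show ?case
      using assms[of "i - 1" "d + (i - 1)"] by simp
  qed simp
  from this[of "j - i"] show ?thesis
    by simp
qed

lemma (in symmetric_cubic) rotary_if_bicirculant:
  assumes "bicirculant G" "card (pverts G) = 2 * n" "9 \<le> n"
  obtains u v where "rotary G side n u v"
proof -
  obtain f A B where f: "automorphism G f" and AB: "pverts G = A \<union> B" "A \<inter> B = {}" "card A = card B"
    and cyc: "cyclic_on f A" "cyclic_on f B"
    using assms(1) unfolding bicirculant_def by blast
  have "finite A" "finite B"
    using finite_cyclic_on cyc by blast+
  then have card: "card A = n" "card B = n"
    using AB assms(2) by (auto simp: card_Un_disjoint)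
  obtain a where a: "range (rotation n f a) = A"
    "\<And>i j. rotation n f a i = rotation n f a j \<longleftrightarrow> int n dvd i - j"
    "\<And>i. f (rotation n f a i) = rotation n f a (i + 1)"
    using cyclic_on_rotation[OF cyc(1) card(1)] by blast
  obtain b where b: "range (rotation n f b) = B"
    "\<And>i j. rotation n f b i = rotation n f b j \<longleftrightarrow> int n dvd i - j"
    "\<And>i. f (rotation n f b i) = rotation n f b (i + 1)"
    using cyclic_on_rotation[OF cyc(2) card(2)] by blast
  let ?u = "rotation n f a" and ?v = "rotation n f b"
  have V: "?u i \<in> pverts G" "?v i \<in> pverts G" for i
    using a(1) b(1) AB(1) by blast+
  have arc: "(f w, f z) \<in> parcs G \<longleftrightarrow> (w, z) \<in> parcs G" if "w \<in> pverts G" "z \<in> pverts G" for w z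
    using f that by (simp add: automorphism_def)
  have "rotary G side n ?u ?v"
  proof unfold_locales
    show "?u i \<noteq> ?v j" for i j
      using a(1) b(1) AB(2) by blast
    show "(?u i, ?u j) \<in> parcs G \<longleftrightarrow> (?u 0, ?u (j - i)) \<in> parcs G" for i j
      by (rule shift_invariant) (use arc V a(3) in metis)
    show "(?u i, ?v j) \<in> parcs G \<longleftrightarrow> (?u 0, ?v (j - i)) \<in> parcs G" for i j
      by (rule shift_invariant) (use arc V a(3) b(3) in metis)
    show "(?v i, ?v j) \<in> parcs G \<longleftrightarrow> (?v 0, ?v (j - i)) \<in> parcs G" for i j
      by (rule shift_invariant) (use arc V b(3) in metis)
  qed (use a b AB assms in auto)
  then show ?thesis
    using that by blast
qed

section \<open>The three exceptional configurations\<close>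

lemma pair_sym_digraph_undirected:
  assumes "E \<subseteq> V \<times> V"
  shows "pair_sym_digraph (undirected V E)"
  using assms by unfold_locales (auto simp: undirected_def symmetric_def sym_def)

lemma pair_sym_digraph_levi_graph:
  assumes "incidence C \<subseteq> points C \<times> blocks C"
  shows "pair_sym_digraph (levi_graph C)"
  unfolding levi_graph_def using assms by (intro pair_sym_digraph_undirected) auto

lemma pair_sym_digraph_haar_graph: "pair_sym_digraph (haar_graph m S)"
  unfolding haar_graph_def by (intro pair_sym_digraph_undirected) auto

lemma pair_sym_digraph_gen_petersen: "pair_sym_digraph (gen_petersen m k)"
  unfolding gen_petersen_def by (intro pair_sym_digraph_undirected) auto

fun flag_adjacent :: "('p \<Rightarrow> 'l \<Rightarrow> bool) \<Rightarrow> 'p + 'l \<Rightarrow> 'p + 'l \<Rightarrow> bool" where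
  "flag_adjacent inc (Inl p) (Inr l) = inc p l"
| "flag_adjacent inc (Inr l) (Inl p) = inc p l"
| "flag_adjacent inc _ _ = False"

fun haar_adjacent :: "nat \<Rightarrow> nat list \<Rightarrow> nat + nat \<Rightarrow> nat + nat \<Rightarrow> bool" where
  "haar_adjacent m S (Inl i) (Inr j) = (\<exists>k \<in> set S. j = (i + k) mod m)"
| "haar_adjacent m S (Inr j) (Inl i) = (\<exists>k \<in> set S. j = (i + k) mod m)"
| "haar_adjacent m S _ _ = False"

fun petersen_adjacent :: "nat \<Rightarrow> nat \<Rightarrow> nat + nat \<Rightarrow> nat + nat \<Rightarrow> bool" where
  "petersen_adjacent m k (Inl i) (Inr j) = (i = j)"
| "petersen_adjacent m k (Inr i) (Inl j) = (i = j)"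
| "petersen_adjacent m k (Inl i) (Inl j) = (j = (i + k) mod m \<or> i = (j + k) mod m)"
| "petersen_adjacent m k (Inr i) (Inr j) = (j = (i + 1) mod m \<or> i = (j + 1) mod m)"

abbreviation adjacency_lists :: "('a \<Rightarrow> 'a \<Rightarrow> bool) \<Rightarrow> 'a list \<Rightarrow> nat list list" where
  "adjacency_lists R vs \<equiv> map (\<lambda>x. filter (\<lambda>j. R x (vs ! j)) [0..<length vs]) vs"

lemma presents_levi_graph:
  assumes "incidence C \<subseteq> points C \<times> blocks C" "distinct vs" "set vs = points C <+> blocks C"
    and "\<And>p l. p \<in> points C \<Longrightarrow> l \<in> blocks C \<Longrightarrow> inc p l \<longleftrightarrow> (p, l) \<in> incidence C"
    and "adjacency_lists (flag_adjacent inc) vs = al"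
  shows "presents (levi_graph C) ((!) vs) al"
  unfolding levi_graph_def
proof (rule presents_undirected[OF assms(2,3) _ _ assms(5)])
  fix x y assume "x \<in> points C <+> blocks C" "y \<in> points C <+> blocks C"
  then show "flag_adjacent inc x y \<longleftrightarrow> (x, y) \<in> {(Inl p, Inr l) |p l. (p, l) \<in> incidence C} \<or>
      (y, x) \<in> {(Inl p, Inr l) |p l. (p, l) \<in> incidence C}"
    by (cases x; cases y) (auto simp: assms(4))
qed (use assms(1) in auto)

lemma presents_haar_graph:
  assumes "distinct vs" "set vs = {..<m} <+> {..<m}" "adjacency_lists (haar_adjacent m S) vs = al"
  shows "presents (haar_graph m (set S)) ((!) vs) al"
  unfolding haar_graph_def
proof (rule presents_undirected[OF assms(1,2) _ _ assms(3)])
  fix x y :: "nat + nat" assume "x \<in> {..<m} <+> {..<m}" "y \<in> {..<m} <+> {..<m}"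
  then show "haar_adjacent m S x y \<longleftrightarrow>
      (x, y) \<in> {(Inl i, Inr ((i + k) mod m)) |i k. i < m \<and> k \<in> set S} \<or>
      (y, x) \<in> {(Inl i, Inr ((i + k) mod m)) |i k. i < m \<and> k \<in> set S}"
    by (cases x; cases y) auto
qed auto

lemma presents_gen_petersen:
  assumes "distinct vs" "set vs = {..<m} <+> {..<m}" "adjacency_lists (petersen_adjacent m k) vs = al"
  shows "presents (gen_petersen m k) ((!) vs) al"
  unfolding gen_petersen_def
proof (rule presents_undirected[OF assms(1,2) _ _ assms(3)])
  let ?E = "{(Inr i, Inr ((i + 1) mod m)) |i. i < m} \<union> {(Inl i, Inr i) |i. i < m} \<union>
      {(Inl i, Inl ((i + k) mod m)) |i. i < m}"
  fix x y :: "nat + nat" assume "x \<in> {..<m} <+> {..<m}" "y \<in> {..<m} <+> {..<m}"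
  then show "petersen_adjacent m k x y \<longleftrightarrow> (x, y) \<in> ?E \<or> (y, x) \<in> ?E"
    by (cases x; cases y) auto
qed auto

definition is_configuration3 :: "nat \<Rightarrow> 'p list \<Rightarrow> 'l list \<Rightarrow> ('p \<Rightarrow> 'l \<Rightarrow> bool) \<Rightarrow> bool" where
  "is_configuration3 n ps bs inc \<longleftrightarrow> distinct ps \<and> length ps = n \<and> distinct bs \<and> length bs = n \<and>
     (\<forall>l \<in> set bs. length (filter (\<lambda>p. inc p l) ps) = 3) \<and>
     (\<forall>p \<in> set ps. length (filter (inc p) bs) = 3) \<and>
     (\<forall>p \<in> set ps. \<forall>q \<in> set ps. p \<noteq> q \<longrightarrow> length (filter (\<lambda>l. inc p l \<and> inc q l) bs) \<le> 1)"

lemma configuration3_if_is_configuration3: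
  assumes "is_configuration3 n ps bs inc" "points C = set ps" "blocks C = set bs"
    and "incidence C \<subseteq> points C \<times> blocks C"
    and "\<And>p l. p \<in> points C \<Longrightarrow> l \<in> blocks C \<Longrightarrow> inc p l \<longleftrightarrow> (p, l) \<in> incidence C"
  shows "configuration3 n C"
proof -
  have d: "distinct ps" "distinct bs"
    using assms(1) by (auto simp: is_configuration3_def)
  have "{p \<in> points C. (p, l) \<in> incidence C} = set (filter (\<lambda>p. inc p l) ps)" if "l \<in> blocks C" for l
    using assms(2,5) that by auto
  moreover have "{l \<in> blocks C. (p, l) \<in> incidence C} = set (filter (inc p) bs)" if "p \<in> points C" for p
    using assms(3,5) that by auto
  moreover have "{l \<in> blocks C. (p, l) \<in> incidence C \<and> (q, l) \<in> incidence C} =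
      set (filter (\<lambda>l. inc p l \<and> inc q l) bs)" if "p \<in> points C" "q \<in> points C" for p q
    using assms(3,5) that by auto
  ultimately show ?thesis
    unfolding configuration3_def using assms(1-4) d
    by (auto simp: is_configuration3_def distinct_card simp del: set_filter)
qed

definition haar7_lists :: "nat list list" where
  "haar7_lists =
   [[7, 8, 10], [8, 9, 11], [9, 10, 12], [10, 11, 13], [7, 11, 12], [8, 12, 13], [7, 9, 13],
    [0, 4, 6], [0, 1, 5], [1, 2, 6], [0, 2, 3], [1, 3, 4], [2, 4, 5], [3, 5, 6]]"

definition haar8_lists :: "nat list list" where
  "haar8_lists =
   [[8, 9, 11], [9, 10, 12], [10, 11, 13], [11, 12, 14], [12, 13, 15], [8, 13, 14],
    [9, 14, 15], [8, 10, 15], [0, 5, 7], [0, 1, 6], [1, 2, 7], [0, 2, 3], [1, 3, 4],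
    [2, 4, 5], [3, 5, 6], [4, 6, 7]]"

definition petersen8_lists :: "nat list list" where
  "petersen8_lists =
   [[3, 5, 8], [4, 6, 9], [5, 7, 10], [0, 6, 11], [1, 7, 12], [0, 2, 13], [1, 3, 14],
    [2, 4, 15], [0, 9, 15], [1, 8, 10], [2, 9, 11], [3, 10, 12], [4, 11, 13], [5, 12, 14],
    [6, 13, 15], [7, 8, 14]]"

definition petersen10_lists :: "nat list list" where
  "petersen10_lists =
   [[3, 7, 10], [4, 8, 11], [5, 9, 12], [0, 6, 13], [1, 7, 14], [2, 8, 15], [3, 9, 16],
    [0, 4, 17], [1, 5, 18], [2, 6, 19], [0, 11, 19], [1, 10, 12], [2, 11, 13], [3, 12, 14],
    [4, 13, 15], [5, 14, 16], [6, 15, 17], [7, 16, 18], [8, 17, 19], [9, 10, 18]]"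

lemma splitfree_haar7: "splitfree haar7_lists"
  by code_simp

lemma splitfree_haar8: "splitfree haar8_lists"
  by code_simp

lemma splitfree_petersen10: "splitfree petersen10_lists"
  by code_simp

definition std_vertices :: "nat \<Rightarrow> (nat + nat) list" where
  "std_vertices m = map Inl [0..<m] @ map Inr [0..<m]"

lemma distinct_std_vertices: "distinct (std_vertices m)"
  by (auto simp: std_vertices_def distinct_map)

lemma set_std_vertices: "set (std_vertices m) = {..<m} <+> {..<m}"
  by (auto simp: std_vertices_def lessThan_atLeast0)

lemma presents_haar7: "presents (haar_graph 7 {0, 1, 3}) ((!) (std_vertices 7)) haar7_lists"
proof -
  have "adjacency_lists (haar_adjacent 7 [0, 1, 3]) (std_vertices 7) = haar7_lists"
    by code_simp
  from presents_haar_graph[OF distinct_std_vertices set_std_vertices this] show ?thesis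
    by simp
qed

lemma presents_haar8: "presents (haar_graph 8 {0, 1, 3}) ((!) (std_vertices 8)) haar8_lists"
proof -
  have "adjacency_lists (haar_adjacent 8 [0, 1, 3]) (std_vertices 8) = haar8_lists"
    by code_simp
  from presents_haar_graph[OF distinct_std_vertices set_std_vertices this] show ?thesis
    by simp
qed

lemma presents_petersen8: "presents (gen_petersen 8 3) ((!) (std_vertices 8)) petersen8_lists"
  by (rule presents_gen_petersen[OF distinct_std_vertices set_std_vertices]) code_simp

lemma presents_petersen10: "presents (gen_petersen 10 3) ((!) (std_vertices 10)) petersen10_lists"
  by (rule presents_gen_petersen[OF distinct_std_vertices set_std_vertices]) code_simp

text \<open>On each rim sides alternate, and position \<open>i\<close> carries the index
  \<open>i\<close> if even and \<open>i - 2\<close> modulo 8 if odd. The spokes are then the edges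
  with step 0, and both rims use steps 1 and 3.\<close>

definition haar8_vertices :: "(nat + nat) list" where
  "haar8_vertices =
   [Inl 0, Inr 7, Inl 2, Inr 1, Inl 4, Inr 3, Inl 6, Inr 5, Inr 0, Inl 7, Inr 2, Inl 1, Inr 4,
    Inl 3, Inr 6, Inl 5]"

lemma presents_haar8_petersen: "presents (haar_graph 8 {0, 1, 3}) ((!) haar8_vertices) petersen8_lists"
proof -
  have "distinct haar8_vertices" "set haar8_vertices = set (std_vertices 8)"
    "adjacency_lists (haar_adjacent 8 [0, 1, 3]) haar8_vertices = petersen8_lists"
    by code_simp+
  from presents_haar_graph[OF this(1) this(2)[unfolded set_std_vertices] this(3)] show ?thesis
    by simp
qed

definition fano_points :: "(nat \<times> nat \<times> nat) list" where
  "fano_points =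
   [(0, 0, 1), (0, 1, 0), (0, 1, 1), (1, 0, 0), (1, 0, 1), (1, 1, 0), (1, 1, 1)]"

text \<open>The points follow a Singer cycle: the linear map sending (0, 0, 1) to (1, 0, 0), this to
  (0, 1, 0) and this to (0, 1, 1) has order seven. Its action makes the incidence graph
  cyclic.\<close>

definition fano_vertices :: "(nat \<times> nat \<times> nat + nat \<times> nat \<times> nat) list" where
  "fano_vertices =
   [Inl (0, 0, 1), Inl (1, 0, 0), Inl (0, 1, 0), Inl (0, 1, 1), Inl (1, 1, 1), Inl (1, 0, 1),
    Inl (1, 1, 0), Inr (1, 1, 0), Inr (0, 1, 0), Inr (0, 0, 1), Inr (1, 0, 0), Inr (0, 1, 1),
    Inr (1, 0, 1), Inr (1, 1, 1)]"

fun fano_incident :: "nat \<times> nat \<times> nat \<Rightarrow> nat \<times> nat \<times> nat \<Rightarrow> bool" where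
  "fano_incident (x, y, z) (a, b, c) \<longleftrightarrow> even (a * x + b * y + c * z)"

lemma fano_simps: "points fano = set fano_points" "blocks fano = set fano_points"
  "incidence fano = {(p, l). p \<in> points fano \<and> l \<in> blocks fano \<and> fano_incident p l}"
  by (auto simp: fano_def Let_def fano_points_def)

lemma configuration3_fano: "configuration3 7 fano"
  by (rule configuration3_if_is_configuration3[of 7 fano_points fano_points fano_incident])
    (code_simp, auto simp: fano_simps)

lemma presents_fano: "presents (levi_graph fano) ((!) fano_vertices) haar7_lists"
proof (rule presents_levi_graph[where inc = fano_incident])
  show "set fano_vertices = points fano <+> blocks fano"
    unfolding fano_simps by code_simp
  show "distinct fano_vertices"
    by code_simp
  show "adjacency_lists (flag_adjacent fano_incident) fano_vertices = haar7_lists"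
    by code_simp
qed (auto simp: fano_simps)

definition moebius_kantor_points :: "(nat \<times> nat) list" where
  "moebius_kantor_points =
   [(0, 1), (0, 2), (1, 0), (1, 1), (1, 2), (2, 0), (2, 1), (2, 2)]"

text \<open>As in the Fano plane the points form the orbit of a linear map, here of order eight over
  the field with three elements, sending (0, 1) to (2, 2) and (1, 0) to (2, 1).\<close>

definition moebius_kantor_vertices :: "(nat \<times> nat + nat \<times> nat) list" where
  "moebius_kantor_vertices =
   [Inl (0, 1), Inl (2, 2), Inl (2, 0), Inl (1, 2), Inl (0, 2), Inl (1, 1), Inl (1, 0),
    Inl (2, 1), Inr (0, 1), Inr (1, 1), Inr (2, 0), Inr (2, 1), Inr (0, 2), Inr (2, 2),
    Inr (1, 0), Inr (1, 2)]"

fun moebius_kantor_incident :: "nat \<times> nat \<Rightarrow> nat \<times> nat \<Rightarrow> bool" where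
  "moebius_kantor_incident (x, y) (a, b) \<longleftrightarrow> (a * x + b * y) mod 3 = 1"

lemma moebius_kantor_simps: "points moebius_kantor = set moebius_kantor_points"
  "blocks moebius_kantor = set moebius_kantor_points"
  "incidence moebius_kantor = {(p, l). p \<in> points moebius_kantor \<and> l \<in> blocks moebius_kantor \<and>
     moebius_kantor_incident p l}"
  by (auto simp: moebius_kantor_def Let_def moebius_kantor_points_def)

lemma configuration3_moebius_kantor: "configuration3 8 moebius_kantor"
  by (rule configuration3_if_is_configuration3[of 8 moebius_kantor_points moebius_kantor_points
        moebius_kantor_incident]) (code_simp, auto simp: moebius_kantor_simps)

lemma presents_moebius_kantor:
  "presents (levi_graph moebius_kantor) ((!) moebius_kantor_vertices) haar8_lists"
proof (rule presents_levi_graph[where inc = moebius_kantor_incident])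
  show "set moebius_kantor_vertices = points moebius_kantor <+> blocks moebius_kantor"
    unfolding moebius_kantor_simps by code_simp
  show "distinct moebius_kantor_vertices"
    by code_simp
  show "adjacency_lists (flag_adjacent moebius_kantor_incident) moebius_kantor_vertices = haar8_lists"
    by code_simp
qed (auto simp: moebius_kantor_simps)

definition desargues_points :: "nat set list" where
  "desargues_points =
   [{0, 1}, {0, 2}, {0, 3}, {0, 4}, {1, 2}, {1, 3}, {1, 4}, {2, 3}, {2, 4}, {3, 4}]"

definition desargues_lines :: "nat set list" where
  "desargues_lines =
   [{0, 1, 2}, {0, 1, 3}, {0, 1, 4}, {0, 2, 3}, {0, 2, 4}, {0, 3, 4}, {1, 2, 3}, {1, 2, 4},
    {1, 3, 4}, {2, 3, 4}]"

text \<open>Rotation by two positions on both rims is the 5-cycle sending 0 to 2, 2 to 1, 1 to 3, 3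
  to 4 and 4 to 0; opposite positions of a rim carry complementary sets.\<close>

definition desargues_vertices :: "(nat set + nat set) list" where
  "desargues_vertices =
   [Inl {0, 1}, Inr {1, 2, 4}, Inl {2, 3}, Inr {0, 1, 3}, Inl {1, 4}, Inr {2, 3, 4},
    Inl {0, 3}, Inr {0, 1, 4}, Inl {2, 4}, Inr {0, 2, 3}, Inr {0, 1, 2}, Inl {1, 2},
    Inr {1, 2, 3}, Inl {1, 3}, Inr {1, 3, 4}, Inl {3, 4}, Inr {0, 3, 4}, Inl {0, 4},
    Inr {0, 2, 4}, Inl {0, 2}]"

lemma desargues_simps: "points desargues = set desargues_points"
  "blocks desargues = set desargues_lines"
  "incidence desargues = {(p, l). p \<in> points desargues \<and> l \<in> blocks desargues \<and> p \<subseteq> l}"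
proof -
  \<comment> \<open>Writing the subsets as an explicit list makes both sides computable.\<close>
  have *: "{p. p \<subseteq> {..<5} \<and> card p = k} =
      set (filter (\<lambda>p. card p = k) (map set (subseqs [0..<5 :: nat])))" for k
    by (auto simp: subseqs_powset lessThan_atLeast0)
  show "points desargues = set desargues_points"
    unfolding desargues_def Let_def incidence_structure.simps * by code_simp
  show "blocks desargues = set desargues_lines"
    unfolding desargues_def Let_def incidence_structure.simps * by code_simp
  show "incidence desargues = {(p, l). p \<in> points desargues \<and> l \<in> blocks desargues \<and> p \<subseteq> l}"
    by (simp add: desargues_def Let_def)
qed

lemma configuration3_desargues: "configuration3 10 desargues"
  by (rule configuration3_if_is_configuration3[of 10 desargues_points desargues_lines "(\<subseteq>)"])
    (code_simp, auto simp: desargues_simps)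

lemma presents_desargues: "presents (levi_graph desargues) ((!) desargues_vertices) petersen10_lists"
proof (rule presents_levi_graph[where inc = "(\<subseteq>)"])
  show "set desargues_vertices = points desargues <+> blocks desargues"
    unfolding desargues_simps by code_simp
  show "distinct desargues_vertices"
    by code_simp
  show "adjacency_lists (flag_adjacent (\<subseteq>)) desargues_vertices = petersen10_lists"
    by code_simp
qed (auto simp: desargues_simps)

lemma incidence_subset: "incidence fano \<subseteq> points fano \<times> blocks fano"
  "incidence moebius_kantor \<subseteq> points moebius_kantor \<times> blocks moebius_kantor"
  "incidence desargues \<subseteq> points desargues \<times> blocks desargues"
  unfolding fano_simps(3) moebius_kantor_simps(3) desargues_simps(3) by auto

lemmas wf_graphs = incidence_subset[THEN pair_sym_digraph_levi_graph]
  pair_sym_digraph_haar_graph pair_sym_digraph_gen_petersen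

theorem exceptional_isomorphisms:
  "graph_iso (levi_graph fano) (haar_graph 7 {0, 1, 3})"
  "graph_iso (levi_graph moebius_kantor) (haar_graph 8 {0, 1, 3})"
  "graph_iso (haar_graph 8 {0, 1, 3}) (gen_petersen 8 3)"
  "graph_iso (levi_graph desargues) (gen_petersen 10 3)"
  using graph_iso_if_presents[OF presents_fano _ presents_haar7]
    graph_iso_if_presents[OF presents_moebius_kantor _ presents_haar8]
    graph_iso_if_presents[OF presents_haar8_petersen _ presents_petersen8]
    graph_iso_if_presents[OF presents_desargues _ presents_petersen10]
    wf_graphs[THEN pair_sym_digraph.axioms(1)] by blast+

theorem unsplittable_exceptional: "unsplittable fano" "unsplittable moebius_kantor" "unsplittable desargues"
  unfolding splittable_def
  using pair_sym_digraph.unsplittable_graph_if_splitfree[OF wf_graphs(1) presents_fano splitfree_haar7]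
    pair_sym_digraph.unsplittable_graph_if_splitfree[OF wf_graphs(2) presents_moebius_kantor splitfree_haar8]
    pair_sym_digraph.unsplittable_graph_if_splitfree[OF wf_graphs(3) presents_desargues splitfree_petersen10]
  by blast+

section \<open>Levi graphs of flag-transitive configurations\<close>

lemma levi_graph_arc_iff:
  "(Inl p, Inr l) \<in> parcs (levi_graph C) \<longleftrightarrow> (p, l) \<in> incidence C"
  "(Inr l, Inl p) \<in> parcs (levi_graph C) \<longleftrightarrow> (p, l) \<in> incidence C"
  "(Inl p, Inl q) \<notin> parcs (levi_graph C)" "(Inr l, Inr m) \<notin> parcs (levi_graph C)"
  by (auto simp: levi_graph_def undirected_def)

lemma pverts_levi_graph: "pverts (levi_graph C) = points C <+> blocks C"
  by (simp add: levi_graph_def undirected_def)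

lemma configuration3_unique_line:
  assumes "configuration3 n C" "(p, l) \<in> incidence C" "(q, l) \<in> incidence C"
    "(p, m) \<in> incidence C" "(q, m) \<in> incidence C"
  shows "p = q \<or> l = m"
proof (rule ccontr)
  assume neq: "\<not> (p = q \<or> l = m)"
  let ?L = "{l \<in> blocks C. (p, l) \<in> incidence C \<and> (q, l) \<in> incidence C}"
  have "finite ?L" "p \<in> points C" "q \<in> points C" and lm: "l \<in> ?L" "m \<in> ?L"
    using assms by (auto simp: configuration3_def)
  then have "card ?L \<le> Suc 0"
    using assms(1) neq by (simp add: configuration3_def)
  then have "\<forall>l \<in> ?L. \<forall>m \<in> ?L. l = m"
    using card_le_Suc0_iff_eq[OF \<open>finite ?L\<close>] by blast
  then show False
    using lm neq by blast
qed

lemma symmetric_cubic_levi_graph: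
  assumes C: "configuration3 n C" and flag: "flag_transitive C" and conn: "connected (with_proj (levi_graph C))"
  shows "symmetric_cubic (levi_graph C) isl"
proof -
  let ?G = "levi_graph C"
  have inc: "incidence C \<subseteq> points C \<times> blocks C" and fin: "finite (points C)" "finite (blocks C)"
    using C by (auto simp: configuration3_def)
  interpret pair_sym_digraph ?G
    by (rule pair_sym_digraph_levi_graph[OF inc])
  have V: "finite (pverts ?G)"
    using fin by (simp add: pverts_levi_graph)
  have E: "finite (parcs ?G)"
    by (rule finite_subset[of _ "pverts ?G \<times> pverts ?G"]) (use V in \<open>auto dest: in_arcsD1 in_arcsD2\<close>)
  show ?thesis
  proof (intro symmetric_cubic.intro symmetric_cubic_axioms.intro)
    show "pair_pseudo_graph ?G"
      by unfold_locales (rule V E)+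
    show "isl y \<longleftrightarrow> \<not> isl x" if "(x, y) \<in> parcs ?G" for x y
      using that by (cases x; cases y) (auto simp: levi_graph_arc_iff)
    show "card {y. (x, y) \<in> parcs ?G} = 3" if "x \<in> pverts ?G" for x
    proof -
      have "out_arcs (with_proj ?G) x = Pair x ` {y. (x, y) \<in> parcs ?G}"
        by (auto simp: out_arcs_def)
      moreover have "card (out_arcs (with_proj ?G) x) = 3"
        using flag that by (simp add: flag_transitive_def cubic_def out_degree_def)
      ultimately show ?thesis
        by (simp add: card_image inj_on_def)
    qed
    show "x = w \<or> y = z" if "(x, y) \<in> parcs ?G" "(x, z) \<in> parcs ?G" "(w, y) \<in> parcs ?G"
      "(w, z) \<in> parcs ?G" for x y z w
      using that configuration3_unique_line[OF C]
      by (cases x; cases y; cases z; cases w) (simp_all add: levi_graph_arc_iff, blast+)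
    show "arc_transitive ?G"
      using flag by (simp add: flag_transitive_def)
  qed (rule conn)
qed

section \<open>From Levi graphs back to configurations\<close>

lemma presents_cong:
  assumes "presents G \<phi> al" "map set al = map set bl"
  shows "presents G \<phi> bl"
proof -
  have "length al = length bl"
    using assms(2) map_eq_imp_length_eq by blast
  moreover have "set (al ! i) = set (bl ! i)" if "i < length al" for i
    using that assms(2) \<open>length al = length bl\<close> by (metis nth_map)
  ultimately show ?thesis
    using assms(1) by (simp add: presents_def)
qed

text \<open>The list \<open>\<pi>\<close> is an automorphism of the presented graph, so it changes
  the labelling of \<open>G\<close> but not the adjacency lists.\<close>

lemma presents_relabel:
  assumes G: "presents G \<phi> al" and \<pi>: "distinct \<pi>" "set \<pi> = {..<length al}"
    and al: "\<forall>i \<in> set [0..<length al]. set (al ! (\<pi> ! i)) = (!) \<pi> ` set (al ! i)"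
  shows "presents G (\<phi> \<circ> (!) \<pi>) al"
proof -
  have len: "length \<pi> = length al"
    using \<pi> by (metis card_lessThan distinct_card)
  have bij: "bij_betw ((!) \<pi>) {..<length al} {..<length al}"
    by (rule bij_betw_nth[OF \<pi>(1)]) (simp_all only: len \<pi>(2))
  have less: "\<pi> ! i < length al" if "i < length al" for i
    using bij_betwE[OF bij] that by blast
  show ?thesis
    unfolding presents_def
  proof (intro conjI allI impI)
    show "bij_betw (\<phi> \<circ> (!) \<pi>) {..<length al} (pverts G)"
      using G by (intro bij_betw_trans[OF bij]) (simp add: presents_def)
    fix i assume i: "i < length al"
    then show "set (al ! i) \<subseteq> {..<length al}"
      using G by (simp add: presents_def)
    have "set (al ! (\<pi> ! i)) = (!) \<pi> ` set (al ! i)"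
      using al i by simp
    then show "{y. ((\<phi> \<circ> (!) \<pi>) i, y) \<in> parcs G} = (\<phi> \<circ> (!) \<pi>) ` set (al ! i)"
      using presentsD(2)[OF G less[OF i]] by (simp add: image_comp)
  qed
qed

text \<open>The search from 0 shows that the presented graph is connected, so two proper
  two-colourings agree or are opposite. Here \<open>c\<close> is the known colouring and
  \<open>s\<close> is transported from \<open>G\<close>.\<close>

lemma presents_sides:
  assumes G: "presents G \<phi> al" and side: "\<And>x y. (x, y) \<in> parcs G \<Longrightarrow> s y \<longleftrightarrow> \<not> s x"
    and col: "\<forall>i \<in> set [0..<length al]. \<forall>j \<in> set (al ! i). c j \<longleftrightarrow> \<not> c i"
    and reach: "unreached al k [0] [0..<length al] = []" and i: "i < length al"
  shows "s (\<phi> i) \<longleftrightarrow> (s (\<phi> 0) \<longleftrightarrow> (c 0 \<longleftrightarrow> c i))"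
proof -
  let ?P = "\<lambda>i. i < length al \<and> (s (\<phi> i) \<longleftrightarrow> (s (\<phi> 0) \<longleftrightarrow> (c 0 \<longleftrightarrow> c i)))"
  have "?P i"
  proof (rule unreached_closed[of "[0]" ?P al "[0..<length al]" i k])
    show "?P j" if "j \<in> set [0]" for j
      using that i by (cases al) auto
    show "?P j" if "?P m" "j \<in> set (al ! m)" "j \<in> set [0..<length al]" for m j
    proof -
      have "(\<phi> m, \<phi> j) \<in> parcs G"
        using that presents_arc_iff[OF G, of m j] by auto
      then have "s (\<phi> j) \<longleftrightarrow> \<not> s (\<phi> m)"
        by (rule side)
      moreover have "c j \<longleftrightarrow> \<not> c m"
        using col that by auto
      ultimately show ?thesis
        using that by auto
    qed
  qed (use i reach in auto)
  then show ?thesis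
    by blast
qed

lemma configuration_iso_if_bij:
  assumes bij: "bij_betw h (points C <+> blocks C) (points D <+> blocks D)"
    and arcs: "\<And>x y. x \<in> points C <+> blocks C \<Longrightarrow> y \<in> points C <+> blocks C \<Longrightarrow>
      (h x, h y) \<in> parcs (levi_graph D) \<longleftrightarrow> (x, y) \<in> parcs (levi_graph C)"
    and side: "\<And>x. x \<in> points C <+> blocks C \<Longrightarrow> isl (h x) \<longleftrightarrow> isl x"
  shows "configuration_iso C D"
proof -
  define f where "f p = projl (h (Inl p))" for p
  define g where "g l = projr (h (Inr l))" for l
  have f: "h (Inl p) = Inl (f p)" if "p \<in> points C" for p
    using side[of "Inl p"] that by (cases "h (Inl p)") (auto simp: f_def)
  have g: "h (Inr l) = Inr (g l)" if "l \<in> blocks C" for l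
    using side[of "Inr l"] that by (cases "h (Inr l)") (auto simp: g_def)
  have inj: "inj_on h (points C <+> blocks C)" and img: "h ` (points C <+> blocks C) = points D <+> blocks D"
    using bij by (auto simp: bij_betw_def)
  have "bij_betw f (points C) (points D)"
    unfolding bij_betw_def
  proof (intro conjI equalityI subsetI inj_onI)
    fix p q assume "p \<in> points C" "q \<in> points C" "f p = f q"
    then have "h (Inl p) = h (Inl q)"
      by (simp add: f)
    then have "Inl p = (Inl q :: 'a + 'b)"
      using inj_onD[OF inj] \<open>p \<in> points C\<close> \<open>q \<in> points C\<close> by blast
    then show "p = q"
      by simp
  next
    fix p assume "p \<in> f ` points C"
    then obtain q where "q \<in> points C" "p = f q"
      by blast
    then have "Inl p \<in> points D <+> blocks D"
      unfolding img[symmetric] using f by (metis InlI imageI)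
    then show "p \<in> points D"
      by auto
  next
    fix p assume "p \<in> points D"
    then have "Inl p \<in> h ` (points C <+> blocks C)"
      unfolding img by blast
    then obtain x where x: "x \<in> points C <+> blocks C" "h x = Inl p"
      by (metis imageE)
    then have "isl x"
      using side[of x] by simp
    then obtain q where "x = Inl q" "q \<in> points C"
      using x(1) by (cases x) auto
    then show "p \<in> f ` points C"
      using f x(2) by force
  qed
  moreover have "bij_betw g (blocks C) (blocks D)"
    unfolding bij_betw_def
  proof (intro conjI equalityI subsetI inj_onI)
    fix p q assume "p \<in> blocks C" "q \<in> blocks C" "g p = g q"
    then have "h (Inr p) = h (Inr q)"
      by (simp add: g)
    then have "Inr p = (Inr q :: 'a + 'b)"
      using inj_onD[OF inj] \<open>p \<in> blocks C\<close> \<open>q \<in> blocks C\<close> by blast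
    then show "p = q"
      by simp
  next
    fix p assume "p \<in> g ` blocks C"
    then obtain q where "q \<in> blocks C" "p = g q"
      by blast
    then have "Inr p \<in> points D <+> blocks D"
      unfolding img[symmetric] using g by (metis InrI imageI)
    then show "p \<in> blocks D"
      by auto
  next
    fix p assume "p \<in> blocks D"
    then have "Inr p \<in> h ` (points C <+> blocks C)"
      unfolding img by blast
    then obtain x where x: "x \<in> points C <+> blocks C" "h x = Inr p"
      by (metis imageE)
    then have "\<not> isl x"
      using side[of x] by simp
    then obtain q where "x = Inr q" "q \<in> blocks C"
      using x(1) by (cases x) auto
    then show "p \<in> g ` blocks C"
      using g x(2) by force
  qed
  moreover have "(f p, g l) \<in> incidence D \<longleftrightarrow> (p, l) \<in> incidence C" if "p \<in> points C" "l \<in> blocks C" for p l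
    using arcs[OF InlI[OF that(1)] InrI[OF that(2)]] f[OF that(1)] g[OF that(2)]
    by (simp add: levi_graph_arc_iff)
  ultimately show ?thesis
    unfolding configuration_iso_def by blast
qed

text \<open>Both Levi graphs have the same adjacency lists, but vertex 0 may be a line in the first
  and is a point in the second. Relabelling by a colour-exchanging automorphism, in effect the
  self-duality of the Desargues configuration, makes the isomorphism preserve points and
  lines.\<close>

lemma desargues_if_presents:
  assumes "presents (levi_graph C) \<phi> (igraph_lists 10 3)"
  shows "configuration_iso C desargues"
proof -
  let ?al = petersen10_lists
  \<comment> \<open>Rotation of both rims by one position. It moves 0 to 1, which has the other
    colour under \<open>c\<close>.\<close>
  define \<pi> :: "nat list" where "\<pi> = [1, 2, 3, 4, 5, 6, 7, 8, 9, 0, 11, 12, 13, 14, 15, 16, 17, 18, 19, 10]"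
  define c :: "nat \<Rightarrow> bool" where "c i \<longleftrightarrow> (i < 10 \<longleftrightarrow> even i)" for i
  have "map set (igraph_lists 10 3) = map set ?al"
    by code_simp
  then have \<phi>: "presents (levi_graph C) \<phi> ?al"
    by (rule presents_cong[OF assms])
  have len: "length ?al = 20"
    by code_simp
  have side: "isl y \<longleftrightarrow> \<not> isl x" if "(x, y) \<in> parcs (levi_graph D)" for x y and D :: "('x, 'y) incidence_structure"
    using that by (cases x; cases y) (auto simp: levi_graph_arc_iff)
  have col: "\<forall>i \<in> set [0..<length ?al]. \<forall>j \<in> set (?al ! i). c j \<longleftrightarrow> \<not> c i"
    unfolding c_def by code_simp
  have reach: "unreached ?al 20 [0] [0..<length ?al] = []"
    by code_simp
  have \<pi>: "distinct \<pi>" "set \<pi> = {..<length ?al}"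
    "\<forall>i \<in> set [0..<length ?al]. set (?al ! (\<pi> ! i)) = (!) \<pi> ` set (?al ! i)"
    unfolding \<pi>_def lessThan_atLeast0 atLeast_upt by code_simp+
  have "isl (\<phi> 1) \<longleftrightarrow> \<not> isl (\<phi> 0)"
    using presents_sides[where s = isl and i = 1, OF \<phi> side col reach] by (simp add: len c_def)
  then have "\<exists>\<phi>. presents (levi_graph C) \<phi> ?al \<and> isl (\<phi> 0)"
    using \<phi> presents_relabel[OF \<phi> \<pi>] by (cases "isl (\<phi> 0)") (auto simp: \<pi>_def)
  then obtain \<phi> where \<phi>: "presents (levi_graph C) \<phi> ?al" "isl (\<phi> 0)"
    by blast
  have "isl (desargues_vertices ! 0)"
    by code_simp
  then have sides: "isl (desargues_vertices ! i) \<longleftrightarrow> isl (\<phi> i)" if "i < length ?al" for i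
    using presents_sides[where s = isl, OF \<phi>(1) side col reach that] \<phi>(2)
      presents_sides[where s = isl, OF presents_desargues side col reach that] by simp
  obtain h where h: "bij_betw h (pverts (levi_graph C)) (pverts (levi_graph desargues))"
    "\<And>i. i < length ?al \<Longrightarrow> h (\<phi> i) = desargues_vertices ! i"
    "\<And>x y. x \<in> pverts (levi_graph C) \<Longrightarrow> y \<in> pverts (levi_graph C) \<Longrightarrow>
      (h x, h y) \<in> parcs (levi_graph desargues) \<longleftrightarrow> (x, y) \<in> parcs (levi_graph C)"
    by (rule presents_bijE[OF \<phi>(1) presents_desargues]) blast
  show ?thesis
  proof (rule configuration_iso_if_bij[OF h(1)[unfolded pverts_levi_graph] h(3)[unfolded pverts_levi_graph]])
    fix x assume "x \<in> points C <+> blocks C"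
    then obtain i where "i < length ?al" "x = \<phi> i"
      using presents_vertexE[OF \<phi>(1)] unfolding pverts_levi_graph by metis
    then show "isl (h x) \<longleftrightarrow> isl x"
      using h(2) sides by simp
  qed
qed

theorem splittable_flag_transitive_bicirculant:
  assumes "9 \<le> n" "configuration3 n C" "flag_transitive C" "connected (with_proj (levi_graph C))"
    "bicirculant (levi_graph C)" "\<not> configuration_iso C desargues"
  shows "splittable C"
proof -
  interpret symmetric_cubic "levi_graph C" isl
    using symmetric_cubic_levi_graph assms by blast
  have "card (pverts (levi_graph C)) = 2 * n"
    using assms(2) by (simp add: pverts_levi_graph card_Plus configuration3_def)
  then obtain u v where "rotary (levi_graph C) isl n u v"
    using rotary_if_bicirculant[OF assms(5)] assms(1) by blast
  from rotary.haar_or_igraph[OF this] show ?thesis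
    unfolding splittable_def
  proof (elim disjE exE)
    fix x y U W assume "igraph_like (levi_graph C) isl n x y U W"
    from igraph_like.splittable_or_presents_igraph_lists[OF this]
    show "splittable_graph (levi_graph C)"
      using desargues_if_presents assms(6) by blast
  qed (rule haar_like.splittable)
qed

theorem theorem12:
  shows
    "(configuration3 7 fano \<and>
      graph_iso (levi_graph fano) (haar_graph 7 {0, 1, 3}) \<and>
      unsplittable fano) \<and>
     (configuration3 8 moebius_kantor \<and>
      graph_iso (levi_graph moebius_kantor) (haar_graph 8 {0, 1, 3}) \<and>
      graph_iso (haar_graph 8 {0, 1, 3}) (gen_petersen 8 3) \<and>
      unsplittable moebius_kantor) \<and>
     (configuration3 10 desargues \<and>
      graph_iso (levi_graph desargues) (gen_petersen 10 3) \<and>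
      unsplittable desargues) \<and>
     (\<forall>n (C :: ('p, 'l) incidence_structure).
        n \<ge> 9 \<and> configuration3 n C \<and> flag_transitive C \<and>
        connected (with_proj (levi_graph C)) \<and> bicirculant (levi_graph C) \<and>
        \<not> configuration_iso C desargues \<longrightarrow> splittable C)"
  using configuration3_fano configuration3_moebius_kantor configuration3_desargues
    exceptional_isomorphisms unsplittable_exceptional splittable_flag_transitive_bicirculant by blast

end
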